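(* Let $N$ be a set of ground closures of Horn clauses that is saturated, i.e. every ground Parallel Superposition I, Parallel Superposition II or Equality Resolution inference whose premises are in $N$ belongs to $\mathrm{Red}_I(N)$, and suppose $N$ does not contain $\bot$. Then $R_*\models N$, where $R_*$ is the candidate interpretation constructed from $N$.
   Context: Fix a signature and a reduction ordering $\succ$ on terms, total on ground terms. A clause is a finite multiset of literals $s\approx t$ / $s\not\approx t$ ($\approx$ symmetric); $\bot$ empty clause; Horn clause: at most one positive literal. $\succ_L$: map $s\approx t$ to $\{s,t\}$, $s\not\approx t$ to $\{s,s,t,t\}$, compare by multiset extension of $\succ$; $\succ_C$: multiset extension of $\succ_L$. $L$ maximal in $C\lor L$: no literal of $C$ larger; strictly maximal: none larger or equal. Most general unifiers are idempotent. A ground closure $(C\cdot\theta)$: clause $C$, substitution $\theta$ with $C\theta$ ground; identified up to bijective renaming of $C$ when instances coincide; $(\bot\cdot\theta)=\bot$. Ground rewrite system $R$: contained in $\succ$ if $u\succ v$ for all rules; left-reduced if no left-hand side is reducible by the other rules; $t{\downarrow}_R$ normal form; $R\models(C\cdot\theta)$ means $C\theta$ true in the equational interpretation generated by $R$. Ordering $\succ\!\!\succ_R$ (for left-reduced ground $R$ contained in $\succ$): $\mathrm{ss}^-(C)$: all subterms (including top) of sides of negative literals of $C$; $\mathrm{ss}^+_{>\epsilon}(C)$: subterms at non-top positions of sides of positive literals; $\mathrm{ts}^-(C)$, $\mathrm{ts}^+(C)$: sides of negative, resp. positive literals (all sets, not multisets). $\mathrm{lss}(C)=\{(t,2)\mid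 t\in\mathrm{ss}^-(C)\}\cup\{(t,1)\mid t\in\mathrm{ss}^+_{>\epsilon}(C)\setminus\mathrm{ss}^-(C)\}\cup\{(t,0)\mid t\in\mathrm{ts}^+(C)\setminus(\mathrm{ss}^+_{>\epsilon}(C)\cup\mathrm{ss}^-(C))\}$; $\mathrm{lts}(C)=\{(t,2)\mid t\in\mathrm{ts}^-(C)\}\cup\{(t,0)\mid t\in\mathrm{ts}^+(C)\setminus\mathrm{ts}^-(C)\}$. $\mathrm{rm}_R(t,m)$ ($m\in\{0,1,2\}$): $\emptyset$ if $t$ irreducible; $\{(u,m)\}\cup\mathrm{rm}_R(t',m)$ if $t\to_Rt'$ by $u\to v$ at position $p$ with $p=\epsilon$ or $m>0$; $\{(u,1)\}\cup\mathrm{rm}_R(t',m)$ if at $p>\epsilon$ and $m=0$ (well-defined). $\mathrm{nm}_R(C\cdot\theta)=\bigcup_{(f(t_1,\dots,t_n),m)\in\mathrm{lss}(C)}\mathrm{rm}_R(f(t_1\theta{\downarrow}_R,\dots,t_n\theta{\downarrow}_R),m)\cup\bigcup_{(x,m)\in\mathrm{lss}(C),x\text{ variable}}\mathrm{rm}_R(x\theta,m)\cup\bigcup_{(t,m)\in\mathrm{lts}(C)}\{(t\theta{\downarrow}_R,m)\}$. Fix a well-founded $\succ_{Clo}$ on ground closures, total on closures with equal ground instance, with $(C\cdot\theta_1)\succ_{Clo}(D\cdot\theta_2)$ whenever $C\theta_1=D\theta_2$ and $D$ is an instance of $C$ but not vice versa. $\succ\!\!\succ_R$: lexicographic combination of (1)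 the multiset extension of (lexicographic $\succ$ on terms, $>$ on labels) on $\mathrm{nm}_R$; (2) $\succ_C$ on ground instances; (3) $\succ_{Clo}$. $\prec\!\!\prec_R$ converse. Ground inferences (premises renamed apart, one $\theta$): Parallel Superposition I: from $(D'\lor t\approx t'\cdot\theta)$ and $(C[u,\dots,u]_{p_1,\dots,p_k}\cdot\theta)$ derive $((D'\lor C[t',\dots,t']_{p_1,\dots,p_k})\sigma\cdot\theta)$, $u$ non-variable, $t\theta=u\theta$, $\sigma=\mathrm{mgu}(t\doteq u)$, $p_i$ all occurrences of $u$ in $C$; if an occurrence of $u$ is in a negative literal or below the top in a positive literal then $(D'\lor t\approx t')\theta\prec_C C\theta$; one occurrence of $u$ is in a positive literal $s[u]\approx s'$ with $(s[u]\approx s')\theta$ strictly maximal in $C\theta$ or in a negative literal $s[u]\not\approx s'$ with $(s[u]\not\approx s')\theta$ maximal in $C\theta$; $s[u]\theta\succ s'\theta$; $(t\approx t')\theta$ strictly maximal in $(D'\lor t\approx t')\theta$; $t\theta\succ t'\theta$. Parallel Superposition II: from $(D'\lor t\approx t'\cdot\theta)$ and $(C\cdot\theta)$ derive $(D'\lor C\cdot\theta[x\mapsto u[t'\theta]])$, $x$ a variable of $C$ with $x\theta=u[t\theta]$, same remaining conditions with $x$ for $u$. Equality Resolution: from $(C'\lor s\not\approx s'\cdot\theta)$ derive $(C'\sigma\cdot\theta)$, $s\theta=s'\theta$, $\sigma=\mathrm{mgu}(s\doteq s')$, $(s\not\approx s')\theta$ maximal. Second/only premise = right/only premise. $\mathrm{Red}_I(N)$: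 a ground inference $\iota$ with right/only premise $(C\cdot\theta)$ is in it iff for every left-reduced ground $R$ contained in $\succ$: (i) $R\models\mathrm{concl}(\iota)$; or (ii) some $(C'\cdot\theta')\in N$ with $(C'\cdot\theta')\prec\!\!\prec_R(C\cdot\theta)$ and $R\not\models(C'\cdot\theta')$; or (iii) $\iota$ is a Parallel Superposition inference with left premise $(D'\lor t\approx t'\cdot\theta)$, $t\theta\succ t'\theta$, $(t\theta\to t'\theta)\notin R$; or (iv) $\iota$ is a Parallel Superposition inference whose left premise is not the $\succ\!\!\succ_R$-minimal premise. Candidate interpretation from $N$: by induction on ground terms $s$ w.r.t. $\succ$, $R_s=\bigcup_{t\prec s}E_t$, and $E_s=\{s\to s'\}$ if $(C\cdot\theta)$ is the $\succ\!\!\succ_{R_s}$-smallest closure in $N$ such that $C=C'\lor u\approx u'$, $s=u\theta$ is a strictly maximal term in $C\theta$ (every other term occurring in $C\theta$ is $\prec s$), occurs only in positive literals of $C\theta$ and is $R_s$-irreducible, $s'=u'\theta$, $C\theta$ is false in $R_s$, and $s\succ s'$ (then $(C\cdot\theta)$ produces $s\to s'$); $E_s=\emptyset$ if no such closure exists. $R_*=\bigcup_t E_t$. *)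

theory Defs
  imports "HOL-Library.Multiset" "HOL-Library.Uprod"
begin

section \<open>Terms, literals, clauses\<close>

datatype ('f, vars_trm: 'v) trm = Var 'v | Fun 'f "('f, 'v) trm list"

type_synonym ('f, 'v) subst = "'v \<Rightarrow> ('f, 'v) trm"
type_synonym ('f, 'v) trs = "(('f, 'v) trm \<times> ('f, 'v) trm) set"
type_synonym ('f, 'v) trm_rel = "('f, 'v) trm \<Rightarrow> ('f, 'v) trm \<Rightarrow> bool"

text \<open>A signature is a set of function symbols paired with their arities; the type
  \<^type>\<open>trm\<close> itself does not enforce arities.\<close>

fun wf_trm :: "('f \<times> nat) set \<Rightarrow> ('f, 'v) trm \<Rightarrow> bool" where
  "wf_trm F (Var x) = True"
| "wf_trm F (Fun f ts) = ((f, length ts) \<in> F \<and> (\<forall>t \<in> set ts. wf_trm F t))"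

definition ground_trm :: "('f, 'v) trm \<Rightarrow> bool" where
  "ground_trm t \<longleftrightarrow> vars_trm t = {}"

fun subst_trm :: "('f, 'v) trm \<Rightarrow> ('f, 'v) subst \<Rightarrow> ('f, 'v) trm" where
  "subst_trm (Var x) \<theta> = \<theta> x"
| "subst_trm (Fun f ts) \<theta> = Fun f (map (\<lambda>t. subst_trm t \<theta>) ts)"

definition subst_comp :: "('f, 'v) subst \<Rightarrow> ('f, 'v) subst \<Rightarrow> ('f, 'v) subst" where
  "subst_comp \<sigma> \<tau> = (\<lambda>x. subst_trm (\<sigma> x) \<tau>)"

lemma size_nth_arg [termination_simp]: "i < length ts \<Longrightarrow> size (ts ! i) < Suc (size_list size ts)"
  using size_list_estimation'[OF nth_mem, of i ts "size (ts ! i)" size] by simp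

context
  notes conj_cong [fundef_cong]
begin

fun poss :: "('f, 'v) trm \<Rightarrow> nat list set" where
  "poss (Var x) = {[]}"
| "poss (Fun f ts) = insert [] {i # p |i p. i < length ts \<and> p \<in> poss (ts ! i)}"

end

fun subt_at :: "('f, 'v) trm \<Rightarrow> nat list \<Rightarrow> ('f, 'v) trm" where
  "subt_at t [] = t"
| "subt_at (Fun f ts) (i # p) = subt_at (ts ! i) p"

fun replace_at :: "('f, 'v) trm \<Rightarrow> nat list \<Rightarrow> ('f, 'v) trm \<Rightarrow> ('f, 'v) trm" where
  "replace_at t [] s = s"
| "replace_at (Fun f ts) (i # p) s = Fun f (ts[i := replace_at (ts ! i) p s])"

definition subterms :: "('f, 'v) trm \<Rightarrow> ('f, 'v) trm set" where
  "subterms t = subt_at t ` poss t"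

definition proper_subterms :: "('f, 'v) trm \<Rightarrow> ('f, 'v) trm set" where
  "proper_subterms t = subt_at t ` (poss t - {[]})"

text \<open>Replacement of all occurrences of \<open>u\<close> (which cannot overlap) by \<open>v\<close>.\<close>

fun replace_all :: "('f, 'v) trm \<Rightarrow> ('f, 'v) trm \<Rightarrow> ('f, 'v) trm \<Rightarrow> ('f, 'v) trm" where
  "replace_all u v (Var x) = (if Var x = u then v else Var x)"
| "replace_all u v (Fun f ts) = (if Fun f ts = u then v else Fun f (map (replace_all u v) ts))"

text \<open>An equation is an unordered pair of terms, so that symmetry of equality is built in.\<close>

datatype 'a literal = is_Pos: Pos (atm: 'a) | Neg (atm: 'a)

type_synonym ('f, 'v) lit = "('f, 'v) trm uprod literal"
type_synonym ('f, 'v) clause = "('f, 'v) lit multiset"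

definition map_lit :: "(('f, 'v) trm \<Rightarrow> ('f, 'v) trm) \<Rightarrow> ('f, 'v) lit \<Rightarrow> ('f, 'v) lit" where
  "map_lit h = map_literal (map_uprod h)"

definition subst_lit :: "('f, 'v) lit \<Rightarrow> ('f, 'v) subst \<Rightarrow> ('f, 'v) lit" where
  "subst_lit L \<theta> = map_lit (\<lambda>t. subst_trm t \<theta>) L"

definition subst_cls :: "('f, 'v) clause \<Rightarrow> ('f, 'v) subst \<Rightarrow> ('f, 'v) clause" where
  "subst_cls C \<theta> = image_mset (\<lambda>L. subst_lit L \<theta>) C"

definition sides :: "('f, 'v) lit \<Rightarrow> ('f, 'v) trm set" where
  "sides L = set_uprod (atm L)"

definition vars_cls :: "('f, 'v) clause \<Rightarrow> 'v set" where
  "vars_cls C = (\<Union>L \<in> set_mset C. \<Union>t \<in> sides L. vars_trm t)"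

definition wf_cls :: "('f \<times> nat) set \<Rightarrow> ('f, 'v) clause \<Rightarrow> bool" where
  "wf_cls F C \<longleftrightarrow> (\<forall>L \<in># C. \<forall>t \<in> sides L. wf_trm F t)"

definition ground_cls :: "('f, 'v) clause \<Rightarrow> bool" where
  "ground_cls C \<longleftrightarrow> vars_cls C = {}"

definition horn :: "('f, 'v) clause \<Rightarrow> bool" where
  "horn C \<longleftrightarrow> size (filter_mset is_Pos C) \<le> 1"

definition instance_of :: "('f, 'v) clause \<Rightarrow> ('f, 'v) clause \<Rightarrow> bool" where
  "instance_of D C \<longleftrightarrow> (\<exists>\<sigma>. D = subst_cls C \<sigma>)"

definition unifier :: "('f, 'v) subst \<Rightarrow> ('f, 'v) trm \<Rightarrow> ('f, 'v) trm \<Rightarrow> bool" where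
  "unifier \<sigma> s t \<longleftrightarrow> subst_trm s \<sigma> = subst_trm t \<sigma>"

definition idem_mgu :: "('f, 'v) subst \<Rightarrow> ('f, 'v) trm \<Rightarrow> ('f, 'v) trm \<Rightarrow> bool" where
  "idem_mgu \<sigma> s t \<longleftrightarrow>
     unifier \<sigma> s t \<and> (\<forall>\<tau>. unifier \<tau> s t \<longrightarrow> (\<exists>\<delta>. \<tau> = subst_comp \<sigma> \<delta>)) \<and> subst_comp \<sigma> \<sigma> = \<sigma>"


section \<open>Orderings on terms, literals and clauses\<close>

text \<open>All orderings are passed in the ``smaller than'' direction. A reduction ordering relates
  only terms over the signature; this matters because the multiset extension is a transitive
  closure.\<close>

definition reduction_ordering :: "('f \<times> nat) set \<Rightarrow> ('f, 'v) trm_rel \<Rightarrow> bool" where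
  "reduction_ordering F lt \<longleftrightarrow>
     (\<forall>s t. lt s t \<longrightarrow> wf_trm F s \<and> wf_trm F t) \<and>
     transp lt \<and> wfp lt \<and>
     (\<forall>s t \<sigma>. lt s t \<and> (\<forall>x. wf_trm F (\<sigma> x)) \<longrightarrow> lt (subst_trm s \<sigma>) (subst_trm t \<sigma>)) \<and>
     (\<forall>s t f us vs. lt s t \<and> wf_trm F (Fun f (us @ s # vs)) \<longrightarrow>
        lt (Fun f (us @ s # vs)) (Fun f (us @ t # vs)))"

lift_definition mset_uprod :: "'a uprod \<Rightarrow> 'a multiset" is "\<lambda>(x, y). {#x, y#}"
  by (auto simp: add_mset_commute)

fun mset_lit :: "('f, 'v) lit \<Rightarrow> ('f, 'v) trm multiset" where
  "mset_lit (Pos A) = mset_uprod A"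
| "mset_lit (Neg A) = mset_uprod A + mset_uprod A"

definition lit_less :: "('f, 'v) trm_rel \<Rightarrow> ('f, 'v) lit \<Rightarrow> ('f, 'v) lit \<Rightarrow> bool" where
  "lit_less lt L K \<longleftrightarrow> multp lt (mset_lit L) (mset_lit K)"

definition cls_less :: "('f, 'v) trm_rel \<Rightarrow> ('f, 'v) clause \<Rightarrow> ('f, 'v) clause \<Rightarrow> bool" where
  "cls_less lt = multp (lit_less lt)"

definition maximal_lit :: "('f, 'v) trm_rel \<Rightarrow> ('f, 'v) lit \<Rightarrow> ('f, 'v) clause \<Rightarrow> bool" where
  "maximal_lit lt L C \<longleftrightarrow> L \<in># C \<and> (\<forall>K \<in># C - {#L#}. \<not> lit_less lt L K)"

definition strictly_maximal_lit :: "('f, 'v) trm_rel \<Rightarrow> ('f, 'v) lit \<Rightarrow> ('f, 'v) clause \<Rightarrow> bool" where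
  "strictly_maximal_lit lt L C \<longleftrightarrow> L \<in># C \<and> (\<forall>K \<in># C - {#L#}. \<not> lit_less lt L K \<and> K \<noteq> L)"


section \<open>Ground rewrite systems\<close>

text \<open>Rules are ground, so a redex is literally a left-hand side.\<close>

definition rstep :: "('f, 'v) trs \<Rightarrow> ('f, 'v) trs" where
  "rstep R = {(t, t'). \<exists>u v p. (u, v) \<in> R \<and> p \<in> poss t \<and> subt_at t p = u \<and> t' = replace_at t p v}"

definition irreducible :: "('f, 'v) trs \<Rightarrow> ('f, 'v) trm \<Rightarrow> bool" where
  "irreducible R t \<longleftrightarrow> (\<nexists>t'. (t, t') \<in> rstep R)"

definition ground_trs :: "('f, 'v) trs \<Rightarrow> bool" where
  "ground_trs R \<longleftrightarrow> (\<forall>(u, v) \<in> R. ground_trm u \<and> ground_trm v)"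

definition contained_in :: "('f, 'v) trs \<Rightarrow> ('f, 'v) trm_rel \<Rightarrow> bool" where
  "contained_in R lt \<longleftrightarrow> (\<forall>(u, v) \<in> R. lt v u)"

definition left_reduced :: "('f, 'v) trs \<Rightarrow> bool" where
  "left_reduced R \<longleftrightarrow> (\<forall>(u, v) \<in> R. irreducible (R - {(u, v)}) u)"

definition normal_form :: "('f, 'v) trs \<Rightarrow> ('f, 'v) trm \<Rightarrow> ('f, 'v) trm" where
  "normal_form R t = (THE t'. (t, t') \<in> (rstep R)\<^sup>* \<and> irreducible R t')"

definition eq_true :: "('f, 'v) trs \<Rightarrow> ('f, 'v) trm uprod \<Rightarrow> bool" where
  "eq_true R A \<longleftrightarrow> (\<exists>s t. A = Upair s t \<and> (s, t) \<in> (rstep R \<union> (rstep R)\<inverse>)\<^sup>*)"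

fun lit_true :: "('f, 'v) trs \<Rightarrow> ('f, 'v) lit \<Rightarrow> bool" where
  "lit_true R (Pos A) = eq_true R A"
| "lit_true R (Neg A) = (\<not> eq_true R A)"

definition cls_true :: "('f, 'v) trs \<Rightarrow> ('f, 'v) clause \<Rightarrow> bool" where
  "cls_true R C \<longleftrightarrow> (\<exists>L \<in># C. lit_true R L)"


section \<open>The multisets of labelled redexes and normal forms\<close>

definition ss_neg :: "('f, 'v) clause \<Rightarrow> ('f, 'v) trm set" where
  "ss_neg C = (\<Union>L \<in> {L. L \<in># C \<and> \<not> is_Pos L}. \<Union>t \<in> sides L. subterms t)"

definition ss_pos_below :: "('f, 'v) clause \<Rightarrow> ('f, 'v) trm set" where
  "ss_pos_below C = (\<Union>L \<in> {L. L \<in># C \<and> is_Pos L}. \<Union>t \<in> sides L. proper_subterms t)"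

definition ts_neg :: "('f, 'v) clause \<Rightarrow> ('f, 'v) trm set" where
  "ts_neg C = (\<Union>L \<in> {L. L \<in># C \<and> \<not> is_Pos L}. sides L)"

definition ts_pos :: "('f, 'v) clause \<Rightarrow> ('f, 'v) trm set" where
  "ts_pos C = (\<Union>L \<in> {L. L \<in># C \<and> is_Pos L}. sides L)"

definition lss :: "('f, 'v) clause \<Rightarrow> (('f, 'v) trm \<times> nat) set" where
  "lss C = ss_neg C \<times> {2} \<union> (ss_pos_below C - ss_neg C) \<times> {1}
     \<union> (ts_pos C - (ss_pos_below C \<union> ss_neg C)) \<times> {0}"

definition lts :: "('f, 'v) clause \<Rightarrow> (('f, 'v) trm \<times> nat) set" where
  "lts C = ts_neg C \<times> {2} \<union> (ts_pos C - ts_neg C) \<times> {0}"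

text \<open>One derivation of the redex multiset for each reduction of the term to normal form; for
  left-reduced ground systems contained in a reduction ordering the resulting multiset is unique,
  and \<open>rm\<close> denotes it. Redexes are counted with multiplicity, so unions of redex multisets
  are sums.\<close>

inductive redexes :: "('f, 'v) trs \<Rightarrow> ('f, 'v) trm \<Rightarrow> nat \<Rightarrow> (('f, 'v) trm \<times> nat) multiset \<Rightarrow> bool"
  for R where
  irred: "irreducible R t \<Longrightarrow> redexes R t m {#}"
| same_label: "(u, v) \<in> R \<Longrightarrow> p \<in> poss t \<Longrightarrow> subt_at t p = u \<Longrightarrow> p = [] \<or> m > 0 \<Longrightarrow>
    redexes R (replace_at t p v) m M \<Longrightarrow> redexes R t m ({#(u, m)#} + M)"
| below_top: "(u, v) \<in> R \<Longrightarrow> p \<in> poss t \<Longrightarrow> subt_at t p = u \<Longrightarrow> p \<noteq> [] \<Longrightarrow> m = 0 \<Longrightarrow>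
    redexes R (replace_at t p v) m M \<Longrightarrow> redexes R t m ({#(u, 1)#} + M)"

definition rm :: "('f, 'v) trs \<Rightarrow> ('f, 'v) trm \<Rightarrow> nat \<Rightarrow> (('f, 'v) trm \<times> nat) multiset" where
  "rm R t m = (THE M. redexes R t m M)"

fun rm_arg :: "('f, 'v) trs \<Rightarrow> ('f, 'v) subst \<Rightarrow> ('f, 'v) trm \<times> nat \<Rightarrow> (('f, 'v) trm \<times> nat) multiset" where
  "rm_arg R \<theta> (Var x, m) = rm R (\<theta> x) m"
| "rm_arg R \<theta> (Fun f ts, m) = rm R (Fun f (map (\<lambda>t. normal_form R (subst_trm t \<theta>)) ts)) m"

definition nm_raw :: "('f, 'v) trs \<Rightarrow> ('f, 'v) clause \<Rightarrow> ('f, 'v) subst \<Rightarrow> (('f, 'v) trm \<times> nat) multiset" where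
  "nm_raw R C \<theta> =
     (\<Sum>tm \<in> lss C. rm_arg R \<theta> tm) + (\<Sum>(t, m) \<in> lts C. {#(normal_form R (subst_trm t \<theta>), m)#})"


section \<open>Ground closures\<close>

text \<open>Closures are identified up to a bijective renaming of the clause that the substitutions
  follow. Equality of the two ground clauses alone would be too coarse, since it could also permute
  the values of the variables among literals, which changes the labelled redexes; closures of the
  empty clause are all identified because it has no variables.\<close>

definition gc_rel :: "('f, 'v) clause \<times> ('f, 'v) subst \<Rightarrow> ('f, 'v) clause \<times> ('f, 'v) subst \<Rightarrow> bool" where
  "gc_rel = (\<lambda>(C, \<theta>) (D, \<tau>). ground_cls (subst_cls C \<theta>) \<and> ground_cls (subst_cls D \<tau>) \<and>
     (\<exists>\<rho>. bij \<rho> \<and> D = subst_cls C (Var \<circ> \<rho>) \<and> (\<forall>x \<in> vars_cls C. \<theta> x = \<tau> (\<rho> x))))"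

lemma subst_trm_cong: "(\<And>x. x \<in> vars_trm t \<Longrightarrow> \<theta> x = \<tau> x) \<Longrightarrow> subst_trm t \<theta> = subst_trm t \<tau>"
  by (induction t) auto

lemma subst_trm_comp: "subst_trm (subst_trm t \<sigma>) \<tau> = subst_trm t (subst_comp \<sigma> \<tau>)"
  by (induction t) (auto simp: subst_comp_def)

lemma subst_trm_Var: "subst_trm t Var = t"
  by (induction t) (auto simp: map_idI)

lemma map_lit_comp: "map_lit g (map_lit h L) = map_lit (g \<circ> h) L"
  by (cases L) (auto simp: map_lit_def uprod.map_comp)

lemma map_lit_cong: "(\<And>t. t \<in> sides L \<Longrightarrow> g t = h t) \<Longrightarrow> map_lit g L = map_lit h L"
  by (cases L) (auto simp: map_lit_def sides_def intro: uprod.map_cong)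

lemma sides_map_lit: "sides (map_lit h L) = h ` sides L"
  by (cases L) (auto simp: map_lit_def sides_def uprod.set_map)

lemma is_Pos_map_lit: "is_Pos (map_lit h L) = is_Pos L"
  by (cases L) (auto simp: map_lit_def)

lemma vars_subst_trm: "vars_trm (subst_trm t \<theta>) = (\<Union>x \<in> vars_trm t. vars_trm (\<theta> x))"
  by (induction t) auto

lemma subst_cls_cong: "(\<And>x. x \<in> vars_cls C \<Longrightarrow> \<theta> x = \<tau> x) \<Longrightarrow> subst_cls C \<theta> = subst_cls C \<tau>"
  unfolding subst_cls_def subst_lit_def vars_cls_def
  by (intro image_mset_cong map_lit_cong subst_trm_cong) blast

lemma subst_cls_comp: "subst_cls (subst_cls C \<sigma>) \<tau> = subst_cls C (subst_comp \<sigma> \<tau>)"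
  by (simp add: subst_cls_def subst_lit_def multiset.map_comp comp_def map_lit_comp subst_trm_comp)

lemma subst_cls_Var: "subst_cls (C :: ('f, 'v) clause) Var = C"
proof -
  have "subst_lit L Var = L" for L :: "('f, 'v) lit"
    by (cases L) (simp_all add: subst_lit_def subst_trm_Var map_lit_def uprod.map_ident)
  then show ?thesis by (simp add: subst_cls_def)
qed

lemma vars_subst_cls: "vars_cls (subst_cls C \<theta>) = (\<Union>x \<in> vars_cls C. vars_trm (\<theta> x))"
  by (simp add: vars_cls_def subst_cls_def subst_lit_def sides_map_lit vars_subst_trm)

lemma gc_rel_inst: "gc_rel (C, \<theta>) (D, \<tau>) \<Longrightarrow> subst_cls C \<theta> = subst_cls D \<tau>"
  unfolding gc_rel_def by (auto simp: subst_cls_comp subst_comp_def intro!: subst_cls_cong)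

lemma gc_rel_sym: "gc_rel a b \<Longrightarrow> gc_rel b a"
proof -
  assume ab: "gc_rel a b"
  obtain C \<theta> D \<tau> where e: "a = (C, \<theta>)" "b = (D, \<tau>)" by (cases a, cases b)
  from ab obtain \<rho> where \<rho>: "bij \<rho>" "D = subst_cls C (Var \<circ> \<rho>)" "\<forall>x \<in> vars_cls C. \<theta> x = \<tau> (\<rho> x)"
    and g: "ground_cls (subst_cls C \<theta>)" "ground_cls (subst_cls D \<tau>)"
    by (auto simp: e gc_rel_def)
  have i: "inv \<rho> (\<rho> x) = x" for x
    using \<rho>(1) by (simp add: bij_is_inj)
  have 1: "C = subst_cls D (Var \<circ> inv \<rho>)"
    by (simp add: \<rho>(2) subst_cls_comp subst_comp_def i subst_cls_Var[simplified])
  have 2: "\<forall>x \<in> vars_cls D. \<tau> x = \<theta> (inv \<rho> x)"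
    using \<rho>(3) by (auto simp: \<rho>(2) vars_subst_cls i)
  show ?thesis
    using g 1 2 \<rho>(1) unfolding e gc_rel_def by (auto intro!: exI[of _ "inv \<rho>"] bij_imp_bij_inv)
qed

lemma gc_rel_trans: "gc_rel a b \<Longrightarrow> gc_rel b c \<Longrightarrow> gc_rel a c"
proof -
  assume ab: "gc_rel a b" and bc: "gc_rel b c"
  obtain C \<theta> D \<tau> E \<eta> where e: "a = (C, \<theta>)" "b = (D, \<tau>)" "c = (E, \<eta>)"
    by (cases a, cases b, cases c)
  from ab obtain \<rho> where \<rho>: "bij \<rho>" "D = subst_cls C (Var \<circ> \<rho>)" "\<forall>x \<in> vars_cls C. \<theta> x = \<tau> (\<rho> x)"
    and g: "ground_cls (subst_cls C \<theta>)"
    by (auto simp: e gc_rel_def)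
  from bc obtain \<pi> where \<pi>: "bij \<pi>" "E = subst_cls D (Var \<circ> \<pi>)" "\<forall>x \<in> vars_cls D. \<tau> x = \<eta> (\<pi> x)"
    and g': "ground_cls (subst_cls E \<eta>)"
    by (auto simp: e gc_rel_def)
  have "E = subst_cls C (Var \<circ> (\<pi> \<circ> \<rho>))"
    by (simp add: \<pi>(2) \<rho>(2) subst_cls_comp subst_comp_def comp_def)
  moreover have "\<forall>x \<in> vars_cls C. \<theta> x = \<eta> ((\<pi> \<circ> \<rho>) x)"
    using \<rho>(3) \<pi>(3) by (auto simp: \<rho>(2) vars_subst_cls)
  ultimately show ?thesis
    using g g' bij_comp[OF \<rho>(1) \<pi>(1)] unfolding e gc_rel_def by blast
qed

quotient_type ('f, 'v) gclosure = "('f, 'v) clause \<times> ('f, 'v) subst" / partial: gc_rel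
proof (rule part_equivpI)
  have "gc_rel ({#}, Var) ({#}, Var)"
    by (auto simp: gc_rel_def ground_cls_def vars_cls_def subst_cls_def intro!: exI[of _ id])
  then show "\<exists>x. gc_rel x x" ..
  show "symp gc_rel" by (auto intro: sympI gc_rel_sym)
  show "transp gc_rel" by (auto intro: transpI gc_rel_trans)
qed

text \<open>\<open>gclo C \<theta>\<close> is meaningful only if \<open>C\<theta>\<close> is ground.\<close>

definition gclo :: "('f, 'v) clause \<Rightarrow> ('f, 'v) subst \<Rightarrow> ('f, 'v) gclosure" where
  "gclo C \<theta> = abs_gclosure (C, \<theta>)"

definition bot_closure :: "('f, 'v) gclosure" where
  "bot_closure = gclo {#} Var"

lift_definition inst :: "('f, 'v) gclosure \<Rightarrow> ('f, 'v) clause" is "\<lambda>(C, \<theta>). subst_cls C \<theta>"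
  by (auto dest: gc_rel_inst)

lemma finite_poss: "finite (poss t)"
proof (induction t)
  case (Fun f ts)
  have "{i # p |i p. i < length ts \<and> p \<in> poss (ts ! i)} = (\<Union>i<length ts. (#) i ` poss (ts ! i))"
    by auto
  then show ?case using Fun by simp
qed simp

lemma poss_rename: "poss (subst_trm t (Var \<circ> \<rho>)) = poss t"
  by (induction t) auto

lemma subt_at_rename:
  "p \<in> poss t \<Longrightarrow> subt_at (subst_trm t (Var \<circ> \<rho>)) p = subst_trm (subt_at t p) (Var \<circ> \<rho>)"
  by (induction t arbitrary: p) auto

lemma subterms_rename:
  "subterms (subst_trm t (Var \<circ> \<rho>)) = (\<lambda>s. subst_trm s (Var \<circ> \<rho>)) ` subterms t"
  by (auto simp: subterms_def poss_rename subt_at_rename image_image)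

lemma proper_subterms_rename:
  "proper_subterms (subst_trm t (Var \<circ> \<rho>)) = (\<lambda>s. subst_trm s (Var \<circ> \<rho>)) ` proper_subterms t"
  by (auto simp: proper_subterms_def poss_rename subt_at_rename image_image)

lemma vars_subt_at: "p \<in> poss t \<Longrightarrow> vars_trm (subt_at t p) \<subseteq> vars_trm t"
proof (induction t arbitrary: p)
  case (Fun f ts)
  show ?case
  proof (cases p)
    case (Cons i q)
    then have "i < length ts" "q \<in> poss (ts ! i)" using Fun.prems by auto
    then have "vars_trm (subt_at (ts ! i) q) \<subseteq> vars_trm (ts ! i)" "ts ! i \<in> set ts"
      using Fun.IH by auto
    then show ?thesis using Cons by auto
  qed simp
qed simp

lemma inj_rename: "bij \<rho> \<Longrightarrow> inj (\<lambda>s. subst_trm s (Var \<circ> \<rho>))"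
  by (rule inj_on_inverseI[of _ "\<lambda>s. subst_trm s (Var \<circ> inv \<rho>)"])
    (simp add: subst_trm_comp subst_comp_def bij_is_inj subst_trm_Var)

lemma subst_cls_lits:
  "{L. L \<in># subst_cls C \<sigma> \<and> is_Pos L} = (\<lambda>L. subst_lit L \<sigma>) ` {L. L \<in># C \<and> is_Pos L}"
  "{L. L \<in># subst_cls C \<sigma> \<and> \<not> is_Pos L} = (\<lambda>L. subst_lit L \<sigma>) ` {L. L \<in># C \<and> \<not> is_Pos L}"
  by (auto simp: subst_cls_def subst_lit_def is_Pos_map_lit)

lemma lss_vars: "(t, m) \<in> lss C \<Longrightarrow> vars_trm t \<subseteq> vars_cls C"
  unfolding lss_def ss_neg_def ss_pos_below_def ts_pos_def vars_cls_def subterms_def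
    proper_subterms_def using vars_subt_at by fastforce

lemma lts_vars: "(t, m) \<in> lts C \<Longrightarrow> vars_trm t \<subseteq> vars_cls C"
  unfolding lts_def ts_neg_def ts_pos_def vars_cls_def by auto

lemma sets_rename:
  assumes "D = subst_cls C (Var \<circ> \<rho>)"
  shows "ss_neg D = (\<lambda>s. subst_trm s (Var \<circ> \<rho>)) ` ss_neg C"
    "ss_pos_below D = (\<lambda>s. subst_trm s (Var \<circ> \<rho>)) ` ss_pos_below C"
    "ts_neg D = (\<lambda>s. subst_trm s (Var \<circ> \<rho>)) ` ts_neg C"
    "ts_pos D = (\<lambda>s. subst_trm s (Var \<circ> \<rho>)) ` ts_pos C"
  unfolding assms ss_neg_def ss_pos_below_def ts_neg_def ts_pos_def subst_cls_lits
  by (simp_all add: subst_lit_def sides_map_lit subterms_rename proper_subterms_rename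
      image_UN)

lemma lss_lts_rename:
  fixes C :: "('f, 'v) clause"
  assumes "bij \<rho>" and D: "D = subst_cls C (Var \<circ> \<rho>)"
  shows "lss D = map_prod (\<lambda>s. subst_trm s (Var \<circ> \<rho>)) id ` lss C"
    "lts D = map_prod (\<lambda>s. subst_trm s (Var \<circ> \<rho>)) id ` lts C"
proof -
  have *: "map_prod h id ` (A \<times> {k}) = (h ` A) \<times> {k}" for h :: "('f, 'v) trm \<Rightarrow> ('f, 'v) trm" and A and k :: nat
    by force
  show "lss D = map_prod (\<lambda>s. subst_trm s (Var \<circ> \<rho>)) id ` lss C"
    "lts D = map_prod (\<lambda>s. subst_trm s (Var \<circ> \<rho>)) id ` lts C"
    unfolding lss_def lts_def sets_rename[OF D] image_Un *
      image_set_diff[OF inj_rename[OF assms(1)]] by simp_all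
qed

lemma nm_raw_rename:
  assumes "gc_rel (C, \<theta>) (D, \<tau>)"
  shows "nm_raw R C \<theta> = nm_raw R D \<tau>"
proof -
  from assms obtain \<rho> where \<rho>: "bij \<rho>" "D = subst_cls C (Var \<circ> \<rho>)" "\<forall>x \<in> vars_cls C. \<theta> x = \<tau> (\<rho> x)"
    by (auto simp: gc_rel_def)
  let ?h = "map_prod (\<lambda>s. subst_trm s (Var \<circ> \<rho>)) (id :: nat \<Rightarrow> nat)"
  have inj: "inj ?h" using inj_rename[OF \<rho>(1)] by (intro prod.inj_map) simp_all
  have s: "subst_trm (subst_trm t (Var \<circ> \<rho>)) \<tau> = subst_trm t \<theta>" if "vars_trm t \<subseteq> vars_cls C" for t
    unfolding subst_trm_comp using that \<rho>(3) by (intro subst_trm_cong) (auto simp: subst_comp_def)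
  have 1: "rm_arg R \<tau> (?h tm) = rm_arg R \<theta> tm" if "tm \<in> lss C" for tm
  proof -
    obtain t m where tm: "tm = (t, m)" by (cases tm)
    have v: "vars_trm t \<subseteq> vars_cls C" using lss_vars that tm by blast
    show ?thesis
    proof (cases t)
      case (Var x)
      then show ?thesis using v \<rho>(3) tm by simp
    next
      case (Fun f ts)
      then have "\<forall>a \<in> set ts. vars_trm a \<subseteq> vars_cls C" using v by auto
      then show ?thesis using Fun tm s by (auto intro!: arg_cong[of _ _ "\<lambda>xs. rm R (Fun f xs) m"])
    qed
  qed
  have 2: "(\<lambda>(t, m). {#(normal_form R (subst_trm t \<tau>), m)#}) (?h tm)
    = (\<lambda>(t, m). {#(normal_form R (subst_trm t \<theta>), m)#}) tm" if "tm \<in> lts C" for tm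
    using that lts_vars[of "fst tm" "snd tm" C] s[of "fst tm"] by (cases tm) auto
  show ?thesis
    unfolding nm_raw_def lss_lts_rename[OF \<rho>(1,2)] sum.reindex[OF inj_on_subset[OF inj subset_UNIV]]
    by (intro arg_cong2[of _ _ _ _ "(+)"] sum.cong refl) (simp_all add: 1 2 del: map_prod_simp)
qed

lift_definition nm :: "('f, 'v) trs \<Rightarrow> ('f, 'v) gclosure \<Rightarrow> (('f, 'v) trm \<times> nat) multiset"
  is "\<lambda>R (C, \<theta>). nm_raw R C \<theta>"
  by (auto dest: nm_raw_rename)

lemma wf_subst_rename: "wf_trm F (subst_trm t (Var \<circ> \<rho>)) = wf_trm F t"
  by (induction t) auto

lift_definition wf_closure :: "('f \<times> nat) set \<Rightarrow> ('f, 'v) gclosure \<Rightarrow> bool"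
  is "\<lambda>F (C, \<theta>). wf_cls F C \<and> (\<forall>x \<in> vars_cls C. wf_trm F (\<theta> x))"
  by (auto simp: gc_rel_def wf_cls_def vars_subst_cls)
    (auto simp: subst_cls_def subst_lit_def sides_map_lit wf_subst_rename)

lift_definition horn_closure :: "('f, 'v) gclosure \<Rightarrow> bool" is "\<lambda>(C, \<theta>). horn C"
  by (auto simp: gc_rel_def horn_def subst_cls_def subst_lit_def filter_mset_image_mset is_Pos_map_lit)

lemma instance_of_trans: "instance_of C B \<Longrightarrow> instance_of B A \<Longrightarrow> instance_of C A"
  by (auto simp: instance_of_def subst_cls_comp)

lemma gc_rel_instance_of: "gc_rel (C, \<theta>) (D, \<tau>) \<Longrightarrow> instance_of D C"
  by (auto simp: gc_rel_def instance_of_def)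

text \<open>The clause of the first closure is an instance of the clause of the second one.\<close>

lift_definition instance_closure :: "('f, 'v) gclosure \<Rightarrow> ('f, 'v) gclosure \<Rightarrow> bool"
  is "\<lambda>(D, _) (C, _). instance_of D C"
  by (auto, (meson instance_of_trans gc_rel_instance_of gc_rel_sym)+)

type_synonym ('f, 'v) gclosure_rel = "('f, 'v) gclosure \<Rightarrow> ('f, 'v) gclosure \<Rightarrow> bool"

definition closure_ordering :: "('f \<times> nat) set \<Rightarrow> ('f, 'v) gclosure_rel \<Rightarrow> bool" where
  "closure_ordering F ltClo \<longleftrightarrow>
     transp_on (Collect (wf_closure F)) ltClo \<and> wfp_on (Collect (wf_closure F)) ltClo \<and>
     (\<forall>c d. wf_closure F c \<and> wf_closure F d \<and> inst c = inst d \<longrightarrow>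
        (c \<noteq> d \<longrightarrow> ltClo c d \<or> ltClo d c) \<and>
        (instance_closure d c \<and> \<not> instance_closure c d \<longrightarrow> ltClo d c))"

definition label_less :: "('f, 'v) trm_rel \<Rightarrow> ('f, 'v) trm \<times> nat \<Rightarrow> ('f, 'v) trm \<times> nat \<Rightarrow> bool" where
  "label_less lt = (\<lambda>(s, m) (t, n). lt s t \<or> s = t \<and> m < n)"

definition closure_less ::
  "('f, 'v) trm_rel \<Rightarrow> ('f, 'v) gclosure_rel \<Rightarrow> ('f, 'v) trs \<Rightarrow> ('f, 'v) gclosure_rel" where
  "closure_less lt ltClo R c d \<longleftrightarrow>
     multp (label_less lt) (nm R c) (nm R d) \<or>
     nm R c = nm R d \<and> (cls_less lt (inst c) (inst d) \<or> inst c = inst d \<and> ltClo c d)"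

definition closure_true :: "('f, 'v) trs \<Rightarrow> ('f, 'v) gclosure \<Rightarrow> bool" where
  "closure_true R c \<longleftrightarrow> cls_true R (inst c)"


section \<open>Inferences, redundancy, saturation\<close>

text \<open>A parallel superposition inference records its left premise, the ground instance
  \<open>(t\<theta>, t'\<theta>)\<close> of the equation used in it, its right premise, and its conclusion.\<close>

datatype ('f, 'v) inference =
  ParSup "('f, 'v) gclosure" "('f, 'v) trm \<times> ('f, 'v) trm" "('f, 'v) gclosure" "('f, 'v) gclosure"
| EqRes "('f, 'v) gclosure" "('f, 'v) gclosure"

fun prems :: "('f, 'v) inference \<Rightarrow> ('f, 'v) gclosure set" where
  "prems (ParSup l e r c) = {l, r}"
| "prems (EqRes p c) = {p}"

fun right_prem :: "('f, 'v) inference \<Rightarrow> ('f, 'v) gclosure" where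
  "right_prem (ParSup l e r c) = r"
| "right_prem (EqRes p c) = p"

fun concl :: "('f, 'v) inference \<Rightarrow> ('f, 'v) gclosure" where
  "concl (ParSup l e r c) = c"
| "concl (EqRes p c) = c"

abbreviation replace_cls ::
  "('f, 'v) trm \<Rightarrow> ('f, 'v) trm \<Rightarrow> ('f, 'v) clause \<Rightarrow> ('f, 'v) clause" where
  "replace_cls u v C \<equiv> image_mset (map_lit (replace_all u v)) C"

text \<open>The conditions common to both superposition rules; \<open>w\<close> is the overlapped non-variable
  subterm, resp. the variable.\<close>

definition superposition_conds ::
  "('f, 'v) trm_rel \<Rightarrow> ('f, 'v) clause \<Rightarrow> ('f, 'v) trm \<Rightarrow> ('f, 'v) trm \<Rightarrow> ('f, 'v) clause \<Rightarrow>
   ('f, 'v) trm \<Rightarrow> ('f, 'v) subst \<Rightarrow> bool" where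
  "superposition_conds lt D' t t' C w \<theta> \<longleftrightarrow>
     (let D = D' + {#Pos (Upair t t')#} in
      ground_cls (subst_cls D \<theta>) \<and> ground_cls (subst_cls C \<theta>) \<and>
      vars_cls D \<inter> vars_cls C = {} \<and>
      (w \<in> ss_neg C \<union> ss_pos_below C \<longrightarrow> cls_less lt (subst_cls D \<theta>) (subst_cls C \<theta>)) \<and>
      (\<exists>s s' L. L \<in># C \<and> w \<in> subterms s \<and> lt (subst_trm s' \<theta>) (subst_trm s \<theta>) \<and>
         (L = Pos (Upair s s') \<and> strictly_maximal_lit lt (subst_lit L \<theta>) (subst_cls C \<theta>) \<or>
          L = Neg (Upair s s') \<and> maximal_lit lt (subst_lit L \<theta>) (subst_cls C \<theta>))) \<and>
      strictly_maximal_lit lt (subst_lit (Pos (Upair t t')) \<theta>) (subst_cls D \<theta>) \<and>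
      lt (subst_trm t' \<theta>) (subst_trm t \<theta>))"

inductive_set ground_inferences :: "('f, 'v) trm_rel \<Rightarrow> ('f, 'v) inference set"
  for lt :: "('f, 'v) trm_rel" where
  par_sup_I:
  "superposition_conds lt D' t t' C u \<theta> \<Longrightarrow>
   u = Fun f us \<Longrightarrow> subst_trm t \<theta> = subst_trm u \<theta> \<Longrightarrow> idem_mgu \<sigma> t u \<Longrightarrow>
   ParSup (gclo (D' + {#Pos (Upair t t')#}) \<theta>) (subst_trm t \<theta>, subst_trm t' \<theta>) (gclo C \<theta>)
     (gclo (subst_cls (D' + replace_cls u t' C) \<sigma>) \<theta>) \<in> ground_inferences lt"
| par_sup_II:
  "superposition_conds lt D' t t' C (Var x) \<theta> \<Longrightarrow>
   p \<in> poss (\<theta> x) \<Longrightarrow> subt_at (\<theta> x) p = subst_trm t \<theta> \<Longrightarrow>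
   ParSup (gclo (D' + {#Pos (Upair t t')#}) \<theta>) (subst_trm t \<theta>, subst_trm t' \<theta>) (gclo C \<theta>)
     (gclo (D' + C) (\<theta>(x := replace_at (\<theta> x) p (subst_trm t' \<theta>)))) \<in> ground_inferences lt"
| eq_res:
  "ground_cls (subst_cls (C' + {#Neg (Upair s s')#}) \<theta>) \<Longrightarrow>
   subst_trm s \<theta> = subst_trm s' \<theta> \<Longrightarrow> idem_mgu \<sigma> s s' \<Longrightarrow>
   maximal_lit lt (subst_lit (Neg (Upair s s')) \<theta>) (subst_cls (C' + {#Neg (Upair s s')#}) \<theta>) \<Longrightarrow>
   EqRes (gclo (C' + {#Neg (Upair s s')#}) \<theta>) (gclo (subst_cls C' \<sigma>) \<theta>)
     \<in> ground_inferences lt"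

definition Red_I :: "('f, 'v) trm_rel \<Rightarrow> ('f, 'v) gclosure_rel \<Rightarrow> ('f, 'v) gclosure set \<Rightarrow>
    ('f, 'v) inference set" where
  "Red_I lt ltClo N = {\<iota> \<in> ground_inferences lt. \<forall>R.
     ground_trs R \<and> left_reduced R \<and> contained_in R lt \<longrightarrow>
       closure_true R (concl \<iota>) \<or>
       (\<exists>c \<in> N. closure_less lt ltClo R c (right_prem \<iota>) \<and> \<not> closure_true R c) \<or>
       (\<exists>l u v r c. \<iota> = ParSup l (u, v) r c \<and> lt v u \<and> (u, v) \<notin> R) \<or>
       (\<exists>l e r c. \<iota> = ParSup l e r c \<and> (\<exists>d \<in> prems \<iota>. closure_less lt ltClo R d l))}"

definition saturated ::
  "('f, 'v) trm_rel \<Rightarrow> ('f, 'v) gclosure_rel \<Rightarrow> ('f, 'v) gclosure set \<Rightarrow> bool" where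
  "saturated lt ltClo N \<longleftrightarrow>
     (\<forall>\<iota> \<in> ground_inferences lt. prems \<iota> \<subseteq> N \<longrightarrow> \<iota> \<in> Red_I lt ltClo N)"


section \<open>Candidate interpretation\<close>

text \<open>The closure \<open>c\<close> is eligible to produce \<open>s \<rightarrow> s'\<close> over \<open>R\<close>, apart from minimality.
  For \<open>c = (C \<cdot> \<theta>)\<close>, the condition \<open>C = C' \<or> u \<approx> u'\<close>, \<open>s = u\<theta>\<close>, \<open>s' = u'\<theta>\<close> says that
  \<open>s \<approx> s'\<close> is a literal of \<open>C\<theta>\<close>.\<close>

definition eligible ::
  "('f, 'v) trm_rel \<Rightarrow> ('f, 'v) trs \<Rightarrow> ('f, 'v) gclosure \<Rightarrow> ('f, 'v) trm \<Rightarrow> ('f, 'v) trm \<Rightarrow> bool" where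
  "eligible lt R c s s' \<longleftrightarrow>
     Pos (Upair s s') \<in># inst c \<and>
     (\<forall>L \<in># inst c. \<forall>t \<in> sides L. \<forall>t' \<in> subterms t. t' \<noteq> s \<longrightarrow> lt t' s) \<and>
     s \<notin> ss_neg (inst c) \<and> irreducible R s \<and> \<not> closure_true R c \<and> lt s' s"

definition produced :: "('f, 'v) trm_rel \<Rightarrow> ('f, 'v) gclosure_rel \<Rightarrow> ('f, 'v) gclosure set \<Rightarrow>
    ('f, 'v) trs \<Rightarrow> ('f, 'v) trm \<Rightarrow> ('f, 'v) trs" where
  "produced lt ltClo N R s = {(s, s') |s'. \<exists>c \<in> N. eligible lt R c s s' \<and>
     (\<forall>d \<in> N. d \<noteq> c \<and> (\<exists>s''. eligible lt R d s s'') \<longrightarrow> closure_less lt ltClo R c d)}"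

text \<open>Recursion along the ordering on ground terms; \<open>produced_rules\<close> yields the rule sets \<open>E\<^sub>s\<close>.\<close>

definition produced_rules :: "('f, 'v) trm_rel \<Rightarrow> ('f, 'v) gclosure_rel \<Rightarrow> ('f, 'v) gclosure set \<Rightarrow>
    ('f, 'v) trm \<Rightarrow> ('f, 'v) trs" where
  "produced_rules lt ltClo N = wfrec {(t, s). ground_trm t \<and> ground_trm s \<and> lt t s}
     (\<lambda>E s. produced lt ltClo N (\<Union>t \<in> {t. ground_trm t \<and> lt t s}. E t) s)"

definition candidate :: "('f, 'v) trm_rel \<Rightarrow> ('f, 'v) gclosure_rel \<Rightarrow> ('f, 'v) gclosure set \<Rightarrow>
    ('f, 'v) trs" where
  "candidate lt ltClo N = (\<Union>s \<in> {s. ground_trm s}. produced_rules lt ltClo N s)"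

end

(*
Take a closure c of N that is false in the candidate system and minimal with respect to the
ordering of that system, and consider a maximal literal of its instance.

A negative literal s = s is removed by Equality Resolution. If the larger side s of the literal is
reducible by a rule u -> v produced by a closure d, then Parallel Superposition of d into c yields
a false conclusion, because the remaining literals of d stay false (Horn case: they are negative).
Redundancy of the inference then contradicts the minimality of c, provided that d is the smaller
premise. If u occurs in a negative literal or below the top of s, this holds because c has a redex
u with a label above 0, while the largest labelled redex of d is (u, 0). Otherwise the literal is
positive, s = u, and both premises are eligible to produce a rule for u; then d is smaller in the
ordering of the rules below u, and adding the rule for u changes the redex multisets of both
premises by the same amount.
*)

theory Submission
  imports Defs
begin

text \<open>The obstacle is that the ordering on closures depends on the rewrite system. A closure
  produces \<open>u -> v\<close> by minimality with respect to the rules below \<open>u\<close>,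
  whereas counterexamples are ordered by, and redundancy is evaluated at, the finished system
  \<open>cand\<close>. So no induction over closures accompanies the construction; instead, three
  facts are carried from the rules below \<open>u\<close> to \<open>cand\<close>: terms below
  \<open>u\<close> rewrite alike in both, false negative literals stay false, and closures eligible
  for the same \<open>u\<close> keep their order.

  Two preparations are forced by the definitions. Inferences name an idempotent most general unifier
  but keep the substitution of the premises, so such unifiers must be shown to exist and to be
  absorbed by every other unifier. Labelled redex multisets and normal forms are definite
  descriptions, so nothing can be computed with them before unique existence is known; this is a
  confluence proof that also tracks labels.\<close>

section \<open>Most general unifiers\<close>

lemma size_subst_var_le: "x \<in> vars_trm t \<Longrightarrow> size (\<tau> x) \<le> size (subst_trm t \<tau>)"
proof (induction t)
  case (Fun f ts)
  then obtain t where t: "t \<in> set ts" "x \<in> vars_trm t" by auto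
  then have "size (\<tau> x) \<le> size (subst_trm t \<tau>)" using Fun.IH by blast
  also have "\<dots> \<le> size_list size (map (\<lambda>t. subst_trm t \<tau>) ts)"
    using t(1) size_list_estimation'[of "subst_trm t \<tau>" "map (\<lambda>t. subst_trm t \<tau>) ts"] by auto
  finally show ?case by simp
qed simp

text \<open>A proper occurrence of \<open>x\<close> makes every instance of \<open>t\<close>
  strictly larger than the value of \<open>x\<close>.\<close>

lemma occurs_check:
  assumes "x \<in> vars_trm t" "t \<noteq> Var x"
  shows "\<tau> x \<noteq> subst_trm t \<tau>"
proof (cases t)
  case (Fun f ts)
  then obtain s where s: "s \<in> set ts" "x \<in> vars_trm s" using assms by auto
  then have "size (\<tau> x) \<le> size (subst_trm s \<tau>)" by (simp add: size_subst_var_le)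
  also have "\<dots> \<le> size_list size (map (\<lambda>t. subst_trm t \<tau>) ts)"
    using s(1) size_list_estimation'[of "subst_trm s \<tau>" "map (\<lambda>t. subst_trm t \<tau>) ts"] by auto
  also have "\<dots> < size (subst_trm t \<tau>)" by (simp add: Fun)
  finally show ?thesis by auto
qed (use assms in auto)

definition unifies :: "('f, 'v) subst \<Rightarrow> (('f, 'v) trm \<times> ('f, 'v) trm) list \<Rightarrow> bool" where
  "unifies \<tau> E \<longleftrightarrow> (\<forall>(s, t) \<in> set E. unifier \<tau> s t)"

lemma unifies_Cons: "unifies \<tau> ((s, t) # E) \<longleftrightarrow> unifier \<tau> s t \<and> unifies \<tau> E"
  by (simp add: unifies_def)

lemma unifies_append: "unifies \<tau> (E @ E') \<longleftrightarrow> unifies \<tau> E \<and> unifies \<tau> E'"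
  by (auto simp: unifies_def)

lemma unifier_sym: "unifier \<tau> s t \<longleftrightarrow> unifier \<tau> t s"
  by (auto simp: unifier_def)

lemma unifier_Fun:
  "unifier \<tau> (Fun f ss) (Fun g ts) \<longleftrightarrow> f = g \<and> length ss = length ts \<and> unifies \<tau> (zip ss ts)"
  by (fastforce simp: unifier_def unifies_def list_eq_iff_nth_eq in_set_zip
      dest: map_eq_imp_length_eq)

definition eqs_vars :: "(('f, 'v) trm \<times> ('f, 'v) trm) list \<Rightarrow> 'v set" where
  "eqs_vars E = (\<Union>(s, t) \<in> set E. vars_trm s \<union> vars_trm t)"

definition eqs_size :: "(('f, 'v) trm \<times> ('f, 'v) trm) list \<Rightarrow> nat" where
  "eqs_size E = (\<Sum>(s, t) \<leftarrow> E. Suc (size s + size t))"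

lemma eqs_size_Cons: "eqs_size ((s, t) # E) = Suc (size s + size t) + eqs_size E"
  by (simp add: eqs_size_def)

lemma eqs_size_append: "eqs_size (E @ E') = eqs_size E + eqs_size E'"
  by (simp add: eqs_size_def)

text \<open>\<open>size_list\<close> charges one per element, so the two lists together pay for the
  \<open>Suc\<close> of each pair. This is what makes decomposition decrease the measure.\<close>

lemma eqs_size_zip: "eqs_size (zip ss ts) \<le> size_list size ss + size_list size ts"
proof (induction ss arbitrary: ts)
  case (Cons s ss)
  note IH = Cons.IH
  show ?case
  proof (cases ts)
    case (Cons t ts')
    then show ?thesis using IH[of ts'] by (simp add: eqs_size_Cons)
  qed (simp add: eqs_size_def)
qed (simp add: eqs_size_def)

lemma finite_vars_trm: "finite (vars_trm t)"
  by (induction t) auto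

lemma finite_eqs_vars: "finite (eqs_vars E)"
  by (auto simp: eqs_vars_def finite_vars_trm)

lemma eqs_vars_zip: "eqs_vars (zip ss ts) \<subseteq> vars_trm (Fun f ss) \<union> vars_trm (Fun f ts)"
  by (auto simp: eqs_vars_def dest: set_zip_leftD set_zip_rightD)

lemma subst_comp_assoc: "subst_comp (subst_comp \<rho> \<sigma>) \<tau> = subst_comp \<rho> (subst_comp \<sigma> \<tau>)"
  by (simp add: subst_comp_def subst_trm_comp)

text \<open>Absorption by every unifier is stronger than being most general and, applied to the unifier
  itself, yields idempotence.\<close>

definition absorbing_mgu :: "('f, 'v) subst \<Rightarrow> (('f, 'v) trm \<times> ('f, 'v) trm) list \<Rightarrow> bool" where
  "absorbing_mgu \<sigma> E \<longleftrightarrow> unifies \<sigma> E \<and> (\<forall>\<tau>. unifies \<tau> E \<longrightarrow> subst_comp \<sigma> \<tau> = \<tau>)"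

text \<open>Every unifier of \<open>x\<close> and \<open>t\<close> already absorbs the binding
  \<open>x := t\<close>, so absorption is inherited by the composition with an absorbing unifier of
  the remaining equations.\<close>

lemma absorbing_mgu_elim_var:
  assumes x: "x \<notin> vars_trm t"
    and \<sigma>: "absorbing_mgu \<sigma> (map (map_prod (\<lambda>s. subst_trm s (Var(x := t))) (\<lambda>s. subst_trm s (Var(x := t)))) E)"
  shows "absorbing_mgu (subst_comp (Var(x := t)) \<sigma>) ((Var x, t) # E)"
proof -
  let ?\<rho> = "Var(x := t)"
  have t: "subst_trm t ?\<rho> = t"
  proof -
    have "subst_trm t ?\<rho> = subst_trm t Var" using x by (intro subst_trm_cong) auto
    then show ?thesis by (simp add: subst_trm_Var)
  qed
  have *: "unifies \<tau> (map (map_prod (\<lambda>s. subst_trm s ?\<rho>) (\<lambda>s. subst_trm s ?\<rho>)) E)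
    \<longleftrightarrow> unifies (subst_comp ?\<rho> \<tau>) E" for \<tau>
    unfolding unifies_def unifier_def
    by (simp add: subst_trm_comp case_prod_unfold)
  have "unifies (subst_comp ?\<rho> \<sigma>) ((Var x, t) # E)"
  proof -
    have "subst_trm t (subst_comp ?\<rho> \<sigma>) = subst_trm t \<sigma>"
      by (metis t subst_trm_comp)
    then show ?thesis
      using \<sigma> by (simp add: unifies_Cons absorbing_mgu_def * unifier_def) (simp add: subst_comp_def)
  qed
  moreover have "subst_comp (subst_comp ?\<rho> \<sigma>) \<tau> = \<tau>" if u: "unifies \<tau> ((Var x, t) # E)" for \<tau>
  proof -
    have "subst_comp ?\<rho> \<tau> = \<tau>"
      using u by (auto simp: unifies_Cons unifier_def subst_comp_def)
    then show ?thesis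
      using u \<sigma> by (simp add: absorbing_mgu_def * subst_comp_assoc unifies_Cons)
  qed
  ultimately show ?thesis by (simp add: absorbing_mgu_def)
qed

text \<open>Unification by variable elimination, decomposition and deletion. Elimination lowers the
  number of variables; the other steps do not raise it and shrink the size. The given unifier
  excludes symbol clashes and failures of the occurs check.\<close>

lemma absorbing_mgu_exists: "unifies \<tau> E \<Longrightarrow> \<exists>\<sigma>. absorbing_mgu \<sigma> E"
proof (induction E arbitrary: \<tau> rule: wf_induct_rule[OF wf_measures[of "[\<lambda>E. card (eqs_vars E), eqs_size]"]])
  case (1 E)
  \<comment> \<open>Stated up to equal unifiers and equal variables, so that it serves for both
    orientations of an equation with a variable side.\<close>
  have elim: ?case
    if E: "\<And>\<tau>. unifies \<tau> E \<longleftrightarrow> unifies \<tau> ((Var x, t) # E')"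
      and vars: "eqs_vars E = eqs_vars ((Var x, t) # E')" and x: "x \<notin> vars_trm t" for x t E'
  proof -
    let ?\<rho> = "Var(x := t)"
    let ?E = "map (map_prod (\<lambda>s. subst_trm s ?\<rho>) (\<lambda>s. subst_trm s ?\<rho>)) E'"
    have "eqs_vars ?E \<subseteq> eqs_vars E - {x}"
      using x unfolding vars by (fastforce simp: eqs_vars_def vars_subst_trm split: if_splits)
    moreover have "x \<in> eqs_vars E" unfolding vars by (simp add: eqs_vars_def)
    ultimately have "card (eqs_vars ?E) < card (eqs_vars E)"
      by (intro psubset_card_mono finite_eqs_vars) blast
    then have less: "(?E, E) \<in> measures [\<lambda>E. card (eqs_vars E), eqs_size]" by simp
    have u: "unifies \<tau> ((Var x, t) # E')" using 1(2) E by blast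
    then have "subst_comp ?\<rho> \<tau> = \<tau>"
      by (auto simp: unifies_Cons unifier_def subst_comp_def)
    then have "unifies \<tau> ?E"
      using u by (fastforce simp: unifies_def unifier_def subst_trm_comp)
    from 1(1)[OF less this] obtain \<sigma> where "absorbing_mgu \<sigma> ?E" ..
    from absorbing_mgu_elim_var[OF x this] show ?thesis
      unfolding absorbing_mgu_def E by (intro exI[of _ "subst_comp ?\<rho> \<sigma>"])
  qed
  show ?case
  proof (cases E)
    case Nil
    then have "absorbing_mgu Var E"
      by (simp add: absorbing_mgu_def unifies_def subst_comp_def)
    then show ?thesis by (intro exI[of _ Var])
  next
    case (Cons st E')
    obtain s t where st: "st = (s, t)" by (cases st)
    note E = Cons[unfolded st]
    show ?thesis
    proof (cases s)
      case (Var x)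
      show ?thesis
      proof (cases "t = Var x")
        case True
        have "eqs_vars E' \<subseteq> eqs_vars E" by (auto simp: E eqs_vars_def)
        then have "card (eqs_vars E') \<le> card (eqs_vars E)" by (intro card_mono finite_eqs_vars)
        then have less: "(E', E) \<in> measures [\<lambda>E. card (eqs_vars E), eqs_size]"
          by (auto simp: E eqs_size_Cons)
        have u: "unifies \<sigma> E \<longleftrightarrow> unifies \<sigma> E'" for \<sigma>
          by (simp add: E unifies_Cons unifier_def True Var)
        show ?thesis using 1(1)[OF less] 1(2) by (simp add: absorbing_mgu_def u)
      next
        case False
        have "\<tau> x = subst_trm t \<tau>" using 1(2) by (simp add: E Var unifies_Cons unifier_def)
        then have "x \<notin> vars_trm t" using False occurs_check by metis
        then show ?thesis by (intro elim) (simp_all add: E Var)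
      qed
    next
      case s: (Fun f ss)
      show ?thesis
      proof (cases t)
        case (Var x)
        have "\<tau> x = subst_trm s \<tau>" using 1(2) by (simp add: E Var unifies_Cons unifier_def)
        then have "x \<notin> vars_trm s" using s occurs_check by (metis trm.distinct(1))
        then show ?thesis
          by (intro elim[of x s E']) (auto simp: E Var unifies_Cons unifier_sym eqs_vars_def)
      next
        case t: (Fun g ts)
        have f: "f = g" "length ss = length ts"
          using 1(2) by (auto simp: E s t unifies_Cons unifier_Fun)
        have u: "unifies \<sigma> E \<longleftrightarrow> unifies \<sigma> (zip ss ts @ E')" for \<sigma>
          by (auto simp: E s t f unifies_Cons unifier_Fun unifies_append)
        have "eqs_vars (zip ss ts @ E') \<subseteq> eqs_vars E"
          using eqs_vars_zip[of ss ts f] by (auto simp: E s t f eqs_vars_def)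
        then have "card (eqs_vars (zip ss ts @ E')) \<le> card (eqs_vars E)"
          by (intro card_mono finite_eqs_vars)
        moreover have "eqs_size (zip ss ts @ E') < eqs_size E"
          using eqs_size_zip[of ss ts] by (simp add: E s t eqs_size_Cons eqs_size_append)
        ultimately have less: "(zip ss ts @ E', E) \<in> measures [\<lambda>E. card (eqs_vars E), eqs_size]" by auto
        show ?thesis using 1(1)[OF less] 1(2) by (simp add: absorbing_mgu_def u)
      qed
    qed
  qed
qed

text \<open>The second property is the one used later: for a unifier \<open>\<theta>\<close>, the
  closure of \<open>C\<sigma>\<close> with the unchanged \<open>\<theta>\<close> has the instance
  \<open>C\<theta>\<close>.\<close>

lemma idem_mgu_exists:
  assumes "unifier \<tau> s t"
  obtains \<sigma> where "idem_mgu \<sigma> s t" "subst_comp \<sigma> \<tau> = \<tau>"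
proof -
  have u: "unifies \<tau> [(s, t)] \<longleftrightarrow> unifier \<tau> s t" for \<tau> by (simp add: unifies_def)
  obtain \<sigma> where "absorbing_mgu \<sigma> [(s, t)]" using absorbing_mgu_exists[of \<tau>] u assms by blast
  then have "unifier \<sigma> s t" "\<And>\<tau>. unifier \<tau> s t \<Longrightarrow> subst_comp \<sigma> \<tau> = \<tau>"
    unfolding absorbing_mgu_def u by blast+
  then show thesis
    using assms by (intro that[of \<sigma>]) (auto simp: idem_mgu_def intro: exI[of _ "_ :: ('a, 'b) subst"] sym)
qed

section \<open>Positions and subterms\<close>

lemma Nil_in_poss [simp]: "[] \<in> poss t"
  by (cases t) auto

lemma poss_append: "p @ q \<in> poss t \<longleftrightarrow> p \<in> poss t \<and> q \<in> poss (subt_at t p)"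
proof (induction p arbitrary: t)
  case (Cons i p)
  then show ?case by (cases t) auto
qed simp

lemma subt_at_append: "p \<in> poss t \<Longrightarrow> subt_at t (p @ q) = subt_at (subt_at t p) q"
proof (induction p arbitrary: t)
  case (Cons i p)
  then show ?case by (cases t) auto
qed simp

lemma poss_subst: "p \<in> poss t \<Longrightarrow> p \<in> poss (subst_trm t \<theta>)"
  and subt_at_subst: "p \<in> poss t \<Longrightarrow> subt_at (subst_trm t \<theta>) p = subst_trm (subt_at t p) \<theta>"
proof (induction p arbitrary: t)
  case (Cons i p)
  { case 1 then show ?case using Cons by (cases t) auto }
  { case 2 then show ?case using Cons by (cases t) auto }
qed simp_all

text \<open>A redex position lies either at a non-variable position of the clause or inside the
  value of a variable; this decides between Parallel Superposition I and II.\<close>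

lemma poss_subst_cases:
  assumes "p \<in> poss (subst_trm t \<theta>)"
  obtains f ts where "p \<in> poss t" "subt_at t p = Fun f ts"
  | q r x where "p = q @ r" "q \<in> poss t" "subt_at t q = Var x" "r \<in> poss (\<theta> x)"
proof -
  have "(\<exists>f ts. p \<in> poss t \<and> subt_at t p = Fun f ts) \<or>
    (\<exists>q r x. p = q @ r \<and> q \<in> poss t \<and> subt_at t q = Var x \<and> r \<in> poss (\<theta> x))"
    using assms
  proof (induction t arbitrary: p)
    case (Var x)
    then show ?case by (intro disjI2 exI[of _ "[]"] exI[of _ p] exI[of _ x]) simp
  next
    case (Fun f ts)
    show ?case
    proof (cases p)
      case (Cons i p')
      then have i: "i < length ts" and "p' \<in> poss (subst_trm (ts ! i) \<theta>)" using Fun.prems by auto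
      from Fun.IH[OF nth_mem[OF i] this(2)] show ?thesis
      proof (elim disjE exE conjE, goal_cases)
        case 1
        then show ?thesis by (intro disjI1) (use i in \<open>simp add: Cons\<close>)
      next
        case (2 q r x)
        then show ?thesis
          by (intro disjI2 exI[of _ "i # q"] exI[of _ r] exI[of _ x]) (use i in \<open>simp add: Cons\<close>)
      qed
    qed simp
  qed
  then show thesis using that by blast
qed

lemma size_subt_at: "p \<in> poss t \<Longrightarrow> p \<noteq> [] \<Longrightarrow> size (subt_at t p) < size t"
proof (induction p arbitrary: t)
  case (Cons i p)
  then obtain f ts where t: "t = Fun f ts" "i < length ts" "p \<in> poss (ts ! i)" by (cases t) auto
  have "size (subt_at (ts ! i) p) \<le> size (ts ! i)"
    using Cons.IH[OF t(3)] by (cases "p = []") auto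
  then show ?case using size_nth_arg[OF t(2)] by (simp add: t(1))
qed simp

lemma subterms_refl [simp]: "t \<in> subterms t"
  by (auto simp: subterms_def intro: rev_image_eqI[of "[]"])

lemma subterms_trans: "s \<in> subterms t \<Longrightarrow> t \<in> subterms u \<Longrightarrow> s \<in> subterms u"
  unfolding subterms_def by (auto simp flip: subt_at_append) (metis imageI poss_append)

lemma subterms_iff_proper: "s \<in> subterms t \<longleftrightarrow> s = t \<or> s \<in> proper_subterms t"
  unfolding subterms_def proper_subterms_def by (force intro: rev_image_eqI[of "[]"])

lemma size_proper_subterm: "s \<in> proper_subterms t \<Longrightarrow> size s < size t"
  by (auto simp: proper_subterms_def intro: size_subt_at)

lemma proper_subterms_neq: "t \<notin> proper_subterms t"
  using size_proper_subterm[of t t] by auto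

lemma arg_proper_subterm: "t \<in> set ts \<Longrightarrow> t \<in> proper_subterms (Fun f ts)"
proof -
  assume "t \<in> set ts"
  then obtain i where "i < length ts" "t = ts ! i" by (auto simp: in_set_conv_nth)
  then show ?thesis unfolding proper_subterms_def by (intro rev_image_eqI[of "[i]"]) simp_all
qed

lemma finite_subterms: "finite (subterms t)"
  by (simp add: subterms_def finite_poss)

lemma finite_proper_subterms: "finite (proper_subterms t)"
  by (simp add: proper_subterms_def finite_poss)

lemma subterms_subst: "s \<in> subterms t \<Longrightarrow> subst_trm s \<theta> \<in> subterms (subst_trm t \<theta>)"
  unfolding subterms_def by (auto simp: poss_subst simp flip: subt_at_subst)

lemma proper_subterms_subst:
  "s \<in> proper_subterms t \<Longrightarrow> subst_trm s \<theta> \<in> proper_subterms (subst_trm t \<theta>)"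
  unfolding proper_subterms_def by (auto simp: poss_subst simp flip: subt_at_subst)

lemma vars_subterms: "s \<in> subterms t \<Longrightarrow> vars_trm s \<subseteq> vars_trm t"
  using vars_subt_at by (auto simp: subterms_def)

lemma ground_subterm: "s \<in> subterms t \<Longrightarrow> ground_trm t \<Longrightarrow> ground_trm s"
  using vars_subterms by (auto simp: ground_trm_def)

lemma wf_subt_at: "p \<in> poss t \<Longrightarrow> wf_trm F t \<Longrightarrow> wf_trm F (subt_at t p)"
proof (induction p arbitrary: t)
  case (Cons i p)
  then show ?case by (cases t) auto
qed simp

lemma wf_subterm: "s \<in> subterms t \<Longrightarrow> wf_trm F t \<Longrightarrow> wf_trm F s"
  using wf_subt_at by (auto simp: subterms_def)

lemma replace_at_same: "p \<in> poss t \<Longrightarrow> replace_at t p (subt_at t p) = t"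
proof (induction p arbitrary: t)
  case (Cons i p)
  then show ?case by (cases t) auto
qed simp

lemma wf_replace_at:
  "p \<in> poss t \<Longrightarrow> wf_trm F v \<Longrightarrow> wf_trm F (subt_at t p) \<Longrightarrow>
   wf_trm F (replace_at t p v) \<longleftrightarrow> wf_trm F t"
proof (induction p arbitrary: t)
  case (Cons i p)
  then obtain f ts where t: "t = Fun f ts" "i < length ts" "p \<in> poss (ts ! i)" by (cases t) auto
  then show ?case using Cons.IH[of "ts ! i"] Cons.prems
    by (auto simp: all_set_conv_all_nth nth_list_update)
qed simp

lemma ground_replace_at:
  "p \<in> poss t \<Longrightarrow> ground_trm t \<Longrightarrow> ground_trm v \<Longrightarrow> ground_trm (replace_at t p v)"
proof (induction p arbitrary: t)
  case (Cons i p)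
  then obtain f ts where t: "t = Fun f ts" "i < length ts" "p \<in> poss (ts ! i)" by (cases t) auto
  then show ?case using Cons.IH[of "ts ! i"] Cons.prems
    by (auto simp: ground_trm_def dest!: set_mp[OF set_update_subset_insert])
qed simp

section \<open>Replacement at parallel positions\<close>

definition parallel_pos :: "nat list \<Rightarrow> nat list \<Rightarrow> bool" where
  "parallel_pos p q \<longleftrightarrow> (\<nexists>r. q = p @ r) \<and> (\<nexists>r. p = q @ r)"

lemma parallel_pos_sym: "parallel_pos p q \<Longrightarrow> parallel_pos q p"
  by (auto simp: parallel_pos_def)

text \<open>Disjoint contractions commute. For left-reduced ground systems no other nontrivial peaks
  exist, so uniqueness of redex multisets and of normal forms both rest on this.\<close>

lemma parallel_replace_at:
  assumes "p \<in> poss t" "q \<in> poss t" "parallel_pos p q"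
  shows "q \<in> poss (replace_at t p v) \<and> subt_at (replace_at t p v) q = subt_at t q \<and>
    replace_at (replace_at t p v) q w = replace_at (replace_at t q w) p v"
  using assms
proof (induction p arbitrary: t q)
  case Nil
  then show ?case by (simp add: parallel_pos_def)
next
  case (Cons i p)
  then obtain f ts where t: "t = Fun f ts" "i < length ts" "p \<in> poss (ts ! i)" by (cases t) auto
  obtain j q' where q: "q = j # q'" using Cons.prems(3) by (cases q) (auto simp: parallel_pos_def)
  then have q': "j < length ts" "q' \<in> poss (ts ! j)" using Cons.prems(2) t by auto
  show ?case
  proof (cases "i = j")
    case True
    then have "parallel_pos p q'" using Cons.prems(3) by (simp add: parallel_pos_def q)
    then show ?thesis using Cons.IH[of "ts ! i" q'] t q q' True by simp
  next
    case False
    then show ?thesis using t q q' by (simp add: list_update_swap)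
  qed
qed


section \<open>Ground rewriting\<close>

lemma rstepI: "(u, v) \<in> R \<Longrightarrow> p \<in> poss t \<Longrightarrow> subt_at t p = u \<Longrightarrow> (t, replace_at t p v) \<in> rstep R"
  by (auto simp: rstep_def)

lemma rstepE:
  assumes "(t, t') \<in> rstep R"
  obtains u v p where "(u, v) \<in> R" "p \<in> poss t" "subt_at t p = u" "t' = replace_at t p v"
  using assms by (auto simp: rstep_def)

lemma irreducible_iff: "irreducible R t \<longleftrightarrow> (\<forall>(u, v) \<in> R. u \<notin> subterms t)"
  by (auto simp: irreducible_def rstep_def subterms_def)

lemma irreducible_antimono: "irreducible R t \<Longrightarrow> S \<subseteq> R \<Longrightarrow> irreducible S t"
  by (auto simp: irreducible_iff)

lemma rstep_mono: "R \<subseteq> S \<Longrightarrow> rstep R \<subseteq> rstep S"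
  by (auto simp: rstep_def)

lemma rstep_Fun:
  assumes "(a, b) \<in> rstep R"
  shows "(Fun f (xs @ a # ys), Fun f (xs @ b # ys)) \<in> rstep R"
  using assms
proof (rule rstepE)
  fix u v p
  assume "(u, v) \<in> R" "p \<in> poss a" "subt_at a p = u" "b = replace_at a p v"
  then show ?thesis
    using rstepI[of u v R "length xs # p" "Fun f (xs @ a # ys)"] by (simp add: nth_append)
qed

lemma rsteps_Fun:
  assumes "list_all2 (\<lambda>s t. (s, t) \<in> (rstep R)\<^sup>*) ss ts"
  shows "(Fun f ss, Fun f ts) \<in> (rstep R)\<^sup>*"
proof -
  have arg: "(Fun f (xs @ a # ys), Fun f (xs @ b # ys)) \<in> (rstep R)\<^sup>*" if "(a, b) \<in> (rstep R)\<^sup>*" for xs ys a b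
    using that by induction (auto intro: rstep_Fun rtrancl_into_rtrancl)
  \<comment> \<open>The prefix \<open>us\<close> holds the arguments already rewritten.\<close>
  have "(Fun f (us @ ss), Fun f (us @ ts)) \<in> (rstep R)\<^sup>*" for us
    using assms
  proof (induction arbitrary: us rule: list_all2_induct)
    case (Cons s ss t ts)
    show ?case
      using arg[OF Cons.hyps(1), of us ss] Cons.IH[of "us @ [t]"] by (auto intro: rtrancl_trans)
  qed simp
  from this[of "[]"] show ?thesis by simp
qed

section \<open>Conversion as a congruence\<close>

definition conversion :: "('f, 'v) trs \<Rightarrow> ('f, 'v) trs" where
  "conversion R = (rstep R \<union> (rstep R)\<inverse>)\<^sup>*"

lemma conversion_refl [simp]: "(s, s) \<in> conversion R"
  by (simp add: conversion_def)

lemma conversion_sym: "(s, t) \<in> conversion R \<Longrightarrow> (t, s) \<in> conversion R"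
  unfolding conversion_def by (rule symD[OF sym_rtrancl]) (auto simp: sym_def)

lemma conversion_trans: "(s, t) \<in> conversion R \<Longrightarrow> (t, u) \<in> conversion R \<Longrightarrow> (s, u) \<in> conversion R"
  unfolding conversion_def by (rule rtrancl_trans)

lemma rsteps_conversion: "(s, t) \<in> (rstep R)\<^sup>* \<Longrightarrow> (s, t) \<in> conversion R"
  unfolding conversion_def by (rule set_mp[OF rtrancl_mono]) auto

lemma rstep_conversion: "(s, t) \<in> rstep R \<Longrightarrow> (s, t) \<in> conversion R"
  by (auto simp: conversion_def)

lemma conversion_mono: "R \<subseteq> S \<Longrightarrow> conversion R \<subseteq> conversion S"
  unfolding conversion_def by (intro rtrancl_mono Un_mono converse_mono[THEN iffD2] rstep_mono)

lemma eq_true_Upair: "eq_true R (Upair s t) \<longleftrightarrow> (s, t) \<in> conversion R"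
  using conversion_sym unfolding eq_true_def conversion_def[symmetric] by auto

lemma conversion_arg:
  assumes "(a, b) \<in> conversion R"
  shows "(Fun f (xs @ a # ys), Fun f (xs @ b # ys)) \<in> conversion R"
  using assms unfolding conversion_def
proof induction
  case (step b c)
  then have "(Fun f (xs @ b # ys), Fun f (xs @ c # ys)) \<in> rstep R \<union> (rstep R)\<inverse>"
    using rstep_Fun[of b c] rstep_Fun[of c b] by blast
  with step.IH show ?case by (rule rtrancl_into_rtrancl)
qed simp

lemma conversion_Fun:
  assumes "list_all2 (\<lambda>s t. (s, t) \<in> conversion R) ss ts"
  shows "(Fun f ss, Fun f ts) \<in> conversion R"
proof -
  have "(Fun f (us @ ss), Fun f (us @ ts)) \<in> conversion R" for us
    using assms
  proof (induction arbitrary: us rule: list_all2_induct)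
    case (Cons s ss t ts)
    show ?case
      using conversion_arg[OF Cons.hyps(1), of f us ss] Cons.IH[of "us @ [t]"]
      by (auto intro: conversion_trans)
  qed simp
  from this[of "[]"] show ?thesis by simp
qed

lemma conversion_subst:
  assumes "\<And>x. x \<in> vars_trm t \<Longrightarrow> (\<theta> x, \<tau> x) \<in> conversion R"
  shows "(subst_trm t \<theta>, subst_trm t \<tau>) \<in> conversion R"
  using assms
proof (induction t)
  case (Fun f ts)
  then have "(subst_trm t \<theta>, subst_trm t \<tau>) \<in> conversion R" if "t \<in> set ts" for t
    using that by auto
  then show ?case by (auto intro!: conversion_Fun simp: list_all2_conv_all_nth)
qed simp

lemma conversion_replace_all:
  assumes "(subst_trm u \<theta>, subst_trm v \<theta>) \<in> conversion R"
  shows "(subst_trm t \<theta>, subst_trm (replace_all u v t) \<theta>) \<in> conversion R"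
  using assms by (induction t) (auto intro!: conversion_Fun simp: list_all2_conv_all_nth)

lemma conversion_cong:
  assumes "(s, s') \<in> conversion R" "(t, t') \<in> conversion R"
  shows "(s, t) \<in> conversion R \<longleftrightarrow> (s', t') \<in> conversion R"
  using assms conversion_sym[of _ _ R] conversion_trans[of _ _ R] by meson

lemma lit_true_map_cong:
  assumes "\<And>t. t \<in> sides L \<Longrightarrow> (g t, h t) \<in> conversion R"
  shows "lit_true R (map_lit g L) \<longleftrightarrow> lit_true R (map_lit h L)"
proof -
  obtain s t where st: "atm L = Upair s t" by (cases "atm L")
  then have "(g s, h s) \<in> conversion R" "(g t, h t) \<in> conversion R"
    by (simp_all add: assms sides_def)
  then show ?thesis
    using st by (cases L) (simp_all add: map_lit_def eq_true_Upair conversion_cong[of "g s" "h s"])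
qed

lemma redexes_step:
  assumes "(u, v) \<in> R" "p \<in> poss t" "subt_at t p = u" "redexes R (replace_at t p v) m M"
  shows "redexes R t m (add_mset (u, if p = [] \<or> m > 0 then m else 1) M)"
  using redexes.same_label[OF assms(1-3) _ assms(4)] redexes.below_top[OF assms(1-3) _ _ assms(4)]
  by auto

lemma redexes_cases_step:
  assumes "redexes R t m M"
  obtains "irreducible R t" "M = {#}"
  | u v p M' where "(u, v) \<in> R" "p \<in> poss t" "subt_at t p = u"
    "M = add_mset (u, if p = [] \<or> m > 0 then m else 1) M'" "redexes R (replace_at t p v) m M'"
  using assms by (cases rule: redexes.cases) (auto 4 4 split: if_splits)

section \<open>Reduction orderings and left-reduced systems\<close>

locale term_ordering =
  fixes F :: "('f \<times> nat) set" and lt :: "('f, 'v) trm \<Rightarrow> ('f, 'v) trm \<Rightarrow> bool"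
  assumes ordering: "reduction_ordering F lt"
    and total: "totalp_on {t. wf_trm F t \<and> ground_trm t} lt"
begin

lemma lt_wf: "lt s t \<Longrightarrow> wf_trm F s" "lt s t \<Longrightarrow> wf_trm F t"
  using ordering by (auto simp: reduction_ordering_def)

lemma lt_transp: "transp lt"
  using ordering by (simp add: reduction_ordering_def)

lemma lt_trans: "lt s t \<Longrightarrow> lt t u \<Longrightarrow> lt s u"
  using lt_transp by (rule transpD)

lemma le_lt_trans: "lt s t \<or> s = t \<Longrightarrow> lt t u \<Longrightarrow> lt s u"
  using lt_trans by blast

lemma le_trans: "lt s t \<or> s = t \<Longrightarrow> lt t u \<or> t = u \<Longrightarrow> lt s u \<or> s = u"
  using lt_trans by blast

lemma lt_wfp: "wfp lt"
  using ordering by (simp add: reduction_ordering_def)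

lemma lt_irrefl: "\<not> lt t t"
  using lt_wfp by (metis wfp_imp_irreflp irreflpD)

lemma lt_asym: "lt s t \<Longrightarrow> \<not> lt t s"
  using lt_trans lt_irrefl by blast

lemma lt_total: "wf_trm F s \<Longrightarrow> ground_trm s \<Longrightarrow> wf_trm F t \<Longrightarrow> ground_trm t \<Longrightarrow> s \<noteq> t \<Longrightarrow> lt s t \<or> lt t s"
  using total by (auto simp: totalp_on_def)

lemma lt_replace_at:
  assumes "p \<in> poss t" "lt a b" "wf_trm F (replace_at t p a)"
  shows "lt (replace_at t p a) (replace_at t p b)"
  using assms
proof (induction p arbitrary: t)
  case (Cons i p)
  then obtain f ts where t: "t = Fun f ts" "i < length ts" "p \<in> poss (ts ! i)" by (cases t) auto
  have wf: "wf_trm F (Fun f (take i ts @ replace_at (ts ! i) p a # drop (Suc i) ts))"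
    using Cons.prems(3) t by (simp add: upd_conv_take_nth_drop)
  then have "lt (replace_at (ts ! i) p a) (replace_at (ts ! i) p b)"
    using Cons.IH t Cons.prems(2) by auto
  with wf show ?case
    using ordering t unfolding reduction_ordering_def by (simp add: upd_conv_take_nth_drop)
qed simp

text \<open>If a term were smaller than one of its subterms, plugging it into itself repeatedly would
  give an infinite descending chain.\<close>

lemma lt_proper_subterm:
  assumes "s \<in> proper_subterms t" "wf_trm F t" "ground_trm t"
  shows "lt s t"
proof (rule ccontr)
  assume "\<not> lt s t"
  obtain p where p: "p \<in> poss t" "p \<noteq> []" "s = subt_at t p"
    using assms(1) by (auto simp: proper_subterms_def)
  have s: "s \<in> subterms t" using p by (auto simp: subterms_def)
  have "lt t s"
    using \<open>\<not> lt s t\<close> lt_total[of s t] wf_subterm[OF s] ground_subterm[OF s] assms proper_subterms_neq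
    by blast
  have no: "\<not> lt (replace_at t p x) x" for x
  proof (induction x rule: wfp_induct_rule[OF lt_wfp])
    case (1 x)
    show ?case
    proof
      assume less: "lt (replace_at t p x) x"
      then have "wf_trm F (replace_at t p (replace_at t p x))"
        using wf_replace_at[of p t F "replace_at t p x"] lt_wf[OF less] p assms(2) wf_subt_at by blast
      then have "lt (replace_at t p (replace_at t p x)) (replace_at t p x)"
        using lt_replace_at[OF p(1) less] by blast
      then show False using 1 less by blast
    qed
  qed
  show False using no[of s] \<open>lt t s\<close> p by (simp add: replace_at_same)
qed

lemma subterm_le:
  "s \<in> subterms t \<Longrightarrow> wf_trm F t \<Longrightarrow> ground_trm t \<Longrightarrow> lt s t \<or> s = t"
  using lt_proper_subterm by (auto simp: subterms_iff_proper)

definition reduced :: "('f, 'v) trs \<Rightarrow> bool" where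
  "reduced R \<longleftrightarrow> ground_trs R \<and> left_reduced R \<and> contained_in R lt"

lemma reduced_subset: "reduced R \<Longrightarrow> S \<subseteq> R \<Longrightarrow> reduced S"
  unfolding reduced_def ground_trs_def contained_in_def left_reduced_def irreducible_iff by blast

lemma reduced_rule:
  assumes "reduced R" "(u, v) \<in> R"
  shows "lt v u" "ground_trm u" "ground_trm v" "wf_trm F u" "wf_trm F v"
  using assms lt_wf by (auto simp: reduced_def ground_trs_def contained_in_def)

lemma reduced_overlap:
  assumes "reduced R" "(u, v) \<in> R" "(u', v') \<in> R" "u' \<in> subterms u"
  shows "u' = u" "v' = v"
proof -
  have "(u', v') = (u, v)"
    using assms unfolding reduced_def left_reduced_def irreducible_iff by blast
  then show "u' = u" "v' = v" by simp_all
qed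

text \<open>If one position extends the other, then one left-hand side is a subterm of the other.
  Left-reducedness makes the two rules equal, and comparing sizes makes the positions equal.\<close>

lemma reduced_parallel:
  assumes R: "reduced R" and uv: "(u, v) \<in> R" "p \<in> poss t" "subt_at t p = u"
    and uv': "(u', v') \<in> R" "p' \<in> poss t" "subt_at t p' = u'"
  shows "p = p' \<and> u = u' \<and> v = v' \<or> parallel_pos p p'"
proof -
  have *: "r = [] \<and> u = u' \<and> v = v'"
    if "(u, v) \<in> R" "q \<in> poss t" "subt_at t q = u" and "(u', v') \<in> R" "q @ r \<in> poss t" "subt_at t (q @ r) = u'"
    for u v q r u' v'
  proof -
    have r: "r \<in> poss u" "subt_at u r = u'" using that by (auto simp: poss_append subt_at_append)
    then have "u' \<in> subterms u" by (auto simp: subterms_def)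
    from reduced_overlap[OF R that(1,4) this] show ?thesis using size_subt_at[OF r(1)] r(2) by auto
  qed
  show ?thesis
  proof (cases "parallel_pos p p'")
    case False
    then obtain r where "p' = p @ r \<or> p = p' @ r" unfolding parallel_pos_def by blast
    then show ?thesis
    proof
      assume "p' = p @ r"
      then show ?thesis using *[OF uv, of u' v' r] uv' by simp
    next
      assume "p = p' @ r"
      then show ?thesis using *[OF uv', of u v r] uv by simp
    qed
  qed simp
qed

section \<open>Termination and confluence of reduced systems\<close>

lemma rstep_lt:
  assumes "reduced R" "(t, t') \<in> rstep R" "wf_trm F t"
  shows "lt t' t"
  using assms(2)
proof (rule rstepE)
  fix u v p assume *: "(u, v) \<in> R" "p \<in> poss t" "subt_at t p = u" "t' = replace_at t p v"
  have "wf_trm F t'" using * assms(3) reduced_rule[OF assms(1) *(1)] wf_replace_at by blast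
  then have "lt t' (replace_at t p u)"
    using lt_replace_at[OF *(2), of v u] reduced_rule[OF assms(1) *(1)] * by simp
  then show ?thesis using replace_at_same[OF *(2)] *(3) by simp
qed

lemma rstep_wf: "reduced R \<Longrightarrow> (t, t') \<in> rstep R \<Longrightarrow> wf_trm F t \<longleftrightarrow> wf_trm F t'"
  by (erule rstepE) (auto simp: wf_replace_at reduced_rule)

lemma rstep_ground: "reduced R \<Longrightarrow> (t, t') \<in> rstep R \<Longrightarrow> ground_trm t \<Longrightarrow> ground_trm t'"
  by (erule rstepE) (auto simp: ground_replace_at reduced_rule)

text \<open>Two distinct first redexes are parallel, and the induction hypothesis supplies a
  multiset for their common reduct. The label of a redex depends only on its position and
  \<open>m\<close>, so both orders of contraction record the same two labelled redexes.\<close>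

lemma redexes_ex1:
  assumes R: "reduced R"
  shows "wf_trm F t \<Longrightarrow> \<exists>!M. redexes R t m M"
proof (induction t rule: wfp_induct_rule[OF lt_wfp])
  case (1 t)
  let ?l = "\<lambda>p. if p = [] \<or> m > 0 then m else (1 :: nat)"
  have IH: "\<exists>!M. redexes R (replace_at t p v) m M"
    if "(u, v) \<in> R" "p \<in> poss t" "subt_at t p = u" for u v p
  proof -
    have "(t, replace_at t p v) \<in> rstep R" by (rule rstepI[OF that])
    with 1 show ?thesis using rstep_lt[OF R] rstep_wf[OF R] by simp
  qed
  have uniq: "M = M'"
    if "(u, v) \<in> R" "p \<in> poss t" "subt_at t p = u"
      "redexes R (replace_at t p v) m M" "redexes R (replace_at t p v) m M'" for u v p M M'
    using ex1E[OF IH[OF that(1-3)]] that(4,5) by metis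
  show ?case
  proof (cases "irreducible R t")
    case True
    have "M = {#}" if "redexes R t m M" for M
      using that
    proof (cases rule: redexes_cases_step)
      case (2 u v p M')
      then show ?thesis using rstepI[of u v R p t] True by (simp add: irreducible_def)
    qed
    with True show ?thesis using redexes.irred by blast
  next
    case False
    then obtain u v p where uv: "(u, v) \<in> R" "p \<in> poss t" "subt_at t p = u"
      by (auto simp: irreducible_def elim: rstepE)
    from IH[OF uv] obtain M where M: "redexes R (replace_at t p v) m M" by blast
    have "M' = add_mset (u, ?l p) M" if "redexes R t m M'" for M'
      using that
    proof (rule redexes_cases_step)
      fix u' v' p' M''
      assume uv': "(u', v') \<in> R" "p' \<in> poss t" "subt_at t p' = u'"
        and M': "M' = add_mset (u', ?l p') M''" and M'': "redexes R (replace_at t p' v') m M''"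
      from reduced_parallel[OF R uv uv'] show "M' = add_mset (u, ?l p) M"
      proof (elim disjE conjE)
        assume "p = p'" "u = u'" "v = v'"
        then show ?thesis using uniq[OF uv M] M' M'' by simp
      next
        assume par: "parallel_pos p p'"
        note q = parallel_replace_at[OF uv(2) uv'(2) par, of v v']
        note q' = parallel_replace_at[OF uv'(2) uv(2) parallel_pos_sym[OF par], of v' v]
        have s: "(t, replace_at t p v) \<in> rstep R" by (rule rstepI[OF uv])
        have j: "(replace_at t p v, replace_at (replace_at t p v) p' v') \<in> rstep R"
          using q uv' by (intro rstepI) auto
        note wf = rstep_wf[OF R s] rstep_wf[OF R j]
        have "lt (replace_at (replace_at t p v) p' v') t"
          using rstep_lt[OF R s] rstep_lt[OF R j] wf 1(2) by (blast intro: lt_trans)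
        from 1(1)[OF this] obtain K where K: "redexes R (replace_at (replace_at t p v) p' v') m K"
          using wf 1(2) by blast
        have "redexes R (replace_at t p v) m (add_mset (u', ?l p') K)"
          using redexes_step[OF uv'(1) _ _ K] q uv' by simp
        then have M: "M = add_mset (u', ?l p') K" by (rule uniq[OF uv M])
        have "redexes R (replace_at t p' v') m (add_mset (u, ?l p) K)"
          using q' uv(3) K by (intro redexes_step[OF uv(1)]) (simp_all flip: conjunct2[OF conjunct2[OF q]])
        then have "M'' = add_mset (u, ?l p) K" by (rule uniq[OF uv' M''])
        then show ?thesis using M M' by simp
      qed
    qed (use False in blast)
    then show ?thesis using redexes_step[OF uv M] by blast
  qed
qed

lemma rm_eq: "reduced R \<Longrightarrow> wf_trm F t \<Longrightarrow> redexes R t m M \<Longrightarrow> rm R t m = M"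
  unfolding rm_def using redexes_ex1 by (blast intro: the1_equality)

lemma redexes_rm: "reduced R \<Longrightarrow> wf_trm F t \<Longrightarrow> redexes R t m (rm R t m)"
  unfolding rm_def using redexes_ex1 by (rule theI')

lemma rm_irreducible: "reduced R \<Longrightarrow> wf_trm F t \<Longrightarrow> irreducible R t \<Longrightarrow> rm R t m = {#}"
  by (rule rm_eq) (auto intro: redexes.irred)

lemma rm_step:
  assumes "reduced R" "wf_trm F t" "(u, v) \<in> R" "p \<in> poss t" "subt_at t p = u"
  shows "rm R t m = add_mset (u, if p = [] \<or> m > 0 then m else 1) (rm R (replace_at t p v) m)"
  using assms rm_eq redexes_step redexes_rm rstepI rstep_wf by meson

text \<open>The same peak analysis as for redex multisets, with the normal form of the common reduct
  joining the two sides.\<close>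

lemma normal_form_ex1:
  assumes R: "reduced R"
  shows "wf_trm F t \<Longrightarrow> \<exists>!t'. (t, t') \<in> (rstep R)\<^sup>* \<and> irreducible R t'"
proof (induction t rule: wfp_induct_rule[OF lt_wfp])
  case (1 t)
  have IH: "\<exists>!n. (t', n) \<in> (rstep R)\<^sup>* \<and> irreducible R n" if "(t, t') \<in> rstep R" for t'
    using 1 that rstep_lt[OF R] rstep_wf[OF R] by blast
  have uniq: "n = n'"
    if "(t, t') \<in> rstep R" "(t', n) \<in> (rstep R)\<^sup>*" "irreducible R n"
      "(t', n') \<in> (rstep R)\<^sup>*" "irreducible R n'" for t' n n'
    using ex1E[OF IH[OF that(1)]] that(2-) by metis
  have irr: "t' = t" if "irreducible R t" "(t, t') \<in> (rstep R)\<^sup>*" for t'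
    using that(2,1) by (auto simp: irreducible_def elim: converse_rtranclE)
  show ?case
  proof (cases "irreducible R t")
    case True
    then show ?thesis using irr by blast
  next
    case False
    then obtain u v p where uv: "(u, v) \<in> R" "p \<in> poss t" "subt_at t p = u"
      by (auto simp: irreducible_def elim: rstepE)
    note s = rstepI[OF uv]
    from IH[OF s] obtain n where n: "(replace_at t p v, n) \<in> (rstep R)\<^sup>*" "irreducible R n" by blast
    have "n' = n" if n': "(t, n') \<in> (rstep R)\<^sup>*" "irreducible R n'" for n'
    proof -
      obtain t' where t': "(t, t') \<in> rstep R" "(t', n') \<in> (rstep R)\<^sup>*"
        using n' False by (blast elim: converse_rtranclE)
      from t'(1) show ?thesis
      proof (rule rstepE)
        fix u' v' p' assume uv': "(u', v') \<in> R" "p' \<in> poss t" "subt_at t p' = u'"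
          and t'_eq: "t' = replace_at t p' v'"
        from reduced_parallel[OF R uv uv'] show ?thesis
        proof (elim disjE conjE)
          assume "p = p'" "u = u'" "v = v'"
          then show ?thesis using uniq[OF s] n n'(2) t' t'_eq by blast
        next
          assume par: "parallel_pos p p'"
          note q = parallel_replace_at[OF uv(2) uv'(2) par, of v v']
          note q' = parallel_replace_at[OF uv'(2) uv(2) parallel_pos_sym[OF par], of v' v]
          let ?j = "replace_at (replace_at t p v) p' v'"
          have j: "(replace_at t p v, ?j) \<in> rstep R"
            using q uv' by (intro rstepI) auto
          have j': "(t', ?j) \<in> rstep R"
            unfolding t'_eq using q' uv
            by (simp only: conjunct2[OF conjunct2[OF q]]) (intro rstepI, auto)
          note wf = rstep_wf[OF R s] rstep_wf[OF R j]
          have "lt ?j t"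
            using rstep_lt[OF R s] rstep_lt[OF R j] wf 1(2) by (blast intro: lt_trans)
          from 1(1)[OF this] obtain k where k: "(?j, k) \<in> (rstep R)\<^sup>*" "irreducible R k"
            using wf 1(2) by blast
          have "k = n" using uniq[OF s] n j k by (meson converse_rtrancl_into_rtrancl)
          moreover have "k = n'"
            using uniq[OF t'(1)] n' t'(2) j' k by (meson converse_rtrancl_into_rtrancl)
          ultimately show ?thesis by simp
        qed
      qed
    qed
    then show ?thesis using converse_rtrancl_into_rtrancl[OF s n(1)] n(2) by blast
  qed
qed

lemma normal_form_eq:
  "reduced R \<Longrightarrow> wf_trm F t \<Longrightarrow> (t, t') \<in> (rstep R)\<^sup>* \<Longrightarrow> irreducible R t' \<Longrightarrow> normal_form R t = t'"
  unfolding normal_form_def using normal_form_ex1 by (blast intro: the1_equality)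

lemma normal_form:
  assumes "reduced R" "wf_trm F t"
  shows "(t, normal_form R t) \<in> (rstep R)\<^sup>*" "irreducible R (normal_form R t)"
  using theI'[OF normal_form_ex1[OF assms]] unfolding normal_form_def by blast+

lemma normal_form_irreducible:
  "reduced R \<Longrightarrow> wf_trm F t \<Longrightarrow> irreducible R t \<Longrightarrow> normal_form R t = t"
  by (rule normal_form_eq) auto

lemma normal_form_step:
  assumes "reduced R" "wf_trm F t" "(t, t') \<in> rstep R"
  shows "normal_form R t = normal_form R t'"
proof -
  have "wf_trm F t'" using rstep_wf assms by blast
  from normal_form[OF assms(1) this] show ?thesis
    using assms by (intro normal_form_eq) (auto intro: converse_rtrancl_into_rtrancl)
qed

lemma rsteps_le:
  assumes "reduced R" "(t, t') \<in> (rstep R)\<^sup>*" "wf_trm F t"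
  shows "wf_trm F t' \<and> (lt t' t \<or> t' = t)"
  using assms(2,3)
proof induction
  case (step b c)
  then show ?case using rstep_lt[OF assms(1)] rstep_wf[OF assms(1)] lt_trans by blast
qed simp

lemma rsteps_ground:
  assumes "reduced R" "(t, t') \<in> (rstep R)\<^sup>*" "ground_trm t"
  shows "ground_trm t'"
  using assms(2,3) by induction (use assms(1) rstep_ground in blast)+

lemma normal_form_le: "reduced R \<Longrightarrow> wf_trm F t \<Longrightarrow> lt (normal_form R t) t \<or> normal_form R t = t"
  using rsteps_le normal_form(1) by blast

lemma normal_form_wf: "reduced R \<Longrightarrow> wf_trm F t \<Longrightarrow> wf_trm F (normal_form R t)"
  using rsteps_le normal_form(1) by blast

lemma normal_form_ground: "reduced R \<Longrightarrow> wf_trm F t \<Longrightarrow> ground_trm t \<Longrightarrow> ground_trm (normal_form R t)"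
  using rsteps_ground normal_form(1) by blast

lemma conversion_iff_normal_form:
  assumes R: "reduced R" and wf: "wf_trm F s" "wf_trm F t"
  shows "(s, t) \<in> conversion R \<longleftrightarrow> normal_form R s = normal_form R t"
proof
  assume "(s, t) \<in> conversion R"
  \<comment> \<open>A conversion may climb to larger terms; well-formedness survives because
    rewriting preserves it in both directions.\<close>
  then have "wf_trm F t \<and> normal_form R s = normal_form R t" using wf(1) unfolding conversion_def
  proof induction
    case (step b c)
    then show ?case using normal_form_step[OF R] rstep_wf[OF R] by auto
  qed simp
  then show "normal_form R s = normal_form R t" ..
next
  assume "normal_form R s = normal_form R t"
  then show "(s, t) \<in> conversion R"
    using normal_form(1)[OF R wf(1)] normal_form(1)[OF R wf(2)]
    by (metis rsteps_conversion conversion_sym conversion_trans)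
qed

lemma rm_le:
  assumes R: "reduced R"
  shows "wf_trm F t \<Longrightarrow> ground_trm t \<Longrightarrow> (a, l) \<in># rm R t m \<Longrightarrow>
    (lt a t \<or> a = t) \<and> wf_trm F a \<and> ground_trm a"
proof (induction t rule: wfp_induct_rule[OF lt_wfp])
  case (1 t)
  from redexes_rm[OF R 1(2), of m] show ?case
  proof (rule redexes_cases_step)
    fix u v p M' assume uv: "(u, v) \<in> R" "p \<in> poss t" "subt_at t p = u"
    note s = rstepI[OF uv]
    have "lt u t \<or> u = t" using subterm_le[of u t] uv 1 by (auto simp: subterms_def)
    then show ?thesis
      using 1(4) 1(1)[OF rstep_lt[OF R s 1(2)]] rm_step[OF R 1(2) uv, of m] lt_trans
        rstep_lt[OF R s 1(2)] rstep_wf[OF R s] rstep_ground[OF R s] 1(2,3) reduced_rule[OF R uv(1)] by auto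
  qed (use 1 in auto)
qed

section \<open>Restriction to the rules below a term; for the candidate this is the partial system
  \<open>R_s\<close>\<close>

abbreviation below :: "('f, 'v) trm \<Rightarrow> ('f, 'v) trs \<Rightarrow> ('f, 'v) trs" where
  "below s R \<equiv> {(u, v) \<in> R. lt u s}"

lemma rstep_below:
  assumes "lt t s" "ground_trm t"
  shows "(t, t') \<in> rstep (below s R) \<longleftrightarrow> (t, t') \<in> rstep R"
proof
  assume "(t, t') \<in> rstep R"
  then show "(t, t') \<in> rstep (below s R)"
  proof (rule rstepE)
    fix u v p assume uv: "(u, v) \<in> R" "p \<in> poss t" "subt_at t p = u" "t' = replace_at t p v"
    have "lt u s" using subterm_le[of u t] assms lt_wf lt_trans uv by (metis imageI subterms_def)
    then show ?thesis using uv rstepI[of u v "below s R" p t] by auto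
  qed
qed (use rstep_mono[of "below s R" R] in blast)

lemma irreducible_below: "lt t s \<Longrightarrow> ground_trm t \<Longrightarrow> irreducible (below s R) t \<longleftrightarrow> irreducible R t"
  by (simp add: irreducible_def rstep_below)

text \<open>Rewriting only decreases terms, and all subterms of a term below \<open>s\<close> are
  below \<open>s\<close>, so the omitted rules never apply.\<close>

lemma below_eqs:
  assumes R: "reduced R"
  shows "lt t s \<Longrightarrow> ground_trm t \<Longrightarrow>
    normal_form (below s R) t = normal_form R t \<and> rm (below s R) t m = rm R t m"
proof (induction t rule: wfp_induct_rule[OF lt_wfp])
  case (1 t)
  note wf = lt_wf(1)[OF 1(2)]
  have B: "reduced (below s R)" using R by (rule reduced_subset) auto
  show ?case
  proof (cases "irreducible R t")
    case True
    then show ?thesis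
      using wf B R irreducible_below[OF 1(2,3)] by (simp add: normal_form_irreducible rm_irreducible)
  next
    case False
    then obtain t' where t': "(t, t') \<in> rstep (below s R)"
      using rstep_below[OF 1(2,3)] by (auto simp: irreducible_def)
    have s: "(t, t') \<in> rstep R" using t' rstep_below[OF 1(2,3)] by simp
    have IH: "normal_form (below s R) t' = normal_form R t'" "rm (below s R) t' m = rm R t' m"
      using 1 rstep_lt[OF R s wf] rstep_ground[OF R s] lt_trans by blast+
    from t' obtain u v p where uv: "(u, v) \<in> below s R" "p \<in> poss t" "subt_at t p = u" "t' = replace_at t p v"
      by (rule rstepE)
    then have uv': "(u, v) \<in> R" by auto
    show ?thesis
      using IH normal_form_step[OF R wf s] normal_form_step[OF B wf t']
        rm_step[OF R wf uv' uv(2,3)] rm_step[OF B wf uv(1-3)] uv(4) by simp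
  qed
qed

end

section \<open>Clauses and closures\<close>

lemma gc_rel_refl: "ground_cls (subst_cls C \<theta>) \<Longrightarrow> gc_rel (C, \<theta>) (C, \<theta>)"
  by (auto simp: gc_rel_def subst_cls_Var comp_def id_def intro!: exI[of _ id])

lemma inst_gclo: "ground_cls (subst_cls C \<theta>) \<Longrightarrow> inst (gclo C \<theta>) = subst_cls C \<theta>"
  unfolding gclo_def by (simp add: inst.abs_eq eq_onp_def gc_rel_refl)

lemma nm_gclo: "ground_cls (subst_cls C \<theta>) \<Longrightarrow> nm R (gclo C \<theta>) = nm_raw R C \<theta>"
  unfolding gclo_def by (simp add: nm.abs_eq gc_rel_refl)

lemma wf_closure_gclo:
  "ground_cls (subst_cls C \<theta>) \<Longrightarrow>
   wf_closure F (gclo C \<theta>) \<longleftrightarrow> wf_cls F C \<and> (\<forall>x \<in> vars_cls C. wf_trm F (\<theta> x))"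
  unfolding gclo_def by (simp add: wf_closure.abs_eq gc_rel_refl)

lemma horn_closure_gclo: "ground_cls (subst_cls C \<theta>) \<Longrightarrow> horn_closure (gclo C \<theta>) \<longleftrightarrow> horn C"
  unfolding gclo_def by (simp add: horn_closure.abs_eq gc_rel_refl)

lemma gclo_eqI: "gc_rel (C, \<theta>) (D, \<tau>) \<Longrightarrow> gclo C \<theta> = gclo D \<tau>"
  unfolding gclo_def
  using Quotient_rel[OF Quotient_gclosure] by blast

lemma gclo_cases:
  obtains C \<theta> where "c = gclo C \<theta>" "ground_cls (subst_cls C \<theta>)"
proof -
  obtain C \<theta> where "c = abs_gclosure (C, \<theta>)" "gc_rel (C, \<theta>) (C, \<theta>)"
    by (induct c rule: gclosure.abs_induct) auto
  then show thesis using that by (auto simp: gclo_def gc_rel_def)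
qed

section \<open>Closures: renaming apart, instances and truth\<close>

lemma finite_sides: "finite (sides L)"
  by (cases "atm L") (simp add: sides_def)

lemma finite_vars_cls: "finite (vars_cls C)"
  by (auto simp: vars_cls_def finite_vars_trm finite_sides)

lemma bij_rename_apart:
  assumes "infinite (UNIV :: 'v set)" "finite (A :: 'v set)" "finite V"
  obtains \<rho> :: "'v \<Rightarrow> 'v" where "bij \<rho>" "\<rho> ` A \<inter> V = {}"
proof -
  obtain B where B: "finite B" "card B = card A" "B \<subseteq> UNIV - (A \<union> V)"
    using infinite_arbitrarily_large[of "UNIV - (A \<union> V)" "card A"] assms by auto
  then obtain f where f: "bij_betw f A B" using finite_same_card_bij[of A B] assms by auto
  have AB: "A \<inter> B = {}" using B by blast
  \<comment> \<open>Closures are identified only along bijections of all variables. Swapping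
    \<open>A\<close> with the fresh set \<open>B\<close> is an involution, hence such a
    bijection.\<close>
  define \<rho> where "\<rho> x = (if x \<in> A then f x else if x \<in> B then inv_into A f x else x)" for x
  have "\<rho> (\<rho> x) = x" for x
    using f AB bij_betw_inv_into[OF f]
    by (auto simp: \<rho>_def bij_betw_inv_into_left bij_betw_inv_into_right bij_betwE bij_betw_apply
        dest: bij_betw_apply)
  then have "bij \<rho>" by (rule involuntory_imp_bij)
  moreover have "\<rho> ` A \<inter> V = {}" using bij_betw_imp_surj_on[OF f] B by (auto simp: \<rho>_def)
  ultimately show thesis by (rule that)
qed

text \<open>Superposition asks for premises with disjoint variables and a common substitution; this
  supplies a suitable representative of one premise.\<close>

lemma gclo_cases_apart:
  fixes c :: "('f, 'v) gclosure"
  assumes "infinite (UNIV :: 'v set)" "finite V"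
  obtains C \<theta> where "c = gclo C \<theta>" "ground_cls (subst_cls C \<theta>)" "vars_cls C \<inter> V = {}"
proof -
  obtain C \<theta> where C: "c = gclo C \<theta>" "ground_cls (subst_cls C \<theta>)" by (rule gclo_cases)
  obtain \<rho> where \<rho>: "bij \<rho>" "\<rho> ` vars_cls C \<inter> V = {}"
    using bij_rename_apart[OF assms(1) finite_vars_cls assms(2)] .
  let ?D = "subst_cls C (Var \<circ> \<rho>)" and ?\<tau> = "\<theta> \<circ> inv \<rho>"
  have "subst_cls ?D ?\<tau> = subst_cls C \<theta>"
    by (simp add: subst_cls_comp subst_comp_def bij_is_inj[OF \<rho>(1)])
  then have "ground_cls (subst_cls ?D ?\<tau>)" using C by simp
  moreover have "gc_rel (C, \<theta>) (?D, ?\<tau>)"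
    using C(2) calculation \<rho>(1) by (auto simp: gc_rel_def bij_is_inj intro!: exI[of _ \<rho>])
  moreover have "vars_cls ?D \<inter> V = {}" using \<rho>(2) by (auto simp: vars_subst_cls)
  ultimately show thesis using that gclo_eqI C(1) by metis
qed

definition cls_terms :: "('f, 'v) clause \<Rightarrow> ('f, 'v) trm set" where
  "cls_terms C = (\<Union>L \<in> set_mset C. \<Union>t \<in> sides L. subterms t)"

lemma sides_subst_lit: "sides (subst_lit L \<theta>) = (\<lambda>t. subst_trm t \<theta>) ` sides L"
  by (simp add: subst_lit_def sides_map_lit)

lemma is_Pos_subst_lit: "is_Pos (subst_lit L \<theta>) = is_Pos L"
  by (simp add: subst_lit_def is_Pos_map_lit)

lemma subst_lit_Upair:
  "subst_lit (Pos (Upair s t)) \<theta> = Pos (Upair (subst_trm s \<theta>) (subst_trm t \<theta>))"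
  "subst_lit (Neg (Upair s t)) \<theta> = Neg (Upair (subst_trm s \<theta>) (subst_trm t \<theta>))"
  by (simp_all add: subst_lit_def map_lit_def)

lemma subst_cls_memE:
  assumes "L \<in># subst_cls C \<theta>"
  obtains K where "K \<in># C" "L = subst_lit K \<theta>"
  using assms by (auto simp: subst_cls_def)

lemma ss_neg_subst: "t \<in> ss_neg C \<Longrightarrow> subst_trm t \<theta> \<in> ss_neg (subst_cls C \<theta>)"
  unfolding ss_neg_def subst_cls_lits by (auto simp: sides_subst_lit intro: subterms_subst)

lemma ss_pos_below_subst: "t \<in> ss_pos_below C \<Longrightarrow> subst_trm t \<theta> \<in> ss_pos_below (subst_cls C \<theta>)"
  unfolding ss_pos_below_def subst_cls_lits by (auto simp: sides_subst_lit intro: proper_subterms_subst)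

lemma ts_neg_subst: "t \<in> ts_neg C \<Longrightarrow> subst_trm t \<theta> \<in> ts_neg (subst_cls C \<theta>)"
  unfolding ts_neg_def subst_cls_lits by (auto simp: sides_subst_lit)

lemma ts_pos_subst: "t \<in> ts_pos C \<Longrightarrow> subst_trm t \<theta> \<in> ts_pos (subst_cls C \<theta>)"
  unfolding ts_pos_def subst_cls_lits by (auto simp: sides_subst_lit)

lemma cls_terms_simps:
  "ss_neg C \<subseteq> cls_terms C" "ss_pos_below C \<subseteq> cls_terms C" "ts_neg C \<subseteq> ss_neg C" "ts_pos C \<subseteq> cls_terms C"
  unfolding ss_neg_def ss_pos_below_def ts_neg_def ts_pos_def cls_terms_def
  using subterms_refl by (blast dest: subterms_iff_proper[THEN iffD2, OF disjI2])+

lemma lss_cls_terms: "(t, m) \<in> lss C \<Longrightarrow> subst_trm t \<theta> \<in> cls_terms (subst_cls C \<theta>)"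
  using cls_terms_simps ss_neg_subst ss_pos_below_subst ts_pos_subst unfolding lss_def by blast

lemma lts_cls_terms: "(t, m) \<in> lts C \<Longrightarrow> subst_trm t \<theta> \<in> cls_terms (subst_cls C \<theta>)"
  using cls_terms_simps ts_neg_subst ts_pos_subst unfolding lts_def by blast

lemma finite_lss: "finite (lss C)" and finite_lts: "finite (lts C)"
  unfolding lss_def lts_def ss_neg_def ss_pos_below_def ts_neg_def ts_pos_def
  by (auto intro!: finite_cartesian_product finite_UN_I finite_Diff
      simp: finite_sides finite_subterms finite_proper_subterms)

lemma mem_sum_mset: "x \<in># (\<Sum>a \<in> A. f a) \<Longrightarrow> \<exists>a \<in> A. x \<in># f a"
  by (induction A rule: infinite_finite_induct) auto

lemma nm_raw_cases:
  assumes "(a, l) \<in># nm_raw R C \<theta>"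
  obtains t m where "(t, m) \<in> lss C" "(a, l) \<in># rm_arg R \<theta> (t, m)"
  | t where "(t, l) \<in> lts C" "a = normal_form R (subst_trm t \<theta>)"
  using assms unfolding nm_raw_def by (fastforce dest!: mem_sum_mset)

lemma rm_arg_in_nm_raw: "tm \<in> lss C \<Longrightarrow> x \<in># rm_arg R \<theta> tm \<Longrightarrow> x \<in># nm_raw R C \<theta>"
  unfolding nm_raw_def by (auto simp: sum.remove[OF finite_lss])

lemma cls_true_plus: "cls_true R (C + D) \<longleftrightarrow> cls_true R C \<or> cls_true R D"
  by (auto simp: cls_true_def)

lemma subst_cls_plus: "subst_cls (C + D) \<theta> = subst_cls C \<theta> + subst_cls D \<theta>"
  by (simp add: subst_cls_def)

lemma cls_true_subst_replace:
  assumes "(subst_trm u \<theta>, subst_trm v \<theta>) \<in> conversion R"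
  shows "cls_true R (subst_cls (replace_cls u v C) \<theta>) \<longleftrightarrow> cls_true R (subst_cls C \<theta>)"
proof -
  have "lit_true R (subst_lit (map_lit (replace_all u v) L) \<theta>) \<longleftrightarrow> lit_true R (subst_lit L \<theta>)" for L
    unfolding subst_lit_def map_lit_comp
    by (rule lit_true_map_cong) (simp add: conversion_sym conversion_replace_all[OF assms])
  then show ?thesis by (simp add: subst_cls_def cls_true_def)
qed

lemma cls_true_subst_conversion:
  assumes "\<And>x. x \<in> vars_cls C \<Longrightarrow> (\<theta> x, \<tau> x) \<in> conversion R"
  shows "cls_true R (subst_cls C \<theta>) \<longleftrightarrow> cls_true R (subst_cls C \<tau>)"
proof -
  have "lit_true R (subst_lit L \<theta>) \<longleftrightarrow> lit_true R (subst_lit L \<tau>)" if "L \<in># C" for L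
    unfolding subst_lit_def
    using that by (intro lit_true_map_cong conversion_subst assms) (auto simp: vars_cls_def)
  then show ?thesis by (simp add: subst_cls_def cls_true_def)
qed

lemma wf_subst: "wf_trm F t \<Longrightarrow> (\<And>x. x \<in> vars_trm t \<Longrightarrow> wf_trm F (\<theta> x)) \<Longrightarrow> wf_trm F (subst_trm t \<theta>)"
  by (induction t) auto

lemma cls_terms_ground: "ground_cls C \<Longrightarrow> t \<in> cls_terms C \<Longrightarrow> ground_trm t"
  using vars_subterms by (fastforce simp: cls_terms_def ground_cls_def vars_cls_def ground_trm_def)

lemma cls_terms_wf:
  assumes "wf_cls F C" "\<forall>x \<in> vars_cls C. wf_trm F (\<theta> x)" "t \<in> cls_terms (subst_cls C \<theta>)"
  shows "wf_trm F t"
proof -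
  obtain L s where L: "L \<in># C" "s \<in> sides L" "t \<in> subterms (subst_trm s \<theta>)"
    using assms(3) by (auto simp: cls_terms_def subst_cls_def sides_subst_lit)
  then have "wf_trm F (subst_trm s \<theta>)"
    using assms(1,2) by (intro wf_subst) (auto simp: wf_cls_def vars_cls_def)
  then show ?thesis using wf_subterm L by blast
qed

lemma inst_terms:
  assumes "wf_closure F c" "t \<in> cls_terms (inst c)"
  shows "wf_trm F t" "ground_trm t"
proof -
  obtain C \<theta> where c: "c = gclo C \<theta>" "ground_cls (subst_cls C \<theta>)" by (rule gclo_cases)
  then have "wf_cls F C" "\<forall>x \<in> vars_cls C. wf_trm F (\<theta> x)" "t \<in> cls_terms (subst_cls C \<theta>)"
    using assms by (simp_all add: wf_closure_gclo inst_gclo)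
  then show "wf_trm F t" "ground_trm t" using cls_terms_wf cls_terms_ground c(2) by blast+
qed

lemma horn_pos_unique:
  assumes "horn C" "L \<in># C" "is_Pos L" "K \<in># C - {#L#}"
  shows "\<not> is_Pos K"
proof
  assume "is_Pos K"
  have "{#L, K#} \<subseteq># filter_mset is_Pos C"
    using assms \<open>is_Pos K\<close> by (auto simp: multiset_filter_mono insert_DiffM dest!: multi_member_split)
  then have "2 \<le> size (filter_mset is_Pos C)" by (auto dest: size_mset_mono)
  then show False using assms(1) by (simp add: horn_def)
qed

lemma horn_inst: "horn_closure c \<Longrightarrow> horn (inst c)"
  by (rule gclo_cases[of c])
    (auto simp: horn_closure_gclo inst_gclo horn_def subst_cls_def filter_mset_image_mset is_Pos_subst_lit)

lemma mset_uprod_Upair [simp]: "mset_uprod (Upair a b) = {#a, b#}"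
  by transfer simp

lemma mset_uprod_inject: "mset_uprod A = mset_uprod B \<longleftrightarrow> A = B"
  by (cases A; cases B) (auto simp: add_eq_conv_ex)

lemma size_mset_uprod: "size (mset_uprod A) = 2"
  by (cases A) simp

text \<open>The multisets have size 2 for positive and 4 for negative literals, so polarity can be
  read off. Injectivity is what lifts totality from terms to literals.\<close>

lemma mset_lit_inject: "mset_lit L = mset_lit K \<longleftrightarrow> L = K"
proof
  assume eq: "mset_lit L = mset_lit K"
  then have "size (mset_lit L) = size (mset_lit K)" by simp
  then show "L = K"
  proof (cases L; cases K)
    fix A B assume LK: "L = Neg A" "K = Neg B"
    have "count (mset_uprod A) x = count (mset_uprod B) x" for x
      using arg_cong[OF eq, of "\<lambda>M. count M x"] by (simp add: LK)
    then show ?thesis using LK mset_uprod_inject by (metis multiset_eqI)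
  qed (use eq in \<open>auto simp: size_mset_uprod mset_uprod_inject\<close>)
qed simp

lemma set_mset_lit: "set_mset (mset_lit L) = sides L"
  by (cases L; cases "atm L") (auto simp: sides_def)

lemma gclo_cong: "ground_cls (subst_cls C \<theta>) \<Longrightarrow> (\<And>x. x \<in> vars_cls C \<Longrightarrow> \<theta> x = \<tau> x) \<Longrightarrow> gclo C \<theta> = gclo C \<tau>"
  using subst_cls_cong[of C \<theta> \<tau>]
  by (intro gclo_eqI) (auto simp: gc_rel_def subst_cls_Var comp_def id_def intro!: exI[of _ id])

lemma ground_subst_cls: "ground_cls (subst_cls C \<theta>) \<longleftrightarrow> (\<forall>x \<in> vars_cls C. ground_trm (\<theta> x))"
  by (auto simp: ground_cls_def vars_subst_cls ground_trm_def)

lemma vars_cls_plus: "vars_cls (C + D) = vars_cls C \<union> vars_cls D"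
  by (auto simp: vars_cls_def)

lemma vars_replace_all: "vars_trm (replace_all u v t) \<subseteq> vars_trm t \<union> vars_trm v"
  by (induction t) auto

lemma vars_replace_cls: "vars_cls (replace_cls u v C) \<subseteq> vars_cls C \<union> vars_trm v"
  using vars_replace_all by (fastforce simp: vars_cls_def sides_map_lit)

text \<open>A false negative literal is an equation that holds, and it keeps holding when rules are
  added. With positive literals this would fail, which is where the Horn restriction enters.\<close>

lemma cls_false_mono:
  assumes "\<forall>L \<in># C. \<not> is_Pos L" "\<not> cls_true R C" "R \<subseteq> S"
  shows "\<not> cls_true S C"
proof -
  have "\<not> lit_true S L" if L: "L \<in># C" for L
  proof (cases L)
    case (Neg A)
    obtain s t where A: "A = Upair s t" by (cases A)
    have "(s, t) \<in> conversion R" using assms(2) L by (auto simp: cls_true_def Neg A eq_true_Upair)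
    then show ?thesis using conversion_mono[OF assms(3)] by (auto simp: Neg A eq_true_Upair)
  qed (use L assms(1) in auto)
  then show ?thesis by (simp add: cls_true_def)
qed

lemma lss_of_labelled: "t \<in> ss_neg C \<union> ss_pos_below C \<Longrightarrow> \<exists>l > 0. (t, l) \<in> lss C"
  by (cases "t \<in> ss_neg C") (auto simp: lss_def)

lemma lss_of_ts_pos: "t \<in> ts_pos C \<Longrightarrow> \<exists>l. (t, l) \<in> lss C"
  using lss_of_labelled[of t C] by (cases "t \<in> ss_neg C \<union> ss_pos_below C") (auto simp: lss_def)

lemma multp_dominated: "b \<in># N \<Longrightarrow> (\<And>a. a \<in># M \<Longrightarrow> r a b) \<Longrightarrow> multp r M N"
  using one_step_implies_multp[of N M r "{#}"] by fastforce

lemma in_minus_single: "x \<in># M \<Longrightarrow> x \<noteq> y \<Longrightarrow> x \<in># M - {#y#}"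
  by (simp add: in_diff_count)

section \<open>Orderings on literals, clauses and closures\<close>

context term_ordering
begin

lemma lit_less_transp: "transp (lit_less lt)"
  unfolding lit_less_def using transp_multp[OF lt_transp] by (auto intro!: transpI dest: transpD)

lemma lit_less_wfp: "wfp (lit_less lt)"
  by (rule wfp_if_convertible_to_wfp[OF wfp_multp[OF lt_wfp], of _ mset_lit]) (simp add: lit_less_def)

lemma lit_less_asym: "lit_less lt L K \<Longrightarrow> \<not> lit_less lt K L"
  using lit_less_wfp by (metis wfp_imp_asymp asympD)

lemma lit_less_total:
  "totalp_on {L. \<forall>t \<in> sides L. wf_trm F t \<and> ground_trm t} (lit_less lt)"
proof -
  have "totalp_on {M. set_mset M \<subseteq> {t. wf_trm F t \<and> ground_trm t}} (multp lt)"
    by (rule totalp_on_multp[OF total lt_transp]) auto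
  then show ?thesis
    unfolding lit_less_def totalp_on_def by (auto simp: set_mset_lit subset_iff mset_lit_inject)
qed

lemma cls_less_wfp: "wfp (cls_less lt)"
  unfolding cls_less_def by (rule wfp_multp[OF lit_less_wfp])

lemma cls_less_total:
  "totalp_on {C. \<forall>L \<in># C. \<forall>t \<in> sides L. wf_trm F t \<and> ground_trm t} (cls_less lt)"
  unfolding cls_less_def by (rule totalp_on_multp[OF lit_less_total lit_less_transp]) auto

lemma label_less_transp: "transp (label_less lt)"
  using lt_trans by (auto simp: label_less_def intro!: transpI)

lemma label_less_wfp: "wfp (label_less lt)"
proof -
  have "wf ({(x, y). lt x y} <*lex*> less_than)"
    using lt_wfp by (intro wf_lex_prod) (simp_all add: wfp_def)
  moreover have "{(x, y). label_less lt x y} = {(x, y). lt x y} <*lex*> less_than"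
    by (auto simp: label_less_def)
  ultimately show ?thesis by (simp add: wfp_def)
qed

lemma label_less_total: "totalp_on ({t. wf_trm F t \<and> ground_trm t} \<times> UNIV) (label_less lt)"
  using lt_total by (auto simp: label_less_def totalp_on_def)

lemma multp_label_less_wfp: "wfp (multp (label_less lt))"
  by (rule wfp_multp[OF label_less_wfp])

section \<open>Bounds on the labelled terms of a closure\<close>

lemma normalized_args:
  assumes R: "reduced R" and wf: "wf_trm F (Fun f ts)" and g: "ground_trm (Fun f ts)"
  shows "wf_trm F (Fun f (map (normal_form R) ts))" "ground_trm (Fun f (map (normal_form R) ts))"
    "lt (Fun f (map (normal_form R) ts)) (Fun f ts) \<or> Fun f (map (normal_form R) ts) = Fun f ts"
proof -
  have "(Fun f ts, Fun f (map (normal_form R) ts)) \<in> (rstep R)\<^sup>*"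
    using normal_form(1)[OF R] wf by (intro rsteps_Fun) (auto simp: list_all2_conv_all_nth)
  then show "wf_trm F (Fun f (map (normal_form R) ts))" "ground_trm (Fun f (map (normal_form R) ts))"
    "lt (Fun f (map (normal_form R) ts)) (Fun f ts) \<or> Fun f (map (normal_form R) ts) = Fun f ts"
    using rsteps_le[OF R] rsteps_ground[OF R] wf g by blast+
qed

lemma rm_arg_Fun:
  "rm_arg R \<theta> (Fun f ts, m) = rm R (Fun f (map (normal_form R) (map (\<lambda>t. subst_trm t \<theta>) ts))) m"
  by (simp add: comp_def)

lemma rm_arg_le:
  assumes R: "reduced R" and wf: "wf_trm F (subst_trm t \<theta>)" and g: "ground_trm (subst_trm t \<theta>)"
    and a: "(a, l) \<in># rm_arg R \<theta> (t, m)"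
  shows "(lt a (subst_trm t \<theta>) \<or> a = subst_trm t \<theta>) \<and> wf_trm F a \<and> ground_trm a"
proof (cases t)
  case (Var x)
  show ?thesis using rm_le[OF R wf g, of a l m] a by (simp add: Var)
next
  case (Fun f ts)
  note n = normalized_args[OF R wf[unfolded Fun subst_trm.simps] g[unfolded Fun subst_trm.simps]]
  note le = rm_le[OF R n(1,2) a[unfolded Fun rm_arg_Fun]]
  show ?thesis
    unfolding Fun subst_trm.simps using le_trans[OF conjunct1[OF le] n(3)] le by simp
qed

text \<open>Needed for comparability: \<open>lt\<close> is total only on well-formed ground terms,
  so its multiset extension is total only on multisets of such terms.\<close>

lemma nm_terms:
  assumes "reduced R" "wf_closure F c"
  shows "set_mset (nm R c) \<subseteq> {t. wf_trm F t \<and> ground_trm t} \<times> UNIV"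
proof
  fix x assume x: "x \<in># nm R c"
  obtain C \<theta> where c: "c = gclo C \<theta>" "ground_cls (subst_cls C \<theta>)" by (rule gclo_cases)
  obtain a l where al: "x = (a, l)" by (cases x)
  have wf: "wf_trm F t" "ground_trm t" if "t \<in> cls_terms (subst_cls C \<theta>)" for t
    using inst_terms[OF assms(2)] that c by (simp_all add: inst_gclo)
  have "(a, l) \<in># nm_raw R C \<theta>" using x c al by (simp add: nm_gclo)
  then show "x \<in> {t. wf_trm F t \<and> ground_trm t} \<times> UNIV"
  proof (rule nm_raw_cases)
    fix t m assume "(t, m) \<in> lss C" "(a, l) \<in># rm_arg R \<theta> (t, m)"
    then show ?thesis using rm_arg_le[OF assms(1)] wf[OF lss_cls_terms] al by blast
  next
    fix t assume "(t, l) \<in> lts C" "a = normal_form R (subst_trm t \<theta>)"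
    then show ?thesis
      using normal_form_wf[OF assms(1)] normal_form_ground[OF assms(1)] wf[OF lts_cls_terms] al by blast
  qed
qed

section \<open>Asymmetry, totality and minimal elements of the closure ordering\<close>

lemma closure_less_asym:
  assumes "closure_ordering F ltClo" "wf_closure F c" "wf_closure F d"
    and "closure_less lt ltClo R c d"
  shows "\<not> closure_less lt ltClo R d c"
proof -
  have "wfp_on (Collect (wf_closure F)) ltClo" using assms(1) by (simp add: closure_ordering_def)
  \<comment> \<open>Asymmetry of \<open>ltClo\<close> on well-formed closures comes from a minimal
    element of the pair.\<close>
  then have "\<exists>z \<in> {c, d}. \<forall>y. ltClo y z \<longrightarrow> y \<notin> {c, d}"
    unfolding wfp_on_iff_ex_minimal using assms(2,3) by (elim allE[of _ "{c, d}"]) simp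
  then have "ltClo c d \<Longrightarrow> \<not> ltClo d c" by auto
  moreover have "asymp (multp (label_less lt))" "asymp (cls_less lt)"
    using multp_label_less_wfp cls_less_wfp by (auto intro: wfp_imp_asymp)
  ultimately show ?thesis using assms(4) unfolding closure_less_def by (metis asympD)
qed

lemma closure_less_total:
  assumes "closure_ordering F ltClo" "reduced R" "wf_closure F c" "wf_closure F d" "c \<noteq> d"
  shows "closure_less lt ltClo R c d \<or> closure_less lt ltClo R d c"
proof -
  have "totalp_on {M. set_mset M \<subseteq> {t. wf_trm F t \<and> ground_trm t} \<times> UNIV} (multp (label_less lt))"
    by (rule totalp_on_multp[OF label_less_total label_less_transp]) auto
  then have 1: "nm R c \<noteq> nm R d \<Longrightarrow> multp (label_less lt) (nm R c) (nm R d) \<or> multp (label_less lt) (nm R d) (nm R c)"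
    using nm_terms[OF assms(2)] assms(3,4) unfolding totalp_on_def by blast
  have "inst c \<in> {C. \<forall>L \<in># C. \<forall>t \<in> sides L. wf_trm F t \<and> ground_trm t}"
    if "wf_closure F c" for c :: "('f, 'v) gclosure"
  proof -
    have "t \<in> cls_terms (inst c)" if "L \<in># inst c" "t \<in> sides L" for L t
      using that subterms_refl unfolding cls_terms_def by blast
    then show ?thesis using inst_terms[OF that] by blast
  qed
  then have 2: "inst c \<noteq> inst d \<Longrightarrow> cls_less lt (inst c) (inst d) \<or> cls_less lt (inst d) (inst c)"
    using totalp_onD[OF cls_less_total, of "inst c" "inst d"] assms(3,4) by blast
  have "inst c = inst d \<Longrightarrow> ltClo c d \<or> ltClo d c"
    using assms(1,3-5) by (auto simp: closure_ordering_def)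
  with 1 2 show ?thesis unfolding closure_less_def by metis
qed

text \<open>The three components are minimised in turn, each among the closures that agree on the
  earlier ones.\<close>

lemma closure_less_minimal:
  assumes "closure_ordering F ltClo" "S \<subseteq> Collect (wf_closure F)" "S \<noteq> {}"
  shows "\<exists>c \<in> S. \<forall>d \<in> S. \<not> closure_less lt ltClo R d c"
proof -
  obtain M where M: "M \<in> nm R ` S" "\<And>K. multp (label_less lt) K M \<Longrightarrow> K \<notin> nm R ` S"
    using multp_label_less_wfp[unfolded wfp_iff_ex_minimal] assms(3) by (metis image_is_empty)
  let ?S = "{c \<in> S. nm R c = M}"
  obtain C where C: "C \<in> inst ` ?S" "\<And>D. cls_less lt D C \<Longrightarrow> D \<notin> inst ` ?S"
    using cls_less_wfp[unfolded wfp_iff_ex_minimal, rule_format, of "inst ` ?S"] M(1) by blast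
  let ?S' = "{c \<in> ?S. inst c = C}"
  have "wfp_on (Collect (wf_closure F)) ltClo" using assms(1) by (simp add: closure_ordering_def)
  then obtain c where c: "c \<in> ?S'" "\<And>d. ltClo d c \<Longrightarrow> d \<notin> ?S'"
    unfolding wfp_on_iff_ex_minimal using C(1) assms(2) by (elim allE[of _ ?S']) blast
  show ?thesis
  proof (intro bexI ballI)
    show "c \<in> S" using c by blast
    fix d assume "d \<in> S"
    then show "\<not> closure_less lt ltClo R d c"
      using c C(2)[of "inst d"] M(2)[of "nm R d"] unfolding closure_less_def by blast
  qed
qed

section \<open>Redexes that a rule contributes to a closure\<close>

lemma rule_args_irreducible:
  assumes "reduced R" "(u, v) \<in> R" "s \<in> proper_subterms u"
  shows "irreducible R s"
  unfolding irreducible_iff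
proof (intro ballI, clarify)
  fix u' v' assume uv': "(u', v') \<in> R" "u' \<in> subterms s"
  then have "u' \<in> subterms u" using assms(3) subterms_trans subterms_iff_proper by blast
  then have u: "u' = u" using reduced_overlap[OF assms(1,2) uv'(1)] by blast
  then show False
    using uv'(2) size_proper_subterm[OF assms(3)] size_proper_subterm[of u s]
    by (auto simp: subterms_iff_proper)
qed

text \<open>Arguments are normalised before redexes of a term are counted. For an instance equal to
  a left-hand side this changes nothing, so the left-hand side itself is counted.\<close>

lemma rm_arg_args_irreducible:
  assumes R: "reduced R" and wf: "wf_trm F (subst_trm t \<theta>)"
    and irr: "\<And>s. s \<in> proper_subterms (subst_trm t \<theta>) \<Longrightarrow> irreducible R s"
  shows "rm_arg R \<theta> (t, m) = rm R (subst_trm t \<theta>) m"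
proof (cases t)
  case (Fun f ts)
  have "normal_form R (subst_trm s \<theta>) = subst_trm s \<theta>" if "s \<in> set ts" for s
    using wf that unfolding Fun
    by (intro normal_form_irreducible[OF R] irr) (auto simp: Fun intro!: arg_proper_subterm)
  then show ?thesis unfolding Fun by (simp cong: map_cong)
qed simp

lemma rm_arg_redex:
  assumes R: "reduced R" and uv: "(u, v) \<in> R" and t: "subst_trm t \<theta> = u"
  shows "rm_arg R \<theta> (t, m) = add_mset (u, m) (rm R v m)"
proof -
  have wf: "wf_trm F u" using reduced_rule[OF R uv] by blast
  have "rm_arg R \<theta> (t, m) = rm R u m"
    using rm_arg_args_irreducible[OF R, of t \<theta> m] rule_args_irreducible[OF R uv] wf by (simp add: t)
  then show ?thesis using rm_step[OF R wf uv, of "[]" m] by simp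
qed

lemma rm_arg_below:
  assumes R: "reduced R" and less: "lt (subst_trm t \<theta>) u" and g: "ground_trm (subst_trm t \<theta>)"
  shows "rm_arg (below u R) \<theta> (t, m) = rm_arg R \<theta> (t, m)"
proof (cases t)
  case (Var x)
  then show ?thesis using below_eqs[OF R less g] by simp
next
  case (Fun f ts)
  let ?ts = "map (\<lambda>t. subst_trm t \<theta>) ts"
  have t: "subst_trm t \<theta> = Fun f ?ts" by (simp add: Fun)
  note wf = lt_wf(1)[OF less]
  have arg: "normal_form (below u R) s = normal_form R s" if "s \<in> set ?ts" for s
  proof -
    have s: "s \<in> proper_subterms (subst_trm t \<theta>)" unfolding t using that by (rule arg_proper_subterm)
    then have "lt s u" using lt_proper_subterm[OF s wf g] less lt_trans by blast
    moreover have "ground_trm s" using s g ground_subterm subterms_iff_proper by blast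
    ultimately show ?thesis using below_eqs[OF R] by blast
  qed
  have eq: "map (normal_form (below u R)) ?ts = map (normal_form R) ?ts"
    by (intro map_cong refl) (use arg in blast)
  note n = normalized_args[OF R wf[unfolded t] g[unfolded t]]
  have "lt (Fun f (map (normal_form R) ?ts)) u"
    by (rule le_lt_trans[OF n(3) less[unfolded t]])
  then have "rm (below u R) (Fun f (map (normal_form R) ?ts)) m = rm R (Fun f (map (normal_form R) ?ts)) m"
    using below_eqs[OF R _ n(2)] by blast
  then show ?thesis unfolding Fun rm_arg_Fun eq .
qed

text \<open>At a non-variable position the clause subterm above \<open>u\<close> has a positive
  label in \<open>lss\<close>, and its arguments are irreducible. Otherwise \<open>u\<close> sits
  inside the value of a variable, whose redexes are counted without normalising first.\<close>

lemma nm_redex: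
  assumes R: "reduced R" and uv: "(u, v) \<in> R"
    and wf: "\<forall>x \<in> vars_cls C. wf_trm F (\<theta> x)"
    and L: "L \<in># C" "s \<in> sides L"
    and p: "p \<in> poss (subst_trm s \<theta>)" "subt_at (subst_trm s \<theta>) p = u"
    and pos: "is_Pos L \<Longrightarrow> p \<noteq> []"
  shows "\<exists>l > 0. (u, l) \<in># nm_raw R C \<theta>"
proof -
  have sub: "subt_at s q \<in> ss_neg C \<union> ss_pos_below C" if "q \<in> poss s" "is_Pos L \<Longrightarrow> q \<noteq> []" for q
    using that L unfolding ss_neg_def ss_pos_below_def subterms_def proper_subterms_def by blast
  from p(1) show ?thesis
  proof (cases rule: poss_subst_cases)
    case (1 f ts)
    obtain l where l: "l > 0" "(subt_at s p, l) \<in> lss C" using lss_of_labelled[OF sub[OF 1(1) pos]] by blast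
    have "subst_trm (subt_at s p) \<theta> = u" using p(2) subt_at_subst[OF 1(1)] by simp
    then have "(u, l) \<in># rm_arg R \<theta> (subt_at s p, l)" using rm_arg_redex[OF R uv] by simp
    then show ?thesis using l rm_arg_in_nm_raw by blast
  next
    case (2 q r x)
    have x: "subst_trm (Var x) \<theta> = subt_at (subst_trm s \<theta>) q" using subt_at_subst[OF 2(2)] 2(3) by simp
    have r: "subt_at (\<theta> x) r = u"
      using p 2(1) subt_at_append[OF poss_subst[OF 2(2)], of \<theta> r] x by simp
    have "x \<in> vars_trm s" using vars_subt_at[OF 2(2)] 2(3) by simp
    then have "wf_trm F (\<theta> x)" using wf L unfolding vars_cls_def by blast
    from rm_step[OF R this uv 2(4) r]
    have mem: "(u, if r = [] \<or> m > 0 then m else 1) \<in># rm_arg R \<theta> (Var x, m)" for m by simp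
    show ?thesis
    proof (cases "is_Pos L \<and> q = []")
      \<comment> \<open>The variable is a whole side of a positive literal and may carry label 0.
        But then \<open>u\<close> lies strictly inside its value, and a redex below the top receives
        label 1.\<close>
      case True
      then have "Var x \<in> ts_pos C" using L 2(3) unfolding ts_pos_def by auto
      then obtain l where l: "(Var x, l) \<in> lss C" using lss_of_ts_pos by blast
      have "r \<noteq> []" using True pos 2(1) by simp
      then show ?thesis using rm_arg_in_nm_raw[OF l mem] by (auto split: if_splits)
    next
      case False
      then have "\<exists>l > 0. (subt_at s q, l) \<in> lss C" using sub[OF 2(2)] by (intro lss_of_labelled) simp
      then obtain l where l: "l > 0" "(Var x, l) \<in> lss C" unfolding 2(3) by blast
      then show ?thesis using rm_arg_in_nm_raw[OF l(2) mem] by auto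
    qed
  qed
qed

section \<open>Eligible closures and the rule they compete for\<close>

lemma eligible_terms:
  assumes "eligible lt R c u v" "t \<in> cls_terms (inst c)" "t \<noteq> u"
  shows "lt t u"
  using assms unfolding eligible_def cls_terms_def by blast

lemma eligible_mem: "eligible lt R c u v \<Longrightarrow> Pos (Upair u v) \<in># inst c"
  and eligible_less: "eligible lt R c u v \<Longrightarrow> lt v u"
  and eligible_not_neg: "eligible lt R c u v \<Longrightarrow> u \<notin> ss_neg (inst c)"
  by (simp_all add: eligible_def)

lemma eligible_cls_terms:
  assumes "eligible lt R c u v"
  shows "u \<in> cls_terms (inst c)" "v \<in> cls_terms (inst c)"
  using eligible_mem[OF assms] subterms_refl
  unfolding cls_terms_def by (auto simp: sides_def intro!: bexI[of _ "Pos (Upair u v)"])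

lemma eligible_not_pos_below:
  assumes "wf_closure F c" "eligible lt R c u v"
  shows "u \<notin> ss_pos_below (inst c)"
proof
  assume "u \<in> ss_pos_below (inst c)"
  then obtain L t where t: "L \<in># inst c" "t \<in> sides L" "u \<in> proper_subterms t"
    by (auto simp: ss_pos_below_def)
  then have "t \<in> cls_terms (inst c)" unfolding cls_terms_def using subterms_refl by blast
  moreover have "t \<noteq> u" using t(3) proper_subterms_neq by blast
  ultimately show False
    using eligible_terms[OF assms(2)] lt_proper_subterm[OF t(3)] inst_terms[OF assms(1)] lt_asym by blast
qed

lemma eligible_literals:
  assumes "horn_closure c" "eligible lt R c u v" "K \<in># inst c - {#Pos (Upair u v)#}"
  shows "\<not> is_Pos K" "\<And>t. t \<in> sides K \<Longrightarrow> lt t u"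
proof -
  show neg: "\<not> is_Pos K"
    using horn_pos_unique[OF horn_inst[OF assms(1)] eligible_mem[OF assms(2)] _ assms(3)] by simp
  fix t assume t: "t \<in> sides K"
  have K: "K \<in># inst c" using assms(3) by (rule in_diffD)
  then have "t \<in> ss_neg (inst c)" using neg t subterms_refl unfolding ss_neg_def by blast
  then have "t \<noteq> u" using eligible_not_neg[OF assms(2)] by blast
  then show "lt t u"
    using eligible_terms[OF assms(2)] K t subterms_refl unfolding cls_terms_def by blast
qed

text \<open>Eligibility keeps \<open>u\<close> out of negative literals, and its maximality keeps it
  out of proper subterm positions, so both positive labels are excluded.\<close>

lemma eligible_lss:
  assumes "wf_closure F (gclo C \<theta>)" "ground_cls (subst_cls C \<theta>)" "eligible lt R (gclo C \<theta>) u v"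
    and "(t, m) \<in> lss C" "subst_trm t \<theta> = u"
  shows "t \<in> ts_pos C" "m = 0"
  using assms(4,5) eligible_not_neg[OF assms(3)] eligible_not_pos_below[OF assms(1,3)]
    ss_neg_subst[of t C \<theta>] ss_pos_below_subst[of t C \<theta>]
  unfolding inst_gclo[OF assms(2)] lss_def by auto

text \<open>The largest labelled redex of a closure producing \<open>u \<rightarrow> v\<close> is \<open>(u, 0)\<close>, whereas an
  occurrence of \<open>u\<close> in another closure contributes a positive label, unless it is at the top of a
  positive literal. So the producing closure is the smaller one in the first component
  already.\<close>

lemma nm_eligible_le:
  assumes R: "reduced R" and uv: "(u, v) \<in> R" and c: "wf_closure F c" and el: "eligible lt S c u w"
    and al: "(a, l) \<in># nm R c"
  shows "lt a u \<or> a = u \<and> l = 0"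
proof -
  obtain C \<theta> where C: "c = gclo C \<theta>" "ground_cls (subst_cls C \<theta>)" by (rule gclo_cases)
  have terms: "wf_trm F t \<and> ground_trm t \<and> (t = u \<or> lt t u)" if "t \<in> cls_terms (subst_cls C \<theta>)" for t
    using inst_terms[OF c] eligible_terms[OF el] that unfolding C(1) inst_gclo[OF C(2)] by blast
  note uv' = reduced_rule[OF R uv]
  have "(a, l) \<in># nm_raw R C \<theta>" using al unfolding C(1) nm_gclo[OF C(2)] .
  then show ?thesis
  proof (rule nm_raw_cases)
    fix t m assume t: "(t, m) \<in> lss C" and a: "(a, l) \<in># rm_arg R \<theta> (t, m)"
    note tt = terms[OF lss_cls_terms[OF t]]
    show ?thesis
    proof (cases "subst_trm t \<theta> = u")
      case True
      then have "m = 0" using eligible_lss[OF c[unfolded C(1)] C(2) el[unfolded C(1)] t] by blast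
      then have "(a, l) = (u, 0) \<or> (a, l) \<in># rm R v 0" using a rm_arg_redex[OF R uv True] by simp
      then show ?thesis using rm_le[OF R uv'(5,3), of a l 0] le_lt_trans[OF _ uv'(1), of a] by blast
    next
      case False
      then have "lt (subst_trm t \<theta>) u" using tt by blast
      from le_lt_trans[OF _ this] show ?thesis using rm_arg_le[OF R _ _ a] tt by blast
    qed
  next
    fix t assume t: "(t, l) \<in> lts C" and a: "a = normal_form R (subst_trm t \<theta>)"
    note tt = terms[OF lts_cls_terms[OF t]]
    show ?thesis
    proof (cases "subst_trm t \<theta> = u")
      case True
      \<comment> \<open>Here the label is irrelevant: \<open>u\<close> reduces to \<open>v\<close>,
        so its normal form is strictly below \<open>u\<close>.\<close>
      have "(u, v) \<in> rstep R" using rstepI[OF uv, of "[]" u] by simp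
      then have "a = normal_form R v" using normal_form_step[OF R uv'(4)] a True by simp
      then show ?thesis using le_lt_trans[OF normal_form_le[OF R uv'(5)] uv'(1)] by simp
    next
      case False
      then have "lt (subst_trm t \<theta>) u" using tt by blast
      then show ?thesis using le_lt_trans[OF normal_form_le[OF R]] tt a by blast
    qed
  qed
qed

lemma producer_less:
  assumes R: "reduced R" and uv: "(u, v) \<in> R" and d: "wf_closure F d" and el: "eligible lt S d u w"
    and c: "wf_closure F (gclo C \<theta>)" "ground_cls (subst_cls C \<theta>)"
    and "L \<in># C" "s \<in> sides L" "p \<in> poss (subst_trm s \<theta>)" "subt_at (subst_trm s \<theta>) p = u"
    and "is_Pos L \<Longrightarrow> p \<noteq> []"
  shows "closure_less lt ltClo R d (gclo C \<theta>)"
proof -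
  have "\<forall>x \<in> vars_cls C. wf_trm F (\<theta> x)" using c by (simp add: wf_closure_gclo)
  from nm_redex[OF R uv this assms(7-11)] obtain l where l: "l > 0" "(u, l) \<in># nm_raw R C \<theta>" by blast
  have "label_less lt x (u, l)" if "x \<in># nm R d" for x
    using nm_eligible_le[OF R uv d el, of "fst x" "snd x"] that l(1) by (auto simp: label_less_def)
  then have "multp (label_less lt) (nm R d) (nm_raw R C \<theta>)"
    by (rule multp_dominated[OF l(2)])
  then show ?thesis unfolding closure_less_def nm_gclo[OF c(2)] by simp
qed

text \<open>Adding the rule for \<open>u\<close> turns the normal form \<open>(u, 0)\<close> into the redex \<open>(u, 0)\<close>, so all
  eligible closures gain the same elements and their order is preserved.\<close>

lemma nm_shift:
  assumes R: "reduced R" and uv: "(u, v) \<in> R" and c: "wf_closure F c" "horn_closure c"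
    and el: "eligible lt (below u R) c u w"
  shows "nm R c = nm (below u R) c + (rm R v 0 + {#(normal_form R v, 0)#})"
proof -
  obtain C \<theta> where C: "c = gclo C \<theta>" "ground_cls (subst_cls C \<theta>)" by (rule gclo_cases)
  note C' = c(1)[unfolded C(1)] c(2)[unfolded C(1)] el[unfolded C(1)]
  let ?B = "below u R"
  have B: "reduced ?B" using R by (rule reduced_subset) auto
  note uv' = reduced_rule[OF R uv]
  have terms: "ground_trm t \<and> (t = u \<or> lt t u)" if "t \<in> cls_terms (subst_cls C \<theta>)" for t
    using inst_terms[OF C'(1)] eligible_terms[OF C'(3)] that unfolding inst_gclo[OF C(2)] by blast
  obtain K where K: "K \<in># C" "Pos (Upair u w) = subst_lit K \<theta>"
    using eligible_mem[OF C'(3)] unfolding inst_gclo[OF C(2)] by (rule subst_cls_memE)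
  obtain t t' where t: "K = Pos (Upair t t')" "subst_trm t \<theta> = u" "subst_trm t' \<theta> = w"
  proof (cases K)
    case (Pos A)
    obtain s s' where A: "A = Upair s s'" by (cases A)
    show thesis using K(2) that[of s s'] that[of s' s] by (auto simp: Pos A subst_lit_Upair)
  next
    case (Neg A)
    then show thesis using K(2) by (cases A) (simp add: subst_lit_Upair)
  qed
  have uw: "lt w u" using eligible_less[OF el] .
  \<comment> \<open>\<open>lss\<close> and \<open>lts\<close> are sets of clause terms before
    substitution, so two different terms with instance \<open>u\<close> would count the gain twice.
    The Horn property leaves one positive literal, and its other side has the smaller instance
    \<open>w\<close>.\<close>
  have uniq: "t2 = t" if t2: "t2 \<in> ts_pos C" "subst_trm t2 \<theta> = u" for t2
  proof -
    obtain L where L: "L \<in># C" "is_Pos L" "t2 \<in> sides L" using t2(1) by (auto simp: ts_pos_def)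
    have "L = K"
    proof (rule ccontr)
      assume "L \<noteq> K"
      then have "L \<in># C - {#K#}" using L(1) by (simp add: in_diff_count)
      then show False
        using horn_pos_unique[of C K L] C'(2) horn_closure_gclo[OF C(2)] K(1) t(1) L(2) by simp
    qed
    then have "t2 = t \<or> t2 = t'" using L(3) t(1) by (simp add: sides_def)
    then show ?thesis using t2(2) t(3) uw lt_irrefl by blast
  qed
  have tpos: "t \<in> ts_pos C" using K(1) t(1) by (auto simp: ts_pos_def sides_def)
  have tnot: "t \<notin> ss_neg C" "t \<notin> ss_pos_below C"
    using ss_neg_subst[of t C \<theta>] ss_pos_below_subst[of t C \<theta>] eligible_not_neg[OF C'(3)]
      eligible_not_pos_below[OF C'(1,3)] unfolding inst_gclo[OF C(2)] t(2) by blast+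
  have t_lss: "(t, 0) \<in> lss C" using tpos tnot by (simp add: lss_def)
  have t_lts: "(t, 0) \<in> lts C" using tpos tnot cls_terms_simps(3)[of C] by (auto simp: lts_def)
  have lss_less: "lt (subst_trm t2 \<theta>) u \<and> ground_trm (subst_trm t2 \<theta>)" if "(t2, m) \<in> lss C - {(t, 0)}" for t2 m
    using that terms[OF lss_cls_terms] eligible_lss[OF C'(1) C(2) C'(3)] uniq by blast
  have lts_less: "lt (subst_trm t2 \<theta>) u \<and> ground_trm (subst_trm t2 \<theta>)" if "(t2, m) \<in> lts C - {(t, 0)}" for t2 m
  proof -
    have "subst_trm t2 \<theta> \<noteq> u"
    proof
      assume u: "subst_trm t2 \<theta> = u"
      have "t2 \<notin> ts_neg C"
        using ss_neg_subst[of t2 C \<theta>] eligible_not_neg[OF C'(3)] cls_terms_simps(3)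
        unfolding inst_gclo[OF C(2)] u by blast
      then have "t2 \<in> ts_pos C" "m = 0" using that by (auto simp: lts_def)
      then show False using uniq[OF _ u] that by blast
    qed
    then show ?thesis using that terms[OF lts_cls_terms] by blast
  qed
  have sum_lss: "(\<Sum>tm \<in> lss C - {(t, 0)}. rm_arg ?B \<theta> tm) = (\<Sum>tm \<in> lss C - {(t, 0)}. rm_arg R \<theta> tm)"
  proof (rule sum.cong[OF refl])
    fix tm assume tm: "tm \<in> lss C - {(t, 0)}"
    obtain t2 m where "tm = (t2, m)" by (cases tm)
    then show "rm_arg ?B \<theta> tm = rm_arg R \<theta> tm" using rm_arg_below[OF R] lss_less tm by blast
  qed
  let ?n = "\<lambda>R (t, m). {#(normal_form R (subst_trm t \<theta>), m)#}"
  have sum_lts: "(\<Sum>tm \<in> lts C - {(t, 0)}. ?n ?B tm) = (\<Sum>tm \<in> lts C - {(t, 0)}. ?n R tm)"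
  proof (rule sum.cong[OF refl])
    fix tm assume tm: "tm \<in> lts C - {(t, 0)}"
    obtain t2 m where e: "tm = (t2, m)" by (cases tm)
    have "normal_form ?B (subst_trm t2 \<theta>) = normal_form R (subst_trm t2 \<theta>)"
      using below_eqs[OF R] lts_less tm e by blast
    then show "?n ?B tm = ?n R tm" by (simp add: e)
  qed
  have irr: "irreducible ?B u" using el by (simp add: eligible_def)
  have "rm_arg ?B \<theta> (t, 0) = rm ?B u 0"
    using rm_arg_args_irreducible[OF B, of t \<theta> 0] uv'(4)
      irreducible_antimono[OF rule_args_irreducible[OF R uv], of _ ?B] by (auto simp: t(2))
  then have rmB: "rm_arg ?B \<theta> (t, 0) = {#}" using rm_irreducible[OF B uv'(4) irr] by simp
  have nfB: "normal_form ?B u = u" using normal_form_irreducible[OF B uv'(4) irr] .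
  have "(u, v) \<in> rstep R" using rstepI[OF uv, of "[]" u] by simp
  then have nfR: "normal_form R u = normal_form R v" using normal_form_step[OF R uv'(4)] by simp
  show ?thesis
    unfolding C(1) nm_gclo[OF C(2)] nm_raw_def sum.remove[OF finite_lss t_lss] sum.remove[OF finite_lts t_lts]
      sum_lss sum_lts
    by (simp add: rmB nfB nfR rm_arg_redex[OF R uv t(2)] t(2))
qed

text \<open>The multiset extension allows cancelling the common part \<open>K\<close>, and the other
  two components of the ordering do not mention the rewrite system.\<close>

lemma closure_less_shift:
  assumes "closure_less lt ltClo S d c" "nm R d = nm S d + K" "nm R c = nm S c + K"
  shows "closure_less lt ltClo R d c"
proof -
  have "irreflp_on (set_mset K) (label_less lt)"
    by (rule irreflp_on_subset[OF wfp_imp_irreflp[OF label_less_wfp] subset_UNIV])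
  from multp_cancel[OF label_less_transp this] show ?thesis
    using assms unfolding closure_less_def by simp
qed

section \<open>Comparing literals and clauses through one dominating element\<close>

lemma lit_less_dominated: "a \<in> sides K \<Longrightarrow> (\<And>b. b \<in> sides L \<Longrightarrow> lt b a) \<Longrightarrow> lit_less lt L K"
  unfolding lit_less_def by (rule multp_dominated) (simp_all add: set_mset_lit)

text \<open>A negative literal counts its sides twice: after cancelling one \<open>u\<close>, a
  second \<open>u\<close> remains to dominate \<open>v\<close>, whatever the other side is.\<close>

lemma lit_less_Pos_Neg:
  assumes "lt v u" "u \<in> sides K" "\<not> is_Pos K"
  shows "lit_less lt (Pos (Upair u v)) K"
proof -
  obtain y where y: "K = Neg (Upair u y)"
  proof (cases K)
    case (Neg A)
    obtain a b where A: "A = Upair a b" by (cases A)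
    then show thesis using assms(2) Neg that[of a] that[of b] by (auto simp: sides_def)
  qed (use assms in simp)
  have "multp lt ({#u#} + {#v#}) ({#u#} + {#u, y, y#})"
    using assms(1) by (intro one_step_implies_multp) auto
  then show ?thesis by (simp add: lit_less_def y add_mset_commute)
qed

lemma cls_less_dominated: "L \<in># C \<Longrightarrow> (\<And>K. K \<in># D \<Longrightarrow> lit_less lt K L) \<Longrightarrow> cls_less lt D C"
  unfolding cls_less_def by (rule multp_dominated)

end

section \<open>The candidate interpretation\<close>

locale saturated_closures = term_ordering F lt
  for F :: "('f \<times> nat) set" and lt :: "('f, 'v) trm \<Rightarrow> ('f, 'v) trm \<Rightarrow> bool" +
  fixes ltClo :: "('f, 'v) gclosure \<Rightarrow> ('f, 'v) gclosure \<Rightarrow> bool" and N :: "('f, 'v) gclosure set"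
  assumes infinite_vars: "infinite (UNIV :: 'v set)"
    and closure_ordering: "closure_ordering F ltClo"
    and wf_horn: "\<forall>c \<in> N. wf_closure F c \<and> horn_closure c"
    and saturated: "saturated lt ltClo N"
    and no_bot: "bot_closure \<notin> N"
begin

abbreviation cand :: "('f, 'v) trs" where
  "cand \<equiv> candidate lt ltClo N"

lemma N_wf: "c \<in> N \<Longrightarrow> wf_closure F c" and N_horn: "c \<in> N \<Longrightarrow> horn_closure c"
  using wf_horn by blast+

section \<open>The recursion for the candidate and its left-reducedness\<close>

lemma produced_rules_unfold:
  assumes "ground_trm s"
  shows "produced_rules lt ltClo N s =
    produced lt ltClo N (\<Union>t \<in> {t. ground_trm t \<and> lt t s}. produced_rules lt ltClo N t) s"
proof -
  let ?r = "{(t, s). ground_trm t \<and> ground_trm s \<and> lt t s}"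
  have wf: "wf ?r"
    by (rule wf_subset[of "{(t, s). lt t s}"]) (use lt_wfp in \<open>auto simp: wfp_def\<close>)
  have "(\<Union>t \<in> {t. ground_trm t \<and> lt t s}. cut (produced_rules lt ltClo N) ?r s t) =
    (\<Union>t \<in> {t. ground_trm t \<and> lt t s}. produced_rules lt ltClo N t)"
    using assms by (intro SUP_cong refl) (simp add: cut_def)
  then show ?thesis
    using wfrec[OF wf, of "\<lambda>E s. produced lt ltClo N (\<Union>t \<in> {t. ground_trm t \<and> lt t s}. E t) s" s]
    unfolding produced_rules_def[symmetric] by simp
qed

lemma produced_rules_lhs: "ground_trm s \<Longrightarrow> (u, v) \<in> produced_rules lt ltClo N s \<Longrightarrow> u = s"
  unfolding produced_rules_unfold produced_def by blast

lemma candidate_iff: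
  "(u, v) \<in> cand \<longleftrightarrow> ground_trm u \<and> (u, v) \<in> produced_rules lt ltClo N u"
  unfolding candidate_def using produced_rules_lhs by blast

text \<open>Rules in \<open>E_t\<close> have left-hand side \<open>t\<close>, so the partial system
  seen by the recursion at \<open>s\<close> can be recovered from the finished candidate.\<close>

lemma below_candidate:
  "below s cand = (\<Union>t \<in> {t. ground_trm t \<and> lt t s}. produced_rules lt ltClo N t)"
  using candidate_iff produced_rules_lhs by blast

lemma candidate_produced:
  "(u, v) \<in> cand \<longleftrightarrow> ground_trm u \<and> (u, v) \<in> produced lt ltClo N (below u cand) u"
  using candidate_iff produced_rules_unfold unfolding below_candidate by blast

lemma candidate_producer:
  assumes "(u, v) \<in> cand"
  obtains d where "d \<in> N" "eligible lt (below u cand) d u v"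
    "\<And>e w. e \<in> N \<Longrightarrow> e \<noteq> d \<Longrightarrow> eligible lt (below u cand) e u w \<Longrightarrow>
      closure_less lt ltClo (below u cand) d e"
proof -
  have "(u, v) \<in> produced lt ltClo N (below u cand) u" using assms candidate_produced by blast
  then obtain d where "d \<in> N" "eligible lt (below u cand) d u v"
    "\<forall>e \<in> N. e \<noteq> d \<and> (\<exists>w. eligible lt (below u cand) e u w) \<longrightarrow> closure_less lt ltClo (below u cand) d e"
    unfolding produced_def by auto
  then show thesis by (intro that[of d]) auto
qed

lemma candidate_ruleI:
  assumes "ground_trm u" "d \<in> N" "eligible lt (below u cand) d u v"
    and "\<And>e w. e \<in> N \<Longrightarrow> e \<noteq> d \<Longrightarrow> eligible lt (below u cand) e u w \<Longrightarrow>
      closure_less lt ltClo (below u cand) d e"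
  shows "(u, v) \<in> cand"
proof -
  have "\<forall>e \<in> N. e \<noteq> d \<and> (\<exists>w. eligible lt (below u cand) e u w) \<longrightarrow> closure_less lt ltClo (below u cand) d e"
    by (intro ballI impI, elim conjE exE) (rule assms(4))
  then have "(u, v) \<in> produced lt ltClo N (below u cand) u"
    unfolding produced_def using assms(2,3)
    by (intro CollectI exI[of _ v] conjI refl bexI[of _ d])
  with assms(1) show ?thesis by (intro candidate_produced[THEN iffD2] conjI)
qed

text \<open>Distinct producers for the same \<open>u\<close> would each be smaller than the other,
  and a single Horn producer has only one positive equation.\<close>

lemma candidate_functional:
  assumes "(u, v) \<in> cand" "(u, w) \<in> cand"
  shows "v = w"
proof -
  obtain d where d: "d \<in> N" "eligible lt (below u cand) d u v"
    "\<And>e w. e \<in> N \<Longrightarrow> e \<noteq> d \<Longrightarrow> eligible lt (below u cand) e u w \<Longrightarrow>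
      closure_less lt ltClo (below u cand) d e"
    by (rule candidate_producer[OF assms(1)]) blast
  obtain e where e: "e \<in> N" "eligible lt (below u cand) e u w"
    "\<And>d w. d \<in> N \<Longrightarrow> d \<noteq> e \<Longrightarrow> eligible lt (below u cand) d u w \<Longrightarrow>
      closure_less lt ltClo (below u cand) e d"
    by (rule candidate_producer[OF assms(2)]) blast
  have "d = e"
    using d(3)[OF e(1) _ e(2)] e(3)[OF d(1) _ d(2)]
      closure_less_asym[OF closure_ordering N_wf[OF d(1)] N_wf[OF e(1)]] by blast
  then have w: "Pos (Upair u w) \<in># inst d" using eligible_mem[OF e(2)] by simp
  show ?thesis
  proof (rule ccontr)
    assume "v \<noteq> w"
    then have "Pos (Upair u w) \<noteq> Pos (Upair u v)" by auto
    then have "Pos (Upair u w) \<in># inst d - {#Pos (Upair u v)#}" using w by (rule in_minus_single[rotated])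
    then show False using eligible_literals(1)[OF N_horn[OF d(1)] d(2)] by fastforce
  qed
qed

lemma candidate_terms:
  assumes "(u, v) \<in> cand"
  shows "ground_trm u" "ground_trm v" "lt v u" "wf_trm F u" "irreducible (below u cand) u"
proof -
  obtain d where d: "d \<in> N" "eligible lt (below u cand) d u v"
    by (rule candidate_producer[OF assms]) blast
  show "ground_trm u" "ground_trm v" "wf_trm F u"
    using inst_terms[OF N_wf[OF d(1)]] eligible_cls_terms[OF d(2)] by blast+
  show "lt v u" "irreducible (below u cand) u" using d(2) by (simp_all add: eligible_def)
qed

text \<open>A different left-hand side occurring in \<open>u\<close> is below \<open>u\<close>, but
  the producer of a rule for \<open>u\<close> required \<open>u\<close> to be irreducible by those
  rules.\<close>

lemma candidate_reduced: "reduced cand"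
proof -
  have "irreducible (cand - {(u, v)}) u" if uv: "(u, v) \<in> cand" for u v
  proof -
    have "u' \<notin> subterms u" if uv': "(u', v') \<in> cand" "(u', v') \<noteq> (u, v)" for u' v'
    proof
      assume sub: "u' \<in> subterms u"
      have "u' \<noteq> u" using candidate_functional[OF uv] uv' by blast
      then have "(u', v') \<in> below u cand"
        using subterm_le[OF sub] candidate_terms[OF uv] uv'(1) by blast
      then show False using candidate_terms(5)[OF uv] sub unfolding irreducible_iff by blast
    qed
    then show ?thesis unfolding irreducible_iff by blast
  qed
  then show ?thesis
    using candidate_terms
    unfolding reduced_def ground_trs_def left_reduced_def contained_in_def by blast
qed

lemma below_reduced: "reduced (below s cand)"
  by (rule reduced_subset[OF candidate_reduced]) blast

section \<open>Consequences of saturation at the candidate system\<close>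

lemma Red_I_candidate:
  assumes "\<iota> \<in> Red_I lt ltClo N"
  shows "closure_true cand (concl \<iota>) \<or>
       (\<exists>c \<in> N. closure_less lt ltClo cand c (right_prem \<iota>) \<and> \<not> closure_true cand c) \<or>
       (\<exists>l u v r c. \<iota> = ParSup l (u, v) r c \<and> lt v u \<and> (u, v) \<notin> cand) \<or>
       (\<exists>l e r c. \<iota> = ParSup l e r c \<and> (\<exists>d \<in> prems \<iota>. closure_less lt ltClo cand d l))"
  using assms candidate_reduced unfolding Red_I_def reduced_def by blast

text \<open>The other alternatives of redundancy fail: closures below \<open>c\<close> are true, the
  rule used belongs to the system, and the left premise is smaller than the right one and not
  smaller than itself.\<close>

lemma par_sup_concl_true:
  assumes inf: "ParSup d (u, v) c k \<in> ground_inferences lt" and N: "d \<in> N" "c \<in> N"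
    and uv: "(u, v) \<in> cand" and less: "closure_less lt ltClo cand d c"
    and min: "\<And>e. e \<in> N \<Longrightarrow> closure_less lt ltClo cand e c \<Longrightarrow> closure_true cand e"
  shows "closure_true cand k"
proof -
  have "ParSup d (u, v) c k \<in> Red_I lt ltClo N"
    using saturated inf N unfolding saturated_def by auto
  from Red_I_candidate[OF this] show ?thesis
    using min uv closure_less_asym[OF closure_ordering N_wf[OF N(1)] N_wf[OF N(2)] less]
      closure_less_asym[OF closure_ordering N_wf[OF N(1)] N_wf[OF N(1)], of cand]
    by auto
qed

lemma eq_res_concl_true:
  assumes inf: "EqRes c k \<in> ground_inferences lt" and N: "c \<in> N"
    and min: "\<And>e. e \<in> N \<Longrightarrow> closure_less lt ltClo cand e c \<Longrightarrow> closure_true cand e"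
  shows "closure_true cand k"
proof -
  have "EqRes c k \<in> Red_I lt ltClo N"
    using saturated inf N unfolding saturated_def by auto
  from Red_I_candidate[OF this] show ?thesis using min by auto
qed

text \<open>The conclusion joins the false rest of \<open>d\<close> with a version of
  \<open>C\<close> in which some terms are replaced by convertible ones, so it is false, against
  saturation. The clause comparison \<open>cls\<close> is demanded only conditionally, because an
  overlap solely at the top of positive literals needs none.\<close>

lemma superposition_contradiction:
  assumes N: "d \<in> N" "c \<in> N" and uv: "(u, v) \<in> cand" and el: "eligible lt (below u cand) d u v"
    and false: "\<not> closure_true cand c"
    and min: "\<And>e. e \<in> N \<Longrightarrow> closure_less lt ltClo cand e c \<Longrightarrow> closure_true cand e"
    and less: "closure_less lt ltClo cand d c"
    and c: "c = gclo C \<theta>" "ground_cls (subst_cls C \<theta>)"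
    and L: "L \<in># C" "L = Pos (Upair s s') \<and> strictly_maximal_lit lt (subst_lit L \<theta>) (subst_cls C \<theta>) \<or>
      L = Neg (Upair s s') \<and> maximal_lit lt (subst_lit L \<theta>) (subst_cls C \<theta>)"
    and ss': "lt (subst_trm s' \<theta>) (subst_trm s \<theta>)"
    and p: "p \<in> poss (subst_trm s \<theta>)" "subt_at (subst_trm s \<theta>) p = u"
    and cls: "p \<noteq> [] \<or> u \<in> ss_neg (inst c) \<union> ss_pos_below (inst c) \<Longrightarrow> cls_less lt (inst d) (inst c)"
  shows False
proof -
  have "finite (vars_cls C)" by (rule finite_vars_cls)
  then obtain D \<theta>' where D: "d = gclo D \<theta>'" "ground_cls (subst_cls D \<theta>')" "vars_cls D \<inter> vars_cls C = {}"
    using gclo_cases_apart[OF infinite_vars] by metis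
  \<comment> \<open>The substitutions of the two premises are glued together along their disjoint
    variables.\<close>
  define \<eta> where "\<eta> x = (if x \<in> vars_cls D then \<theta>' x else \<theta> x)" for x
  have C\<eta>: "subst_cls C \<eta> = subst_cls C \<theta>"
    by (intro subst_cls_cong) (use D(3) in \<open>auto simp: \<eta>_def\<close>)
  have D\<eta>: "subst_cls D \<eta> = subst_cls D \<theta>'"
    by (intro subst_cls_cong) (simp add: \<eta>_def)
  have c\<eta>: "c = gclo C \<eta>" unfolding c(1)
    by (rule gclo_cong[OF c(2)]) (use D(3) in \<open>auto simp: \<eta>_def\<close>)
  have d\<eta>: "d = gclo D \<eta>" unfolding D(1) by (rule gclo_cong[OF D(2)]) (simp add: \<eta>_def)
  have gC: "ground_cls (subst_cls C \<eta>)" and gD: "ground_cls (subst_cls D \<eta>)"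
    using c(2) D(2) by (simp_all add: C\<eta> D\<eta>)
  have instc: "inst c = subst_cls C \<eta>" and instd: "inst d = subst_cls D \<eta>"
    unfolding c\<eta> d\<eta> by (simp_all add: inst_gclo gC gD)
  have sides_L: "s \<in> sides L" "s' \<in> sides L" using L(2) by (auto simp: sides_def)
  have \<eta>_eq: "subst_trm t \<eta> = subst_trm t \<theta>" if "t \<in> sides L" for t
  proof (rule subst_trm_cong)
    fix x assume "x \<in> vars_trm t"
    then have "x \<in> vars_cls C" using that L(1) unfolding vars_cls_def by blast
    then show "\<eta> x = \<theta> x" using D(3) by (auto simp: \<eta>_def)
  qed
  have L\<eta>: "subst_lit L \<eta> = subst_lit L \<theta>"
    unfolding subst_lit_def by (rule map_lit_cong) (rule \<eta>_eq)
  note s\<eta> = \<eta>_eq[OF sides_L(1)] and s'\<eta> = \<eta>_eq[OF sides_L(2)]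
  obtain K where K: "K \<in># D" "Pos (Upair u v) = subst_lit K \<eta>"
    using eligible_mem[OF el] unfolding instd by (rule subst_cls_memE)
  obtain t t' where t: "K = Pos (Upair t t')" "subst_trm t \<eta> = u" "subst_trm t' \<eta> = v"
  proof (cases K)
    case (Pos A)
    obtain a b where A: "A = Upair a b" by (cases A)
    show thesis using K(2) that[of a b] that[of b a] by (auto simp: Pos A subst_lit_Upair)
  next
    case (Neg A)
    then show thesis using K(2) by (cases A) (simp add: subst_lit_Upair)
  qed
  define D' where "D' = D - {#K#}"
  have DD': "D = D' + {#Pos (Upair t t')#}" using K(1) t(1) by (simp add: D'_def)
  have D_add: "add_mset (Pos (Upair t t')) D' = D" using DD' by simp
  have D'\<eta>: "subst_cls D' \<eta> = inst d - {#Pos (Upair u v)#}"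
    unfolding instd DD' by (simp add: subst_cls_def subst_lit_Upair t)
  have uv_less: "lt v u" using eligible_less[OF el] .
  \<comment> \<open>Eligibility gives falsity only over the rules below \<open>u\<close>; all
    literals concerned are negative, so it extends to the whole candidate.\<close>
  have D'_false: "\<not> cls_true cand (subst_cls D' \<eta>)"
  proof (rule cls_false_mono)
    show "\<forall>L \<in># subst_cls D' \<eta>. \<not> is_Pos L"
      unfolding D'\<eta> using eligible_literals(1)[OF N_horn[OF N(1)] el] by blast
    have "\<not> cls_true (below u cand) (inst d)" using el by (simp add: eligible_def closure_true_def)
    then show "\<not> cls_true (below u cand) (subst_cls D' \<eta>)"
      unfolding D'\<eta> cls_true_def by (meson in_diffD)
  qed blast
  have smax: "strictly_maximal_lit lt (subst_lit (Pos (Upair t t')) \<eta>) (subst_cls D \<eta>)"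
    unfolding strictly_maximal_lit_def subst_lit_Upair t instd[symmetric]
  proof (intro conjI ballI)
    show "Pos (Upair u v) \<in># inst d" by (rule eligible_mem[OF el])
    fix M assume M: "M \<in># inst d - {#Pos (Upair u v)#}"
    note e = eligible_literals[OF N_horn[OF N(1)] el M]
    show "M \<noteq> Pos (Upair u v)" using e(1) by auto
    have "lit_less lt M (Pos (Upair u v))"
      by (rule lit_less_dominated[of u]) (use e(2) in \<open>auto simp: sides_def\<close>)
    then show "\<not> lit_less lt (Pos (Upair u v)) M" by (rule lit_less_asym)
  qed
  \<comment> \<open>One proof for both rules, with \<open>w\<close> the overlapped subterm or
    variable. Its instance must be \<open>u\<close> only if \<open>p = []\<close>; for other
    positions the clause comparison is available anyway.\<close>
  have conds: "superposition_conds lt D' t t' C w \<eta>"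
    if w: "w \<in> subterms s" "p = [] \<Longrightarrow> subst_trm w \<eta> = u" for w
  proof -
    have "cls_less lt (subst_cls D \<eta>) (subst_cls C \<eta>)" if "w \<in> ss_neg C \<union> ss_pos_below C"
    proof -
      have "subst_trm w \<eta> \<in> ss_neg (inst c) \<union> ss_pos_below (inst c)"
        unfolding instc using that ss_neg_subst ss_pos_below_subst by blast
      then show ?thesis using cls w(2) unfolding instc instd by metis
    qed
    moreover have "\<exists>s s' L. L \<in># C \<and> w \<in> subterms s \<and> lt (subst_trm s' \<eta>) (subst_trm s \<eta>) \<and>
         (L = Pos (Upair s s') \<and> strictly_maximal_lit lt (subst_lit L \<eta>) (subst_cls C \<eta>) \<or>
          L = Neg (Upair s s') \<and> maximal_lit lt (subst_lit L \<eta>) (subst_cls C \<eta>))"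
      by (intro exI[of _ s] exI[of _ s'] exI[of _ L] conjI L(1) w(1))
        (use ss' L(2) in \<open>simp_all only: s\<eta> s'\<eta> L\<eta> C\<eta>\<close>)
    ultimately show ?thesis
      unfolding superposition_conds_def Let_def DD'[symmetric]
      using gC gD D(3) smax uv_less unfolding t by blast
  qed
  have C_false: "\<not> cls_true cand (subst_cls C \<eta>)" using false by (simp add: closure_true_def instc)
  have conv: "(u, v) \<in> conversion cand"
    using rstepI[OF uv, of "[]" u] by (intro rstep_conversion) simp
  have p': "p \<in> poss (subst_trm s \<eta>)" using p(1) by (simp add: s\<eta>)
  from p' show False
  proof (cases rule: poss_subst_cases)
    case (1 f ts)
    let ?w = "subt_at s p"
    have w: "?w \<in> subterms s" using 1(1) by (simp add: subterms_def)
    have wu: "subst_trm ?w \<eta> = u" using subt_at_subst[OF 1(1), of \<eta>] p(2) by (simp add: s\<eta>)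
    have "unifier \<eta> t ?w" by (simp add: unifier_def t wu)
    then obtain \<sigma> where \<sigma>: "idem_mgu \<sigma> t ?w" "subst_comp \<sigma> \<eta> = \<eta>" by (rule idem_mgu_exists)
    let ?X = "D' + replace_cls ?w t' C"
    \<comment> \<open>Absorption of \<open>\<sigma>\<close> by \<open>\<eta>\<close> removes the
      unifier from the ground instance.\<close>
    have X: "subst_cls (subst_cls ?X \<sigma>) \<eta> = subst_cls ?X \<eta>" by (simp add: subst_cls_comp \<sigma>(2))
    have "vars_trm t' \<subseteq> vars_cls D" "vars_cls D' \<subseteq> vars_cls D"
      unfolding DD' by (auto simp: vars_cls_def sides_def)
    then have "ground_cls (subst_cls ?X \<eta>)"
      using gC gD vars_replace_cls[of ?w t' C] unfolding ground_subst_cls vars_cls_plus by blast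
    then have instk: "inst (gclo (subst_cls ?X \<sigma>) \<eta>) = subst_cls ?X \<eta>" using X inst_gclo by metis
    have "ParSup d (u, v) c (gclo (subst_cls ?X \<sigma>) \<eta>) \<in> ground_inferences lt"
      using ground_inferences.par_sup_I[OF conds[OF w wu] 1(2) _ \<sigma>(1)]
      by (simp add: t wu D_add c\<eta>[symmetric] d\<eta>[symmetric])
    from par_sup_concl_true[OF this N uv less min] have "cls_true cand (subst_cls ?X \<eta>)"
      by (simp add: closure_true_def instk)
    then show False
      using D'_false C_false cls_true_subst_replace[of ?w \<eta> t' cand C] conv
      by (simp add: subst_cls_plus cls_true_plus wu t)
  next
    case (2 q r x)
    have x_s: "x \<in> vars_trm s" using vars_subt_at[OF 2(2)] 2(3) by simp
    then have x: "x \<in> vars_cls C" using L(1) sides_L(1) unfolding vars_cls_def by blast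
    have w: "Var x \<in> subterms s" using 2(2,3) by (auto simp: subterms_def intro: rev_image_eqI)
    have qx: "subt_at (subst_trm s \<eta>) q = \<eta> x" using subt_at_subst[OF 2(2), of \<eta>] 2(3) by simp
    have r: "subt_at (\<eta> x) r = u"
      using subt_at_append[OF poss_subst[OF 2(2)], of \<eta> r] p(2) 2(1) qx by (simp add: s\<eta>)
    have wu: "subst_trm (Var x) \<eta> = u" if "p = []" using that 2(1) r by simp
    let ?\<eta> = "\<eta>(x := replace_at (\<eta> x) r v)"
    have D'x: "vars_cls D' \<subseteq> vars_cls D" unfolding DD' by (auto simp: vars_cls_def)
    have g\<eta>: "ground_trm (\<eta> y)" if "y \<in> vars_cls D \<union> vars_cls C" for y
      using that gC gD unfolding ground_subst_cls by blast
    have "ground_trm v" using candidate_terms(2)[OF uv] .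
    then have "ground_trm (replace_at (\<eta> x) r v)"
      using ground_replace_at[OF 2(4)] g\<eta> x by blast
    then have "ground_cls (subst_cls (D' + C) ?\<eta>)"
      using g\<eta> D'x unfolding ground_subst_cls vars_cls_plus by auto
    then have instk: "inst (gclo (D' + C) ?\<eta>) = subst_cls (D' + C) ?\<eta>" by (rule inst_gclo)
    have "ParSup d (u, v) c (gclo (D' + C) ?\<eta>) \<in> ground_inferences lt"
      using ground_inferences.par_sup_II[OF conds[OF w wu] 2(4)] r
      by (simp add: t D_add c\<eta>[symmetric] d\<eta>[symmetric])
    from par_sup_concl_true[OF this N uv less min] have *: "cls_true cand (subst_cls (D' + C) ?\<eta>)"
      by (simp add: closure_true_def instk)
    \<comment> \<open>The changed variable belongs to \<open>C\<close>, and the premises share no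
      variables.\<close>
    have "subst_cls D' ?\<eta> = subst_cls D' \<eta>"
      by (rule subst_cls_cong) (use D'x D(3) x in auto)
    moreover have "(\<eta> x, replace_at (\<eta> x) r v) \<in> conversion cand"
      by (rule rstep_conversion[OF rstepI[OF uv 2(4) r]])
    then have "cls_true cand (subst_cls C \<eta>) \<longleftrightarrow> cls_true cand (subst_cls C ?\<eta>)"
      by (intro cls_true_subst_conversion) simp
    ultimately show False
      using * D'_false C_false by (simp add: subst_cls_plus cls_true_plus)
  qed
qed

section \<open>Analysis of a minimal counterexample\<close>

lemma candidate_model:
  assumes "c \<in> N"
  shows "closure_true cand c"
proof (rule ccontr)
  assume "\<not> closure_true cand c"
  then have ne: "{c \<in> N. \<not> closure_true cand c} \<noteq> {}" using assms by blast
  have wf_N: "{c \<in> N. P c} \<subseteq> Collect (wf_closure F)" for P using N_wf by blast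
  obtain c where "c \<in> {c \<in> N. \<not> closure_true cand c}"
    and min': "\<forall>d \<in> {c \<in> N. \<not> closure_true cand c}. \<not> closure_less lt ltClo cand d c"
    using closure_less_minimal[OF closure_ordering wf_N ne, of cand] by (rule bexE)
  then have c: "c \<in> N" and false: "\<not> closure_true cand c" by simp_all
  have min: "closure_true cand e" if "e \<in> N" "closure_less lt ltClo cand e c" for e
    using min' that by blast
  note wf = N_wf[OF c] and horn = horn_inst[OF N_horn[OF c]]
  obtain C \<theta> where C: "c = gclo C \<theta>" "ground_cls (subst_cls C \<theta>)" by (rule gclo_cases)
  have instc: "inst c = subst_cls C \<theta>" unfolding C(1) by (rule inst_gclo[OF C(2)])
  have lit_false: "\<not> lit_true cand K" if "K \<in># inst c" for K
    using false that by (auto simp: closure_true_def cls_true_def)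
  have sides_terms: "t \<in> cls_terms (inst c)" if "K \<in># inst c" "t \<in> sides K" for K t
    using that subterms_refl unfolding cls_terms_def by blast
  note terms = inst_terms[OF wf sides_terms]
  have "inst c \<noteq> {#}"
  proof
    assume "inst c = {#}"
    then have "C = {#}" by (simp add: instc subst_cls_def)
    then have "c = bot_closure"
      using gclo_cong[OF C(2), of Var] by (simp add: C(1) bot_closure_def vars_cls_def)
    then show False using c no_bot by simp
  qed
  then have "\<exists>M \<in># inst c. \<forall>K \<in># inst c. K \<noteq> M \<longrightarrow> \<not> lit_less lt M K"
    by (intro Finite_Set.bex_max_element transp_on_subset[OF lit_less_transp subset_UNIV]
        asymp_on_subset[OF wfp_imp_asymp[OF lit_less_wfp] subset_UNIV]) simp_all
  then obtain M where M: "M \<in># inst c" "\<forall>K \<in># inst c. K \<noteq> M \<longrightarrow> \<not> lit_less lt M K" ..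
  have Mmax: "\<not> lit_less lt M K" if "K \<in># inst c" for K
    using M(2) that lit_less_asym[of M M] by (cases "K = M") auto
  obtain L where L: "L \<in># C" "M = subst_lit L \<theta>" using M(1) unfolding instc by (rule subst_cls_memE)
  obtain s s' where ss': "atm L = Upair s s'"
    and le: "subst_trm s \<theta> = subst_trm s' \<theta> \<or> lt (subst_trm s' \<theta>) (subst_trm s \<theta>)"
  proof -
    obtain a b where ab: "atm L = Upair a b" by (cases "atm L")
    then have "subst_trm a \<theta> \<in> sides M" "subst_trm b \<theta> \<in> sides M"
      by (auto simp: L(2) sides_subst_lit) (simp_all add: sides_def)
    then have "subst_trm a \<theta> = subst_trm b \<theta> \<or> lt (subst_trm a \<theta>) (subst_trm b \<theta>) \<or>
      lt (subst_trm b \<theta>) (subst_trm a \<theta>)"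
      using lt_total terms[OF M(1)] by blast
    then show thesis using that[of a b] that[of b a] ab by auto
  qed
  let ?a = "subst_trm s \<theta>" and ?b = "subst_trm s' \<theta>"
  have sL: "s \<in> sides L" using ss' by (simp add: sides_def)
  have sides_M: "sides M = {?a, ?b}"
    unfolding L(2) sides_subst_lit by (simp add: sides_def ss')
  note a_terms = terms[OF M(1), of ?a] and b_terms = terms[OF M(1), of ?b]
  have a: "wf_trm F ?a" "ground_trm ?a" and b: "wf_trm F ?b" "ground_trm ?b"
    using a_terms b_terms sides_M by simp_all
  note R = candidate_reduced
  show False
  proof (cases L)
    case (Neg A)
    then have LN: "L = Neg (Upair s s')" using ss' by simp
    have MN: "M = Neg (Upair ?a ?b)" unfolding L(2) LN subst_lit_Upair ..
    have max: "maximal_lit lt (subst_lit L \<theta>) (subst_cls C \<theta>)"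
      unfolding maximal_lit_def L(2)[symmetric] instc[symmetric] using M(1) Mmax in_diffD by metis
    show False
    proof (cases "?a = ?b")
      case True
      define C' where "C' = C - {#L#}"
      have CC': "C = C' + {#Neg (Upair s s')#}" using L(1) by (simp add: C'_def LN)
      have "unifier \<theta> s s'" by (simp add: unifier_def True)
      then obtain \<sigma> where \<sigma>: "idem_mgu \<sigma> s s'" "subst_comp \<sigma> \<theta> = \<theta>" by (rule idem_mgu_exists)
      have "EqRes c (gclo (subst_cls C' \<sigma>) \<theta>) \<in> ground_inferences lt"
        using ground_inferences.eq_res[of C' s s' \<theta> \<sigma> lt] C(2) True \<sigma>(1) max[unfolded LN]
        unfolding CC'[symmetric] C(1) by blast
      from eq_res_concl_true[OF this c min] have "closure_true cand (gclo (subst_cls C' \<sigma>) \<theta>)" .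
      moreover have X: "subst_cls (subst_cls C' \<sigma>) \<theta> = subst_cls C' \<theta>" by (simp add: subst_cls_comp \<sigma>(2))
      have "ground_cls (subst_cls C' \<theta>)"
        using C(2) unfolding CC' ground_subst_cls vars_cls_plus by blast
      then have "inst (gclo (subst_cls C' \<sigma>) \<theta>) = subst_cls C' \<theta>" using X inst_gclo by metis
      ultimately have "cls_true cand (subst_cls C' \<theta>)" by (simp add: closure_true_def)
      then have "cls_true cand (inst c)" unfolding instc CC' subst_cls_plus cls_true_plus by blast
      then show False using false by (simp add: closure_true_def)
    next
      case False
      then have less: "lt ?b ?a" using le by blast
      have "(?a, ?b) \<in> conversion cand" using lit_false[OF M(1)] by (simp add: MN eq_true_Upair)
      then have nf: "normal_form cand ?a = normal_form cand ?b"
        using conversion_iff_normal_form[OF R a(1) b(1)] by blast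
      \<comment> \<open>Otherwise \<open>?a\<close> would be the normal form of the smaller term
        \<open>?b\<close>.\<close>
      have "\<not> irreducible cand ?a"
      proof
        assume "irreducible cand ?a"
        then have "normal_form cand ?b = ?a" using nf normal_form_irreducible[OF R a(1)] by simp
        then show False using normal_form_le[OF R b(1)] less lt_asym lt_irrefl by metis
      qed
      then obtain u v p where uv: "(u, v) \<in> cand" "p \<in> poss ?a" "subt_at ?a p = u"
        by (auto simp: irreducible_def elim: rstepE)
      obtain d where d: "d \<in> N" "eligible lt (below u cand) d u v"
        by (rule candidate_producer[OF uv(1)]) blast
      have ua: "lt u ?a \<or> u = ?a" using subterm_le[of u ?a] a uv(2,3) by (auto simp: subterms_def)
      have vu: "lt v u" using candidate_terms(3)[OF uv(1)] .
      \<comment> \<open>\<open>u = ?a\<close> is possible here; then the doubled sides of the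
        negative literal \<open>M\<close> put the produced equation below it.\<close>
      have cls: "cls_less lt (inst d) (inst c)"
      proof (rule cls_less_dominated[OF M(1)])
        fix K assume K: "K \<in># inst d"
        have aM: "?a \<in> sides M" by (simp add: sides_M)
        show "lit_less lt K M"
        proof (cases "K = Pos (Upair u v)")
          case True
          from ua show ?thesis
          proof
            assume less: "lt u ?a"
            show ?thesis
              by (rule lit_less_dominated[OF aM]) (use less lt_trans[OF vu less] True in \<open>auto simp: sides_def\<close>)
          next
            assume "u = ?a"
            then show ?thesis unfolding True using lit_less_Pos_Neg[OF vu] aM MN by simp
          qed
        next
          case False
          then have "K \<in># inst d - {#Pos (Upair u v)#}" using K by (intro in_minus_single)
          from eligible_literals(2)[OF N_horn[OF d(1)] d(2) this] ua lt_trans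
          show ?thesis by (intro lit_less_dominated[OF aM]) blast
        qed
      qed
      have "closure_less lt ltClo cand d c"
        unfolding C(1)
        by (rule producer_less[OF R uv(1) N_wf[OF d(1)] d(2) wf[unfolded C(1)] C(2) L(1) sL uv(2,3)])
          (simp add: LN)
      from superposition_contradiction[OF d(1) c uv(1) d(2) false min this C L(1) _ less uv(2,3) cls]
      show False using max LN by blast
    qed
  next
    case (Pos A)
    then have LP: "L = Pos (Upair s s')" using ss' by simp
    have MP: "M = Pos (Upair ?a ?b)" unfolding L(2) LP subst_lit_Upair ..
    have neg: "\<not> is_Pos K" if "K \<in># inst c - {#M#}" for K
      using horn_pos_unique[OF horn M(1) _ that] by (simp add: MP)
    have smax: "strictly_maximal_lit lt (subst_lit L \<theta>) (subst_cls C \<theta>)"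
      unfolding strictly_maximal_lit_def L(2)[symmetric] instc[symmetric]
      using M(1) Mmax neg in_diffD MP by (metis literal.disc(1))
    have "?a \<noteq> ?b" using lit_false[OF M(1)] by (auto simp: MP eq_true_Upair)
    then have less: "lt ?b ?a" using le by blast
    show False
    \<comment> \<open>If a rule with a smaller left-hand side applies, the overlap is strictly below
      the top and the producer is smaller. If none applies, \<open>c\<close> itself competes for
      producing a rule for \<open>?a\<close>.\<close>
    proof (cases "irreducible (below ?a cand) ?a")
      case False
      then obtain u v p where uv: "(u, v) \<in> below ?a cand" "p \<in> poss ?a" "subt_at ?a p = u"
        by (auto simp: irreducible_def elim: rstepE)
      then have uv': "(u, v) \<in> cand" and ua: "lt u ?a" by auto
      have p: "p \<noteq> []" using uv(3) ua lt_irrefl by auto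
      obtain d where d: "d \<in> N" "eligible lt (below u cand) d u v"
        by (rule candidate_producer[OF uv']) blast
      have vu: "lt v u" using candidate_terms(3)[OF uv'] .
      have cls: "cls_less lt (inst d) (inst c)"
      proof (rule cls_less_dominated[OF M(1)])
        fix K assume K: "K \<in># inst d"
        have "lt t ?a" if "t \<in> sides K" for t
        proof -
          have "t \<in> cls_terms (inst d)" using K that subterms_refl unfolding cls_terms_def by blast
          then show ?thesis using eligible_terms[OF d(2)] ua lt_trans by blast
        qed
        then show "lit_less lt K M" by (intro lit_less_dominated[of ?a]) (simp_all add: sides_M)
      qed
      have "closure_less lt ltClo cand d c"
        unfolding C(1)
        by (rule producer_less[OF R uv' N_wf[OF d(1)] d(2) wf[unfolded C(1)] C(2) L(1) sL uv(2,3) p])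
      from superposition_contradiction[OF d(1) c uv' d(2) false min this C L(1) _ less uv(2,3) cls]
      show False using smax LP by blast
    next
      case True
      \<comment> \<open>A negative literal with a side equal to or above \<open>?a\<close> would
        exceed \<open>M\<close>, which was chosen maximal.\<close>
      have neg_less: "lt t ?a" if K: "K \<in># inst c - {#M#}" and t: "t \<in> sides K" for K t
      proof (rule ccontr)
        assume "\<not> lt t ?a"
        note K' = in_diffD[OF K]
        have "t = ?a \<or> lt ?a t" using \<open>\<not> lt t ?a\<close> lt_total[of t ?a] terms[OF K' t] a by blast
        then have "lit_less lt M K"
        proof
          assume "t = ?a"
          then show ?thesis unfolding MP using lit_less_Pos_Neg[OF less] t neg[OF K] by blast
        next
          assume "lt ?a t"
          then show ?thesis
            using lt_trans[OF less] by (intro lit_less_dominated[OF t]) (auto simp: sides_M)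
        qed
        then show False using Mmax[OF K'] by blast
      qed
      have in_rest: "K \<in># inst c - {#M#}" if "K \<in># inst c" "K \<noteq> M" for K
        using that by (rule in_minus_single)
      have el: "eligible lt (below ?a cand) c ?a ?b"
        unfolding eligible_def
      proof (intro conjI ballI impI)
        show "Pos (Upair ?a ?b) \<in># inst c" using M(1) MP by simp
        show "irreducible (below ?a cand) ?a" "lt ?b ?a" by (fact True less)+
      next
        fix K t t' assume K: "K \<in># inst c" and t: "t \<in> sides K" and t': "t' \<in> subterms t" "t' \<noteq> ?a"
        have "lt t ?a \<or> t = ?a"
        proof (cases "K = M")
          case True
          then show ?thesis using t less by (auto simp: sides_M)
        qed (use neg_less[OF in_minus_single[OF K] t] in blast)
        then show "lt t' ?a" using le_trans[OF subterm_le[OF t'(1) terms[OF K t]]] t'(2) by blast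
      next
        show "?a \<notin> ss_neg (inst c)"
        proof
          assume "?a \<in> ss_neg (inst c)"
          then obtain K t where K: "K \<in># inst c" "\<not> is_Pos K" "t \<in> sides K" "?a \<in> subterms t"
            by (auto simp: ss_neg_def)
          then have "K \<noteq> M" using MP by auto
          then have "lt t ?a" using neg_less[OF in_minus_single[OF K(1)] K(3)] by blast
          then show False using le_lt_trans[OF subterm_le[OF K(4) terms[OF K(1,3)]]] lt_irrefl by blast
        qed
      next
        \<comment> \<open>The positive literal stays false with fewer rules. The negative ones have
          sides below \<open>?a\<close>, whose normal forms use only rules below \<open>?a\<close>,
          so their equations still hold.\<close>
        have "\<not> lit_true (below ?a cand) K" if K: "K \<in># inst c" for K
        proof (cases "K = M")
          case True
          then show ?thesis
            using lit_false[OF M(1)] conversion_mono[of "below ?a cand" cand]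
            by (auto simp: MP eq_true_Upair)
        next
          case False
          note K' = in_minus_single[OF K False]
          obtain x y where xy: "K = Neg (Upair x y)"
            using neg[OF K'] by (cases K; cases "atm K") auto
          have x: "lt x ?a" "wf_trm F x" "ground_trm x" and y: "lt y ?a" "wf_trm F y" "ground_trm y"
            using neg_less[OF K'] terms[OF K] by (simp_all add: xy sides_def)
          have "(x, y) \<in> conversion cand" using lit_false[OF K] by (simp add: xy eq_true_Upair)
          then have "(x, y) \<in> conversion (below ?a cand)"
            using conversion_iff_normal_form[OF R x(2) y(2)]
              conversion_iff_normal_form[OF below_reduced x(2) y(2)]
              below_eqs[OF R x(1,3)] below_eqs[OF R y(1,3)] by simp
          then show ?thesis by (simp add: xy eq_true_Upair)
        qed
        then show "\<not> closure_true (below ?a cand) c" by (simp add: closure_true_def cls_true_def)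
      qed
      let ?S = "{e \<in> N. \<exists>w. eligible lt (below ?a cand) e ?a w}"
      have ne': "?S \<noteq> {}" using el c by blast
      obtain d where "d \<in> ?S" and dmin: "\<forall>e \<in> ?S. \<not> closure_less lt ltClo (below ?a cand) e d"
        using closure_less_minimal[OF closure_ordering wf_N ne', of "below ?a cand"] by (rule bexE)
      then obtain v where d: "d \<in> N" "eligible lt (below ?a cand) d ?a v" by blast
      have d_less: "closure_less lt ltClo (below ?a cand) d e"
        if e: "e \<in> N" "e \<noteq> d" "eligible lt (below ?a cand) e ?a w" for e w
      proof -
        have "e \<in> ?S" using e by blast
        with dmin have "\<not> closure_less lt ltClo (below ?a cand) e d" by (rule bspec)
        then show ?thesis
          using closure_less_total[OF closure_ordering below_reduced N_wf[OF d(1)] N_wf[OF e(1)] e(2)[symmetric]]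
          by (meson)
      qed
      \<comment> \<open>Some eligible closure exists because \<open>c\<close> is one, so the least
        of them produces a rule. That rule makes its producer \<open>d\<close> true, hence the false
        \<open>c\<close> differs from \<open>d\<close>.\<close>
      have uv: "(?a, v) \<in> cand" by (rule candidate_ruleI[OF a(2) d d_less])
      have "closure_true cand d"
      proof -
        have "(?a, v) \<in> conversion cand"
          using rstepI[OF uv, of "[]" ?a] by (intro rstep_conversion) simp
        then show ?thesis
          using eligible_mem[OF d(2)] unfolding closure_true_def cls_true_def
          by (intro bexI[of _ "Pos (Upair ?a v)"]) (simp_all add: eq_true_Upair)
      qed
      then have "c \<noteq> d" using false by blast
      then have below_less: "closure_less lt ltClo (below ?a cand) d c"
        by (rule d_less[OF c _ el])
      have less_dc: "closure_less lt ltClo cand d c"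
        by (rule closure_less_shift[OF below_less nm_shift[OF R uv N_wf[OF d(1)] N_horn[OF d(1)] d(2)]
            nm_shift[OF R uv wf N_horn[OF c] el]])
      \<comment> \<open>With \<open>?a\<close> at the top of positive literals only, the clause
        comparison required of a superposition is vacuous.\<close>
      have top_only: "?a \<notin> ss_neg (inst c) \<union> ss_pos_below (inst c)"
        using eligible_not_neg[OF el] eligible_not_pos_below[OF wf el] by blast
      show False
        by (rule superposition_contradiction[OF d(1) c uv d(2) false min less_dc C L(1) _ less, of "[]"])
          (use top_only smax LP in simp_all)
    qed
  qed
qed

end

theorem theorem1:
  fixes F :: "('f \<times> nat) set"
    and lt :: "('f, 'v) trm \<Rightarrow> ('f, 'v) trm \<Rightarrow> bool"
    and ltClo :: "('f, 'v) gclosure \<Rightarrow> ('f, 'v) gclosure \<Rightarrow> bool"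
    and N :: "('f, 'v) gclosure set"
  assumes "infinite (UNIV :: 'v set)"
    and "reduction_ordering F lt"
    and "totalp_on {t. wf_trm F t \<and> ground_trm t} lt"
    and "closure_ordering F ltClo"
    and "\<forall>c \<in> N. wf_closure F c \<and> horn_closure c"
    and "saturated lt ltClo N"
    and "bot_closure \<notin> N"
  shows "\<forall>c \<in> N. closure_true (candidate lt ltClo N) c"
proof -
  interpret saturated_closures F lt ltClo N
    by unfold_locales (fact assms)+
  show ?thesis using candidate_model by blast
qed

end
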